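(* Let $W:\mathcal{X}\to\mathcal{S}(B)$ be a cq-channel, $\widetilde{\mathcal{X}}=W(\mathcal{X})$ and $\sqrt{\widetilde{\mathcal{X}}}=\{\sqrt{\sigma}:\sigma\in\widetilde{\mathcal{X}}\}$. Then for any $\lambda_1,\lambda_2>0$ with $\lambda_1+\lambda_2<1$, \[ \frac14\,\overline{d}_M\!\left(\sqrt{\widetilde{\mathcal{X}}}\right)\le\dot{C}^{\rm opt}_{\rm DI}(W)\le\limsup_{n\to\infty}\frac{1}{n\log n}\log N_{\rm DI}(n,\lambda_1,\lambda_2)\le\frac12\,\overline{d}_M\!\left(\sqrt{\widetilde{\mathcal{X}}}\right). \] Similarly, for a quantum channel $\mathcal{N}:A\to B$ and a set $\mathcal{X}\subset\mathcal{S}(A)$ of allowed product-input states, with $\widetilde{\mathcal{X}}=\mathcal{N}(\mathcal{X})$: $\frac14\overline{d}_M(\sqrt{\widetilde{\mathcal{X}}})\le\dot{C}^{\rm opt}_{\rm DI}(\mathcal{N}|_{\mathcal{X}})\le\frac12\overline{d}_M(\sqrt{\widetilde{\mathcal{X}}})$.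
   Context: A cq-channel is a measurable map $W:\mathcal{X}\to\mathcal{S}(B)$ from a measure space to density operators on a finite-dimensional Hilbert space $B$; $W_{x^n}=W_{x_1}\otimes\cdots\otimes W_{x_n}$. An $(n,N,\lambda_1,\lambda_2)$-DI code for $W$ is $\{(u_j,E_j):j\in[N]\}$, $u_j\in\mathcal{X}^n$, $0\le E_j\le\mathbb{1}$ on $B^{\otimes n}$, with $\operatorname{Tr}W_{u_j}E_j\ge1-\lambda_1$ and $\operatorname{Tr}W_{u_j}E_k\le\lambda_2$ for all $j\neq k$; $N_{\rm DI}(n,\lambda_1,\lambda_2)$ is the largest such $N$. The optimistic slightly superlinear DI capacity is $\dot{C}^{\rm opt}_{\rm DI}(W)=\inf_{\lambda_1,\lambda_2>0}\limsup_{n\to\infty}\frac{1}{n\log n}\log N_{\rm DI}(n,\lambda_1,\lambda_2)$ (logs base 2). For a quantum channel, a DI $\mathcal{X}$-code uses product inputs $\rho_j=\rho_j^{(1)}\otimes\cdots\otimes\rho_j^{(n)}$ with $\rho_j^{(i)}\in\mathcal{X}$ and satisfies $\operatorname{Tr}\mathcal{N}^{\otimes n}(\rho_j)E_j\ge1-\lambda_1$, $\operatorname{Tr}\mathcal{N}^{\otimes n}(\rho_k)E_j\le\lambda_2$ for $j\ne k$; $\dot{C}^{\rm opt}_{\rm DI}(\mathcal{N}|_{\mathcal{X}})$ is defined analogously with $\limsup$. For a set $F$ of operators metrized by the Hilbert–Schmidt norm, $\Pi_\delta(F)$ is the maximal number of points of $F$ with pairwise distance at least $\delta$, and $\overline{d}_M(F)=\limsup_{\delta\to0}\frac{\log\Pi_\delta(F)}{-\log\delta}$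 is the upper Minkowski dimension. *)

theory Defs
  imports "HOL-Analysis.Analysis" "HOL-Library.Liminf_Limsup" "HOL-Library.Extended_Nat"
    "Jordan_Normal_Form.Matrix"
begin

(* Operators on a d-dimensional Hilbert space C^d are complex d x d matrices. *)

definition adj :: "complex mat \<Rightarrow> complex mat" where
  "adj A = mat (dim_col A) (dim_row A) (\<lambda>(i,j). cnj (A $$ (j,i)))"

definition tr :: "complex mat \<Rightarrow> complex" where
  "tr A = (\<Sum>i<dim_row A. A $$ (i,i))"

definition psd :: "nat \<Rightarrow> complex mat \<Rightarrow> bool" where
  "psd d A \<longleftrightarrow> A \<in> carrier_mat d d \<and>
     (\<forall>v \<in> carrier_vec d.
        let q = (\<Sum>i<d. \<Sum>j<d. cnj (v $ i) * A $$ (i,j) * v $ j) in Im q = 0 \<and> Re q \<ge> 0)"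

definition density :: "nat \<Rightarrow> complex mat \<Rightarrow> bool" where
  "density d \<rho> \<longleftrightarrow> psd d \<rho> \<and> tr \<rho> = 1"

definition effect :: "nat \<Rightarrow> complex mat \<Rightarrow> bool" where
  "effect d E \<longleftrightarrow> psd d E \<and> psd d (1\<^sub>m d - E)"

definition kron :: "complex mat \<Rightarrow> complex mat \<Rightarrow> complex mat" where
  "kron A B = mat (dim_row A * dim_row B) (dim_col A * dim_col B)
     (\<lambda>(i,j). A $$ (i div dim_row B, j div dim_col B) * B $$ (i mod dim_row B, j mod dim_col B))"

definition kron_list :: "complex mat list \<Rightarrow> complex mat" where
  "kron_list As = foldr kron As (1\<^sub>m 1)"

definition tensor_word :: "('x \<Rightarrow> complex mat) \<Rightarrow> nat \<Rightarrow> (nat \<Rightarrow> 'x) \<Rightarrow> complex mat" where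
  "tensor_word W n u = kron_list (map (\<lambda>i. W (u i)) [0..<n])"

definition di_code :: "('x \<Rightarrow> complex mat) \<Rightarrow> 'x set \<Rightarrow> nat \<Rightarrow> nat \<Rightarrow> nat \<Rightarrow> real \<Rightarrow> real
      \<Rightarrow> (nat \<Rightarrow> nat \<Rightarrow> 'x) \<Rightarrow> (nat \<Rightarrow> complex mat) \<Rightarrow> bool" where
  "di_code W X d n N l1 l2 u E \<longleftrightarrow>
     (\<forall>j<N. \<forall>i<n. u j i \<in> X) \<and>
     (\<forall>j<N. effect (d ^ n) (E j)) \<and>
     (\<forall>j<N. Re (tr (tensor_word W n (u j) * E j)) \<ge> 1 - l1) \<and>
     (\<forall>j<N. \<forall>k<N. j \<noteq> k \<longrightarrow> Re (tr (tensor_word W n (u j) * E k)) \<le> l2)"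

definition N_DI :: "('x \<Rightarrow> complex mat) \<Rightarrow> 'x set \<Rightarrow> nat \<Rightarrow> nat \<Rightarrow> real \<Rightarrow> real \<Rightarrow> enat" where
  "N_DI W X d n l1 l2 = Sup {enat N | N. \<exists>u E. di_code W X d n N l1 l2 u E}"

definition di_rate :: "('x \<Rightarrow> complex mat) \<Rightarrow> 'x set \<Rightarrow> nat \<Rightarrow> real \<Rightarrow> real \<Rightarrow> nat \<Rightarrow> ereal" where
  "di_rate W X d l1 l2 n = (case N_DI W X d n l1 l2 of
       enat N \<Rightarrow> ereal (log 2 (real N) / (real n * log 2 (real n)))
     | \<infinity> \<Rightarrow> \<infinity>)"

definition di_limsup :: "('x \<Rightarrow> complex mat) \<Rightarrow> 'x set \<Rightarrow> nat \<Rightarrow> real \<Rightarrow> real \<Rightarrow> ereal" where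
  "di_limsup W X d l1 l2 = limsup (di_rate W X d l1 l2)"

definition C_DI_opt :: "('x \<Rightarrow> complex mat) \<Rightarrow> 'x set \<Rightarrow> nat \<Rightarrow> ereal" where
  "C_DI_opt W X d = (INF l1 \<in> {0<..}. INF l2 \<in> {0<..}. di_limsup W X d l1 l2)"

definition hs_dist :: "complex mat \<Rightarrow> complex mat \<Rightarrow> real" where
  "hs_dist A B = sqrt (\<Sum>i<dim_row A. \<Sum>j<dim_col A. (cmod (A $$ (i,j) - B $$ (i,j)))\<^sup>2)"

definition packing_num :: "real \<Rightarrow> complex mat set \<Rightarrow> enat" where
  "packing_num \<delta> F = Sup {enat (card S) | S. S \<subseteq> F \<and> finite S \<and>
      (\<forall>x\<in>S. \<forall>y\<in>S. x \<noteq> y \<longrightarrow> hs_dist x y \<ge> \<delta>)}"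

definition upper_mink_dim :: "complex mat set \<Rightarrow> ereal" where
  "upper_mink_dim F = Limsup (at_right 0) (\<lambda>\<delta>. case packing_num \<delta> F of
       enat N \<Rightarrow> ereal (log 2 (real N) / (- log 2 \<delta>))
     | \<infinity> \<Rightarrow> \<infinity>)"

definition mat_sqrt :: "nat \<Rightarrow> complex mat \<Rightarrow> complex mat" where
  "mat_sqrt d \<sigma> = (THE S. psd d S \<and> S * S = \<sigma>)"

definition block :: "nat \<Rightarrow> complex mat \<Rightarrow> nat \<Rightarrow> nat \<Rightarrow> complex mat" where
  "block dA M a b = mat dA dA (\<lambda>(r,s). M $$ (a * dA + r, b * dA + s))"

definition id_tensor :: "nat \<Rightarrow> nat \<Rightarrow> nat \<Rightarrow> (complex mat \<Rightarrow> complex mat) \<Rightarrow> complex mat \<Rightarrow> complex mat" where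
  "id_tensor k dA dB \<N> M = mat (k * dB) (k * dB)
     (\<lambda>(i,j). \<N> (block dA M (i div dB) (j div dB)) $$ (i mod dB, j mod dB))"

definition quantum_channel :: "nat \<Rightarrow> nat \<Rightarrow> (complex mat \<Rightarrow> complex mat) \<Rightarrow> bool" where
  "quantum_channel dA dB \<N> \<longleftrightarrow>
     (\<forall>A \<in> carrier_mat dA dA. \<N> A \<in> carrier_mat dB dB) \<and>
     (\<forall>A \<in> carrier_mat dA dA. \<forall>B \<in> carrier_mat dA dA. \<forall>c::complex.
         \<N> (c \<cdot>\<^sub>m A + B) = c \<cdot>\<^sub>m \<N> A + \<N> B) \<and>
     (\<forall>A \<in> carrier_mat dA dA. tr (\<N> A) = tr A) \<and>
     (\<forall>k. \<forall>M. psd (k * dA) M \<longrightarrow> psd (k * dB) (id_tensor k dA dB \<N> M))"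

(* DI X-codes for a quantum channel with product inputs rho_j = rho_j^(1) \<otimes> ... \<otimes> rho_j^(n),
   rho_j^(i) \<in> X: by linearity N^{\<otimes>n}(rho_j) = N(rho_j^(1)) \<otimes> ... \<otimes> N(rho_j^(n)),
   i.e. tensor_word \<N> n (u j). Hence the capacity restricted to X is that of the
   cq-channel x \<mapsto> N(x) on X. *)
definition C_DI_opt_q :: "(complex mat \<Rightarrow> complex mat) \<Rightarrow> complex mat set \<Rightarrow> nat \<Rightarrow> ereal" where
  "C_DI_opt_q \<N> X dB = (INF l1 \<in> {0<..}. INF l2 \<in> {0<..}.
      limsup (\<lambda>n. case Sup {enat N | N. \<exists>\<rho> E.
          (\<forall>j<N. \<forall>i<n. \<rho> j i \<in> X) \<and>
          (\<forall>j<N. effect (dB ^ n) (E j)) \<and>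
          (\<forall>j<N. Re (tr (kron_list (map (\<lambda>i. \<N> (\<rho> j i)) [0..<n]) * E j)) \<ge> 1 - l1) \<and>
          (\<forall>j<N. \<forall>k<N. j \<noteq> k \<longrightarrow> Re (tr (kron_list (map (\<lambda>i. \<N> (\<rho> k i)) [0..<n]) * E j)) \<le> l2)}
        of enat N \<Rightarrow> ereal (log 2 (real N) / (real n * log 2 (real n)))
         | \<infinity> \<Rightarrow> \<infinity>))"

end

theory Submission
  imports Defs "Jordan_Normal_Form.Schur_Decomposition" "Jordan_Normal_Form.Spectral_Radius"
    "HOL-Real_Asymp.Real_Asymp"
begin

text \<open>Everything rests on the affinity \<open>tr (sqrt \<rho> sqrt \<sigma>)\<close>, which equals
  \<open>1 - h^2 / 2\<close> for the Hilbert--Schmidt distance \<open>h\<close> of the square roots and is multiplicative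
  under tensor products.

  Upper bound: if two codewords are letterwise within \<open>2 \<delta>\<close> and \<open>\<delta>\<close> is a small multiple of
  \<open>n powr (-1/2)\<close>, their output states are too close for any effect to tell them apart. Hence rounding
  letters to a maximal \<open>\<delta>\<close>-packing is injective on codewords, and \<open>log \<delta> ~ - (log n) / 2\<close> gives
  the factor 1/2.

  Lower bound: take words over a \<open>\<delta>\<close>-packing, pairwise far apart in Hamming distance
  (Gilbert--Varshamov), all of nearly the same output entropy \<open>H\<close> (pigeonhole). As tests use the typical
  spectral projections of the output states. In both eigenbases the typical eigenvalues are
  \<open>exp (- H)\<close> up to a factor \<open>exp (O (sqrt n))\<close>, so the second error is at most a small tail plus
  \<open>exp (O (sqrt n)) tr (sqrt \<rho> sqrt \<sigma>)\<close>, and the trace is at most \<open>exp (- c n \<delta>^2)\<close>.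
  Thus \<open>\<delta>\<close> a large multiple of \<open>n powr (-1/4)\<close> suffices, which gives the factor 1/4.\<close>

section \<open>Matrices and unitary diagonalization\<close>

text \<open>The obstacle in the lower bound is a mismatch of scales: the typical test of a word
  \<open>w'\<close> sees the state of \<open>w\<close> with a prefactor
  \<open>exp ((H w' - H w) / 2)\<close>, which for unrelated words can be exponential in n and would
  swamp the affinity. Sorting words by entropy removes it cheaply: entropies lie in an interval of
  length n d, so bins of width \<open>sqrt n\<close> number about d \<open>sqrt n\<close>. Hamming
  balls are likewise counted with a crude factor 2^n. Both cost O(n) bits, which is invisible on the
  scale n log n. So is every constant that depends on the errors; hence the lower bound has the same
  value for all positive \<open>l1\<close>, \<open>l2\<close> and survives the infimum. The
  fluctuations of order \<open>sqrt n\<close> are uniform over all states, including those with tiny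
  eigenvalues, because x (ln x)^2 is bounded on [0,1]. The two limits superior are matched in
  opposite directions: the upper bound computes \<delta> from n, whereas the lower bound has to
  compute n from \<delta>, since the upper dimension promises large packings only for some \<delta>
  arbitrarily close to 0.\<close>

definition unitary_mat :: "nat \<Rightarrow> complex mat \<Rightarrow> bool" where
  "unitary_mat n U \<longleftrightarrow> U \<in> carrier_mat n n \<and> adj U * U = 1\<^sub>m n"

definition real_diag :: "nat \<Rightarrow> (nat \<Rightarrow> real) \<Rightarrow> complex mat" where
  "real_diag n p = mat n n (\<lambda>(i,j). if i = j then of_real (p i) else 0)"

text \<open>Fixing the eigenbasis \<open>U\<close> and varying \<open>p\<close> is the functional
  calculus: roots, products and spectral projections of a state all become pointwise operations on
  \<open>p\<close>.\<close>

definition spec_mat :: "nat \<Rightarrow> complex mat \<Rightarrow> (nat \<Rightarrow> real) \<Rightarrow> complex mat" where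
  "spec_mat n U p = U * real_diag n p * adj U"

lemma mat_mult_entry:
  assumes "A \<in> carrier_mat m n" "B \<in> carrier_mat n k" "i < m" "j < k"
  shows "(A * B) $$ (i,j) = (\<Sum>l<n. A $$ (i,l) * B $$ (l,j))"
  using assms by (auto simp: scalar_prod_def lessThan_atLeast0 intro!: sum.cong)

lemma adj_dim [simp]: "dim_row (adj A) = dim_col A" "dim_col (adj A) = dim_row A"
  by (simp_all add: adj_def)

lemma adj_carrier [simp]: "A \<in> carrier_mat m n \<Longrightarrow> adj A \<in> carrier_mat n m"
  by (auto simp: adj_def)

lemma adj_entry [simp]: "i < dim_col A \<Longrightarrow> j < dim_row A \<Longrightarrow> adj A $$ (i,j) = cnj (A $$ (j,i))"
  by (simp add: adj_def)

lemma adj_adj [simp]: "adj (adj A) = A"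
  by (rule eq_matI) auto

lemma adj_mult:
  assumes "A \<in> carrier_mat m n" "B \<in> carrier_mat n k"
  shows "adj (A * B) = adj B * adj A"
proof (rule eq_matI)
  fix i j assume "i < dim_row (adj B * adj A)" "j < dim_col (adj B * adj A)"
  hence ij: "i < k" "j < m" using assms by auto
  have "adj (A * B) $$ (i,j) = cnj (\<Sum>l<n. A $$ (j,l) * B $$ (l,i))"
    using ij assms mat_mult_entry[OF assms ij(2,1)] by simp
  also have "\<dots> = (\<Sum>l<n. adj B $$ (i,l) * adj A $$ (l,j))"
    using ij assms by (auto intro!: sum.cong)
  also have "\<dots> = (adj B * adj A) $$ (i,j)"
    using mat_mult_entry[OF adj_carrier[OF assms(2)] adj_carrier[OF assms(1)] ij] by simp
  finally show "adj (A * B) $$ (i,j) = (adj B * adj A) $$ (i,j)" .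
qed (use assms in auto)

lemma adj_one [simp]: "adj (1\<^sub>m n) = 1\<^sub>m n"
  by (rule eq_matI) auto

lemma real_diag_carrier [simp]: "real_diag n p \<in> carrier_mat n n"
  by (simp add: real_diag_def)

lemma real_diag_dim [simp]: "dim_row (real_diag n p) = n" "dim_col (real_diag n p) = n"
  by (simp_all add: real_diag_def)

lemma adj_real_diag [simp]: "adj (real_diag n p) = real_diag n p"
  by (rule eq_matI) (auto simp: real_diag_def)

lemma real_diag_mult: "real_diag n p * real_diag n q = real_diag n (\<lambda>i. p i * q i)"
proof (rule eq_matI)
  fix i j assume "i < dim_row (real_diag n (\<lambda>i. p i * q i))" "j < dim_col (real_diag n (\<lambda>i. p i * q i))"
  hence ij: "i < n" "j < n" by auto
  have "(real_diag n p * real_diag n q) $$ (i,j)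
      = (\<Sum>l<n. real_diag n p $$ (i,l) * real_diag n q $$ (l,j))"
    by (rule mat_mult_entry[OF _ _ ij]) auto
  also have "\<dots> = (\<Sum>l<n. if l = i then (if i = j then of_real (p i * q i) else 0) else 0)"
    using ij by (intro sum.cong) (auto simp: real_diag_def)
  also have "\<dots> = real_diag n (\<lambda>i. p i * q i) $$ (i,j)"
    using ij by (auto simp: real_diag_def)
  finally show "(real_diag n p * real_diag n q) $$ (i,j) = real_diag n (\<lambda>i. p i * q i) $$ (i,j)" .
qed auto

lemma mult_real_diag_entry:
  assumes "A \<in> carrier_mat m n" "i < m" "j < n"
  shows "(A * real_diag n p) $$ (i,j) = A $$ (i,j) * of_real (p j)"
proof -
  have "(A * real_diag n p) $$ (i,j) = (\<Sum>l<n. A $$ (i,l) * real_diag n p $$ (l,j))"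
    by (rule mat_mult_entry[OF assms(1) _ assms(2,3)]) auto
  also have "\<dots> = (\<Sum>l<n. if l = j then A $$ (i,j) * of_real (p j) else 0)"
    using assms by (intro sum.cong) (auto simp: real_diag_def)
  finally show ?thesis using assms by simp
qed

lemma real_diag_mult_entry:
  assumes "A \<in> carrier_mat n m" "i < n" "j < m"
  shows "(real_diag n p * A) $$ (i,j) = of_real (p i) * A $$ (i,j)"
proof -
  have "(real_diag n p * A) $$ (i,j) = (\<Sum>l<n. real_diag n p $$ (i,l) * A $$ (l,j))"
    by (rule mat_mult_entry[OF _ assms(1) assms(2,3)]) auto
  also have "\<dots> = (\<Sum>l<n. if l = i then of_real (p i) * A $$ (i,j) else 0)"
    using assms by (intro sum.cong) (auto simp: real_diag_def)
  finally show ?thesis using assms by simp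
qed

lemma unitary_carrier: "unitary_mat n U \<Longrightarrow> U \<in> carrier_mat n n"
  by (simp add: unitary_mat_def)

lemma unitary_left: "unitary_mat n U \<Longrightarrow> adj U * U = 1\<^sub>m n"
  by (simp add: unitary_mat_def)

lemma unitary_right: "unitary_mat n U \<Longrightarrow> U * adj U = 1\<^sub>m n"
  using mat_mult_left_right_inverse[of "adj U" n U] by (simp add: unitary_mat_def)

lemma unitary_adj: "unitary_mat n U \<Longrightarrow> unitary_mat n (adj U)"
  using unitary_right by (auto simp: unitary_mat_def)

lemma unitary_one: "unitary_mat n (1\<^sub>m n)"
  by (simp add: unitary_mat_def)

lemma unitary_mult:
  assumes "unitary_mat n U" "unitary_mat n V"
  shows "unitary_mat n (U * V)"
proof -
  have c: "U \<in> carrier_mat n n" "V \<in> carrier_mat n n" using assms by (auto simp: unitary_mat_def)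
  have "adj (U * V) * (U * V) = adj V * adj U * (U * V)"
    using adj_mult[OF c] by simp
  also have "\<dots> = adj V * (adj U * (U * V))"
    by (rule assoc_mult_mat[of _ n n _ n _ n]) (use c in auto)
  also have "adj U * (U * V) = (adj U * U) * V"
    by (rule assoc_mult_mat[of _ n n _ n _ n, symmetric]) (use c in auto)
  finally show ?thesis using assms c by (simp add: unitary_mat_def)
qed

lemma spec_mat_carrier [simp]: "U \<in> carrier_mat n n \<Longrightarrow> spec_mat n U p \<in> carrier_mat n n"
  by (auto simp: spec_mat_def)

lemma adj_spec_mat:
  assumes "U \<in> carrier_mat n n"
  shows "adj (spec_mat n U p) = spec_mat n U p"
proof -
  have "adj (spec_mat n U p) = adj (adj U) * adj (U * real_diag n p)"
    unfolding spec_mat_def by (rule adj_mult) (use assms in auto)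
  also have "adj (U * real_diag n p) = real_diag n p * adj U"
    using adj_mult[OF assms real_diag_carrier] by simp
  also have "adj (adj U) * (real_diag n p * adj U) = U * real_diag n p * adj U"
    by (simp, rule assoc_mult_mat[symmetric]) (use assms in auto)
  finally show ?thesis by (simp add: spec_mat_def)
qed

lemma spec_mat_mult:
  assumes "unitary_mat n U"
  shows "spec_mat n U p * spec_mat n U q = spec_mat n U (\<lambda>i. p i * q i)"
proof -
  let ?P = "real_diag n p" and ?Q = "real_diag n q"
  have U: "U \<in> carrier_mat n n" and V: "adj U \<in> carrier_mat n n"
    using assms by (auto simp: unitary_mat_def)
  have "spec_mat n U p * spec_mat n U q = (U * ?P) * (adj U * (U * ?Q * adj U))"
    unfolding spec_mat_def by (rule assoc_mult_mat[of _ n n _ n _ n]) (use U in auto)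
  also have "adj U * (U * ?Q * adj U) = (adj U * (U * ?Q)) * adj U"
    by (rule assoc_mult_mat[of _ n n _ n _ n, symmetric]) (use U in auto)
  also have "adj U * (U * ?Q) = (adj U * U) * ?Q"
    by (rule assoc_mult_mat[of _ n n _ n _ n, symmetric]) (use U in auto)
  also have "\<dots> = ?Q" using unitary_left[OF assms] by simp
  also have "(U * ?P) * (?Q * adj U) = U * (?P * (?Q * adj U))"
    by (rule assoc_mult_mat[of _ n n _ n _ n]) (use U in auto)
  also have "?P * (?Q * adj U) = ?P * ?Q * adj U"
    by (rule assoc_mult_mat[of _ n n _ n _ n, symmetric]) (use U in auto)
  also have "U * (?P * ?Q * adj U) = U * (?P * ?Q) * adj U"
    by (rule assoc_mult_mat[of _ n n _ n _ n, symmetric]) (use U in auto)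
  finally show ?thesis by (simp add: real_diag_mult spec_mat_def)
qed

lemma spec_mat_one: 
  assumes "unitary_mat n U" 
  shows "spec_mat n U (\<lambda>_. 1) = 1\<^sub>m n"
proof -
  have "real_diag n (\<lambda>_. 1) = 1\<^sub>m n" by (rule eq_matI) (auto simp: real_diag_def)
  thus ?thesis using assms unitary_carrier[OF assms] by (simp add: spec_mat_def unitary_right)
qed

lemma spec_mat_entry:
  assumes "U \<in> carrier_mat n n" "i < n" "j < n"
  shows "spec_mat n U p $$ (i,j) = (\<Sum>l<n. of_real (p l) * (U $$ (i,l) * cnj (U $$ (j,l))))"
proof -
  have "spec_mat n U p $$ (i,j) = (\<Sum>l<n. (U * real_diag n p) $$ (i,l) * adj U $$ (l,j))"
    unfolding spec_mat_def by (rule mat_mult_entry[of _ n n _ n]) (use assms in auto)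
  also have "\<dots> = (\<Sum>l<n. of_real (p l) * (U $$ (i,l) * cnj (U $$ (j,l))))"
    using assms mult_real_diag_entry[OF assms(1,2)] by (intro sum.cong) auto
  finally show ?thesis .
qed

text \<open>Polarization: the form is real at \<open>e_i\<close>, \<open>e_j\<close>, \<open>e_i + e_j\<close> and \<open>e_i + \<i> e_j\<close>.\<close>

lemma psd_hermitian:
  assumes "psd d A"
  shows "adj A = A"
proof (rule eq_matI)
  have A: "A \<in> carrier_mat d d" using assms by (simp add: psd_def)
  show "dim_row (adj A) = dim_row A" "dim_col (adj A) = dim_col A" using A by auto
  fix i j assume "i < dim_row A" "j < dim_col A"
  hence ij: "i < d" "j < d" using A by auto
  have q: "Im (cnj a * a * A $$ (i,i) + cnj a * b * A $$ (i,j) + cnj b * a * A $$ (j,i) + cnj b * b * A $$ (j,j)) = 0"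
    for a b
  proof -
    define v where "v = vec d (\<lambda>k. (if k = i then a else 0) + (if k = j then b else 0))"
    have "v \<in> carrier_vec d" by (simp add: v_def)
    hence e0: "Im (\<Sum>k<d. \<Sum>l<d. cnj (v $ k) * A $$ (k,l) * v $ l) = 0"
      using assms by (auto simp: psd_def Let_def)
    have "(\<Sum>k<d. \<Sum>l<d. cnj (v $ k) * A $$ (k,l) * v $ l)
      = (\<Sum>k<d. \<Sum>l<d. (if k = i then (if l = i then cnj a * a * A $$ (k,l) else 0) else 0) + 
          (if k = i then (if l = j then cnj a * b * A $$ (k,l) else 0) else 0) +
          (if k = j then (if l = i then cnj b * a * A $$ (k,l) else 0) else 0) +
          (if k = j then (if l = j then cnj b * b * A $$ (k,l) else 0) else 0))"
      by (intro sum.cong refl) (auto simp: v_def algebra_simps)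
    also have "\<dots> = cnj a * a * A $$ (i,i) + cnj a * b * A $$ (i,j) + cnj b * a * A $$ (j,i) + cnj b * b * A $$ (j,j)"
    proof -
      have *: "(\<Sum>k<d. \<Sum>l<d. if k = i' then (if l = j' then f k l else 0) else 0) = f i' j'"
        if "i' < d" "j' < d" for i' j' and f :: "nat \<Rightarrow> nat \<Rightarrow> complex"
      proof -
        have "(\<Sum>k<d. \<Sum>l<d. if k = i' then (if l = j' then f k l else 0) else 0)
          = (\<Sum>k<d. if k = i' then f i' j' else 0)"
          using that by (intro sum.cong) auto
        thus ?thesis using that by simp
      qed
      show ?thesis using ij by (simp only: sum.distrib *)
    qed
    finally show ?thesis using e0 by (simp only:)
  qed
  have "Im (A $$ (i,i)) = 0" "Im (A $$ (j,j)) = 0" using q[of 1 0] q[of 0 1] by simp_all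
  hence "Im (A $$ (i,j)) = - Im (A $$ (j,i))" "Re (A $$ (i,j)) = Re (A $$ (j,i))"
    using q[of 1 1] q[of 1 \<i>] by (simp_all)
  thus "adj A $$ (i,j) = A $$ (i,j)" using A ij by (simp add: complex_eq_iff)
qed

section \<open>Spectral theorem for Hermitian matrices\<close>

lemma unitary_with_first_col:
  fixes v :: "complex vec"
  assumes v: "v \<in> carrier_vec n" and v0: "v \<noteq> 0\<^sub>v n"
  obtains W c where "unitary_mat n W" "c \<noteq> 0" "\<And>i. i < n \<Longrightarrow> W $$ (i,0) = c * v $ i"
proof -
  interpret cof_vec_space n "TYPE(complex)" .
  define b where "b = basis_completion v"
  define ws where "ws = gram_schmidt n b"
  note bc = basis_completion[OF v v0, folded b_def]
  have n: "n > 0" using v v0 by (cases n) auto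
  have ne: "b \<noteq> []" using bc(6) n by auto
  have ws: "set ws \<subseteq> carrier_vec n" "corthogonal ws" "length ws = n"
    using gram_schmidt_result[OF bc(2,4,5) refl, folded ws_def] bc(6) by auto
  obtain bs where "b = v # bs" using bc(7) ne by (cases b) auto
  \<comment> \<open>Gram-Schmidt leaves the first vector of its input unchanged, so completing
    \<open>v\<close> to a basis that starts with \<open>v\<close> keeps it as first column.\<close>
  hence "hd ws = v" unfolding ws_def using gram_schmidt_hd[OF v] by simp
  hence ws0: "ws ! 0 = v" using ws(3) n by (cases ws) auto
  have wsc: "ws ! i \<in> carrier_vec n" if "i < n" for i using ws that by auto
  have ip: "(\<Sum>l<n. cnj (ws ! i $ l) * ws ! j $ l) = ws ! j \<bullet>c ws ! i" if "i < n" "j < n" for i j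
    using wsc[OF that(1)] wsc[OF that(2)]
    by (auto simp: scalar_prod_def lessThan_atLeast0 intro!: sum.cong)
  define r where "r j = (\<Sum>l<n. (cmod (ws ! j $ l))\<^sup>2)" for j
  have rr: "(\<Sum>l<n. cnj (ws ! j $ l) * ws ! j $ l) = of_real (r j)" for j
    unfolding r_def of_real_sum
    by (intro sum.cong refl) (simp only: complex_norm_square mult.commute)
  have r_pos: "r j > 0" if "j < n" for j
  proof -
    have "ws ! j \<bullet>c ws ! j \<noteq> 0" using corthogonalD[OF ws(2)] ws(3) that by auto
    hence "r j \<noteq> 0" using rr[of j] ip[OF that that] by auto
    moreover have "r j \<ge> 0" unfolding r_def by (intro sum_nonneg) auto
    ultimately show ?thesis by simp
  qed
  \<comment> \<open>The Gram-Schmidt output is orthogonal but not normalized; dividing by the norms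
    produces the factor \<open>c\<close> of the conclusion.\<close>
  define W where "W = mat n n (\<lambda>(i,j). ws ! j $ i / of_real (sqrt (r j)))"
  have W: "W \<in> carrier_mat n n" by (simp add: W_def)
  have "adj W * W = 1\<^sub>m n"
  proof (rule eq_matI)
    fix i j assume "i < dim_row (1\<^sub>m n :: complex mat)" "j < dim_col (1\<^sub>m n :: complex mat)"
    hence ij: "i < n" "j < n" by auto
    have "(adj W * W) $$ (i,j) = (\<Sum>l<n. adj W $$ (i,l) * W $$ (l,j))"
      by (rule mat_mult_entry[of _ n n _ n]) (use W ij in auto)
    also have "\<dots> = (\<Sum>l<n. cnj (ws ! i $ l) * ws ! j $ l) / of_real (sqrt (r i) * sqrt (r j))"
      unfolding sum_divide_distrib using ij W by (intro sum.cong) (auto simp: W_def)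
    also have "\<dots> = (if i = j then 1 else 0)"
    proof (cases "i = j")
      case True
      hence "(\<Sum>l<n. cnj (ws ! i $ l) * ws ! j $ l) = of_real (r i)" using rr by simp
      thus ?thesis using True r_pos[OF ij(1)] by (simp flip: of_real_mult)
    next
      case False
      thus ?thesis using ip[OF ij] corthogonalD[OF ws(2), of j i] ws(3) ij by simp
    qed
    finally show "(adj W * W) $$ (i,j) = 1\<^sub>m n $$ (i,j)" using ij by simp
  qed (use W in auto)
  hence "unitary_mat n W" using W by (simp add: unitary_mat_def)
  moreover have "1 / complex_of_real (sqrt (r 0)) \<noteq> 0" using r_pos[OF n] by simp
  moreover have "W $$ (i,0) = 1 / complex_of_real (sqrt (r 0)) * v $ i" if "i < n" for i
    using that n by (simp add: W_def ws0)
  ultimately show thesis using that by blast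
qed

lemma adj_four_block:
  assumes "A \<in> carrier_mat a a" "D \<in> carrier_mat b b"
  shows "adj (four_block_mat A (0\<^sub>m a b) (0\<^sub>m b a) D) = four_block_mat (adj A) (0\<^sub>m a b) (0\<^sub>m b a) (adj D)"
  by (rule eq_matI) (use assms in \<open>auto simp: adj_def\<close>)

lemma four_block_diag_mult:
  fixes A A' D D' :: "complex mat"
  assumes "A \<in> carrier_mat a a" "D \<in> carrier_mat b b" "A' \<in> carrier_mat a a" "D' \<in> carrier_mat b b"
  shows "four_block_mat A (0\<^sub>m a b) (0\<^sub>m b a) D * four_block_mat A' (0\<^sub>m a b) (0\<^sub>m b a) D'
       = four_block_mat (A * A') (0\<^sub>m a b) (0\<^sub>m b a) (D * D')"
  by (subst mult_four_block_mat[OF assms(1) zero_carrier_mat zero_carrier_mat assms(2,3) zero_carrier_mat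
      zero_carrier_mat assms(4)]) (use assms in simp)

lemma real_diag_Suc:
  "real_diag (Suc n) (case_nat e p) = four_block_mat (real_diag 1 (\<lambda>_. e)) (0\<^sub>m 1 n) (0\<^sub>m n 1) (real_diag n p)"
  by (rule eq_matI) (auto simp: real_diag_def split: nat.splits)

text \<open>Deflation: a unitary whose first column is an eigenvector turns \<open>A\<close> into a
  matrix with first column (e,0,...,0). Hermitian symmetry then clears the first row and makes e
  real, so the induction hypothesis applies to the remaining block.\<close>

theorem hermitian_spectral:
  assumes "A \<in> carrier_mat n n" "adj A = A"
  shows "\<exists>U p. unitary_mat n U \<and> A = spec_mat n U p"
  using assms
proof (induction n arbitrary: A)
  case 0
  hence "A = spec_mat 0 (1\<^sub>m 0) (\<lambda>_. 0)" by (intro eq_matI) (auto simp: spec_mat_def)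
  thus ?case using unitary_one by blast
next
  case (Suc n A)
  let ?m = "Suc n"
  have A: "A \<in> carrier_mat ?m ?m" by fact
  obtain e where "eigenvalue A e" using spectrum_non_empty[OF A] by (auto simp: spectrum_def)
  then obtain v where ev: "v \<in> carrier_vec ?m" "v \<noteq> 0\<^sub>v ?m" "A *\<^sub>v v = e \<cdot>\<^sub>v v"
    using A by (auto simp: eigenvalue_def eigenvector_def)
  obtain W c where W: "unitary_mat ?m W" "c \<noteq> 0" "\<And>i. i < ?m \<Longrightarrow> W $$ (i,0) = c * v $ i"
    using unitary_with_first_col[OF ev(1,2)] by blast
  note Wc = unitary_carrier[OF W(1)]
  define B where "B = adj W * (A * W)"
  have AWc: "A * W \<in> carrier_mat ?m ?m" using A Wc by auto
  have B: "B \<in> carrier_mat ?m ?m" using A Wc by (auto simp: B_def)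
  have Bh: "adj B = B"
  proof -
    have "adj B = adj (A * W) * W"
      unfolding B_def using adj_mult[OF adj_carrier[OF Wc] AWc] by simp
    also have "adj (A * W) = adj W * A" using adj_mult[OF A Wc] Suc.prems(2) by simp
    also have "adj W * A * W = B" unfolding B_def
      by (rule assoc_mult_mat[of _ ?m ?m _ ?m _ ?m]) (use A Wc in auto)
    finally show ?thesis .
  qed
  \<comment> \<open>The first column of \<open>W\<close> is a multiple of the eigenvector
    \<open>v\<close>.\<close>
  have AW0: "(A * W) $$ (i,0) = e * W $$ (i,0)" if "i < ?m" for i
  proof -
    have "(A * W) $$ (i,0) = (\<Sum>l<?m. A $$ (i,l) * (c * v $ l))"
      using mat_mult_entry[OF A Wc that, of 0] W(3) by (auto intro!: sum.cong)
    also have "\<dots> = c * (\<Sum>l<?m. A $$ (i,l) * v $ l)"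
      by (simp add: sum_distrib_left algebra_simps del: sum.lessThan_Suc)
    also have "(\<Sum>l<?m. A $$ (i,l) * v $ l) = (A *\<^sub>v v) $ i"
      using A ev(1) that by (auto simp: scalar_prod_def lessThan_atLeast0 simp del: sum.lessThan_Suc intro!: sum.cong)
    finally show ?thesis using ev that W(3) by simp
  qed
  have B0: "B $$ (i,0) = (if i = 0 then e else 0)" if "i < ?m" for i
  proof -
    have "B $$ (i,0) = (\<Sum>l<?m. adj W $$ (i,l) * (e * W $$ (l,0)))"
      unfolding B_def using mat_mult_entry[OF adj_carrier[OF Wc] AWc that, of 0] AW0
      by (auto intro!: sum.cong)
    also have "\<dots> = e * (\<Sum>l<?m. adj W $$ (i,l) * W $$ (l,0))"
      by (simp add: sum_distrib_left algebra_simps del: sum.lessThan_Suc)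
    also have "(\<Sum>l<?m. adj W $$ (i,l) * W $$ (l,0)) = (adj W * W) $$ (i,0)"
      using mat_mult_entry[OF adj_carrier[OF Wc] Wc that, of 0] by simp
    finally show ?thesis using unitary_left[OF W(1)] that by simp
  qed
  have B0': "B $$ (0,i) = (if i = 0 then e else 0)" if "i < ?m" for i
  proof -
    have "B $$ (0,i) = cnj (B $$ (i,0))" using adj_entry[of 0 B i] Bh B that by auto
    moreover have "B $$ (0,0) = cnj (B $$ (0,0))" using adj_entry[of 0 B 0] Bh B by auto
    ultimately show ?thesis using B0[OF that] B0[of 0] by auto
  qed
  have "cnj e = e" using adj_entry[of 0 B 0] Bh B B0[of 0] by auto
  hence er: "of_real (Re e) = e" by (simp add: complex_eq_iff)
  define C where "C = mat n n (\<lambda>(i,j). B $$ (Suc i, Suc j))"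
  have C: "C \<in> carrier_mat n n" by (simp add: C_def)
  have "adj C = C"
  proof (rule eq_matI)
    fix i j assume "i < dim_row C" "j < dim_col C"
    thus "adj C $$ (i,j) = C $$ (i,j)"
      using adj_entry[of "Suc i" B "Suc j"] Bh B C by (auto simp: C_def)
  qed (use C in auto)
  with Suc.IH[OF C] obtain U p where U: "unitary_mat n U" "C = spec_mat n U p" by blast
  note Uc = unitary_carrier[OF U(1)]
  let ?fb = "\<lambda>A D. four_block_mat A (0\<^sub>m 1 n) (0\<^sub>m n 1) (D :: complex mat)"
  define V where "V = ?fb (1\<^sub>m 1) U"
  have V: "V \<in> carrier_mat ?m ?m" unfolding V_def using four_block_carrier_mat[of "1\<^sub>m 1" 1 1 U n n] Uc by auto
  have adjV: "adj V = ?fb (1\<^sub>m 1) (adj U)" unfolding V_def using adj_four_block[of "1\<^sub>m 1" 1 U n] Uc by simp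
  have "adj V * V = ?fb (1\<^sub>m 1) (1\<^sub>m n)"
    unfolding adjV unfolding V_def
    by (subst four_block_diag_mult) (use Uc unitary_left[OF U(1)] in auto)
  also have "\<dots> = 1\<^sub>m ?m" by (rule eq_matI) auto
  finally have Vu: "unitary_mat ?m V" using V by (simp add: unitary_mat_def)
  \<comment> \<open>\<open>V\<close> leaves the split-off coordinate alone and diagonalizes the
    block \<open>C\<close>; \<open>case_nat\<close> prepends the eigenvalue found first.\<close>
  have "spec_mat ?m V (case_nat (Re e) p) = ?fb (real_diag 1 (\<lambda>_. Re e)) (spec_mat n U p)"
    unfolding spec_mat_def real_diag_Suc adjV unfolding V_def
    by (subst four_block_diag_mult, (use Uc in auto)[4], subst four_block_diag_mult)
      (use Uc in auto)
  also have "\<dots> = B"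
  proof (rule eq_matI)
    fix i j assume "i < dim_row B" "j < dim_col B"
    thus "?fb (real_diag 1 (\<lambda>_. Re e)) (spec_mat n U p) $$ (i,j) = B $$ (i,j)"
      unfolding U(2)[symmetric] using B C B0 B0' er
      by (auto simp: C_def real_diag_def)
  qed (use B C U(2) in auto)
  finally have BV: "spec_mat ?m V (case_nat (Re e) p) = B" .
  let ?D = "real_diag ?m (case_nat (Re e) p)"
  have "spec_mat ?m (W * V) (case_nat (Re e) p) = W * V * ?D * (adj V * adj W)"
    unfolding spec_mat_def using adj_mult[OF Wc V] by simp
  also have "W * V * ?D = W * (V * ?D)"
    by (rule assoc_mult_mat[of _ ?m ?m _ ?m _ ?m]) (use V Wc in auto)
  also have "\<dots> * (adj V * adj W) = W * (V * ?D * (adj V * adj W))"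
    by (rule assoc_mult_mat[of _ ?m ?m _ ?m _ ?m]) (use V Wc in auto)
  also have "V * ?D * (adj V * adj W) = V * ?D * adj V * adj W"
    by (rule assoc_mult_mat[of _ ?m ?m _ ?m _ ?m, symmetric]) (use V Wc in auto)
  also have "V * ?D * adj V = adj W * (A * W)" using BV by (simp add: spec_mat_def B_def)
  also have "adj W * (A * W) * adj W = adj W * (A * W * adj W)"
    by (rule assoc_mult_mat[of _ ?m ?m _ ?m _ ?m]) (use A Wc in auto)
  also have "A * W * adj W = A * (W * adj W)"
    by (rule assoc_mult_mat[of _ ?m ?m _ ?m _ ?m]) (use A Wc in auto)
  also have "\<dots> = A" using unitary_right[OF W(1)] A by simp
  also have "W * (adj W * A) = W * adj W * A"
    by (rule assoc_mult_mat[of _ ?m ?m _ ?m _ ?m, symmetric]) (use A Wc in auto)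
  also have "\<dots> = A" using unitary_right[OF W(1)] A by simp
  finally show ?case using unitary_mult[OF W(1) Vu] by metis
qed

section \<open>Positive semidefinite matrices and their square roots\<close>

lemma spec_mat_cong:
  assumes "\<And>i. i < n \<Longrightarrow> p i = q i"
  shows "spec_mat n U p = spec_mat n U q"
proof -
  have "real_diag n p = real_diag n q" by (rule eq_matI) (use assms in \<open>auto simp: real_diag_def\<close>)
  thus ?thesis by (simp add: spec_mat_def)
qed

text \<open>In eigencoordinates the form is diagonal. This serves both directions of the equivalence
  between positive semidefiniteness and nonnegative eigenvalues.\<close>

lemma spec_mat_quadratic_form:
  assumes "U \<in> carrier_mat n n"
  shows "(\<Sum>i<n. \<Sum>j<n. cnj (v $ i) * spec_mat n U p $$ (i,j) * v $ j)
       = of_real (\<Sum>l<n. p l * (cmod (\<Sum>i<n. cnj (U $$ (i,l)) * v $ i))\<^sup>2)"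
proof -
  have "(\<Sum>i<n. \<Sum>j<n. cnj (v $ i) * spec_mat n U p $$ (i,j) * v $ j)
      = (\<Sum>i<n. \<Sum>j<n. \<Sum>l<n. of_real (p l) * ((cnj (v $ i) * U $$ (i,l)) * (cnj (U $$ (j,l)) * v $ j)))"
    using assms by (intro sum.cong refl) (simp add: spec_mat_entry sum_distrib_left sum_distrib_right mult_ac)
  also have "\<dots> = (\<Sum>i<n. \<Sum>l<n. \<Sum>j<n. of_real (p l) * ((cnj (v $ i) * U $$ (i,l)) * (cnj (U $$ (j,l)) * v $ j)))"
    by (rule sum.cong[OF refl], rule sum.swap)
  also have "\<dots> = (\<Sum>l<n. \<Sum>i<n. \<Sum>j<n. of_real (p l) * ((cnj (v $ i) * U $$ (i,l)) * (cnj (U $$ (j,l)) * v $ j)))"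
    by (rule sum.swap)
  also have "\<dots> = (\<Sum>l<n. of_real (p l) * ((\<Sum>j<n. cnj (U $$ (j,l)) * v $ j) * cnj (\<Sum>i<n. cnj (U $$ (i,l)) * v $ i)))"
  proof (rule sum.cong[OF refl])
    fix l
    have "(\<Sum>i<n. \<Sum>j<n. of_real (p l) * ((cnj (v $ i) * U $$ (i,l)) * (cnj (U $$ (j,l)) * v $ j)))
      = of_real (p l) * ((\<Sum>i<n. cnj (v $ i) * U $$ (i,l)) * (\<Sum>j<n. cnj (U $$ (j,l)) * v $ j))"
      unfolding sum_product by (simp add: sum_distrib_left)
    also have "(\<Sum>i<n. cnj (v $ i) * U $$ (i,l)) = cnj (\<Sum>i<n. cnj (U $$ (i,l)) * v $ i)"
      by (simp add: mult.commute)
    finally show "(\<Sum>i<n. \<Sum>j<n. of_real (p l) * ((cnj (v $ i) * U $$ (i,l)) * (cnj (U $$ (j,l)) * v $ j)))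
      = of_real (p l) * ((\<Sum>j<n. cnj (U $$ (j,l)) * v $ j) * cnj (\<Sum>i<n. cnj (U $$ (i,l)) * v $ i))"
      by (simp only: mult.commute)
  qed
  also have "\<dots> = of_real (\<Sum>l<n. p l * (cmod (\<Sum>i<n. cnj (U $$ (i,l)) * v $ i))\<^sup>2)"
    by (simp only: of_real_sum of_real_mult complex_norm_square)
  finally show ?thesis .
qed

lemma psd_spec_mat:
  assumes "U \<in> carrier_mat n n" "\<And>i. i < n \<Longrightarrow> p i \<ge> 0"
  shows "psd n (spec_mat n U p)"
  unfolding psd_def Let_def spec_mat_quadratic_form[OF assms(1)]
  using assms by (auto intro!: sum_nonneg)

lemma psd_spec_mat_nonneg:
  assumes "unitary_mat n U" "psd n (spec_mat n U p)" "k < n"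
  shows "p k \<ge> 0"
proof -
  note U = unitary_carrier[OF assms(1)]
  \<comment> \<open>The form is tested at the k-th eigenvector, where only the term with weight
    \<open>p k\<close> survives.\<close>
  have z: "(\<Sum>i<n. cnj (U $$ (i,l)) * col U k $ i) = (if l = k then 1 else 0)" if "l < n" for l
  proof -
    have "(\<Sum>i<n. cnj (U $$ (i,l)) * col U k $ i) = (\<Sum>i<n. adj U $$ (l,i) * U $$ (i,k))"
      using U that assms(3) by (intro sum.cong) auto
    also have "\<dots> = (adj U * U) $$ (l,k)"
      using mat_mult_entry[OF adj_carrier[OF U] U that assms(3)] by simp
    finally show ?thesis using unitary_left[OF assms(1)] that assms(3) by simp
  qed
  have "col U k \<in> carrier_vec n" using U assms(3) by auto
  hence "0 \<le> Re (of_real (\<Sum>l<n. p l * (cmod (\<Sum>i<n. cnj (U $$ (i,l)) * col U k $ i))\<^sup>2))"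
    using assms(2) unfolding psd_def Let_def spec_mat_quadratic_form[OF U] by blast
  also have "\<dots> = (\<Sum>l<n. if l = k then p k else 0)"
    unfolding Re_complex_of_real by (rule sum.cong) (use z in auto)
  finally show ?thesis using assms(3) by simp
qed

theorem psd_spectral:
  assumes "psd n A"
  obtains U p where "unitary_mat n U" "\<And>i. i < n \<Longrightarrow> p i \<ge> 0" "A = spec_mat n U p"
proof -
  have "A \<in> carrier_mat n n" using assms by (simp add: psd_def)
  then obtain U p where U: "unitary_mat n U" "A = spec_mat n U p"
    using hermitian_spectral psd_hermitian[OF assms] by blast
  thus thesis using that psd_spec_mat_nonneg assms by blast
qed

text \<open>Comparing the spectral decompositions of the two roots entrywise, the transition matrix can only
  connect eigenvalues with equal squares, hence equal eigenvalues.\<close>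

lemma psd_sqrt_unique:
  assumes "psd n S" "psd n T" "S * S = T * T"
  shows "S = T"
proof -
  obtain U s where U: "unitary_mat n U" "\<And>i. i < n \<Longrightarrow> s i \<ge> 0" "S = spec_mat n U s"
    using psd_spectral[OF assms(1)] by blast
  obtain V t where V: "unitary_mat n V" "\<And>i. i < n \<Longrightarrow> t i \<ge> 0" "T = spec_mat n V t"
    using psd_spectral[OF assms(2)] by blast
  note Uc = unitary_carrier[OF U(1)] and Vc = unitary_carrier[OF V(1)]
  define M where "M = adj U * V"
  have M: "M \<in> carrier_mat n n" using Uc Vc by (auto simp: M_def)
  have conj: "real_diag n p * M = adj U * spec_mat n U p * V" 
             "M * real_diag n p = adj U * spec_mat n V p * V" for p
  proof -
    have "adj U * spec_mat n U p = adj U * (U * (real_diag n p * adj U))"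
      unfolding spec_mat_def 
      by (rule arg_cong[of _ _ "(*) (adj U)"], rule assoc_mult_mat[of _ n n _ n _ n]) (use Uc in auto)
    also have "\<dots> = adj U * U * (real_diag n p * adj U)"
      by (rule assoc_mult_mat[of _ n n _ n _ n, symmetric]) (use Uc in auto)
    also have "\<dots> = real_diag n p * adj U" unfolding unitary_left[OF U(1)]
      by (rule left_mult_one_mat[of _ n n]) (use Uc in auto)
    finally have 1: "adj U * spec_mat n U p = real_diag n p * adj U" .
    show "real_diag n p * M = adj U * spec_mat n U p * V" unfolding 1 M_def
      by (rule assoc_mult_mat[of _ n n _ n _ n, symmetric]) (use Uc Vc in auto)
    have "spec_mat n V p * V = V * real_diag n p * (adj V * V)" unfolding spec_mat_def
      by (rule assoc_mult_mat[of _ n n _ n _ n]) (use Vc in auto)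
    also have "\<dots> = V * real_diag n p" unfolding unitary_left[OF V(1)]
      by (rule right_mult_one_mat[of _ n n]) (use Vc in auto)
    finally have 2: "spec_mat n V p * V = V * real_diag n p" .
    have "adj U * spec_mat n V p * V = adj U * (spec_mat n V p * V)"
      by (rule assoc_mult_mat[of _ n n _ n _ n]) (use Uc Vc in auto)
    also have "\<dots> = M * real_diag n p" unfolding 2 M_def
      by (rule assoc_mult_mat[of _ n n _ n _ n, symmetric]) (use Uc Vc in auto)
    finally show "M * real_diag n p = adj U * spec_mat n V p * V" by (rule sym)
  qed
  have sq: "real_diag n (\<lambda>i. s i * s i) * M = M * real_diag n (\<lambda>i. t i * t i)"
    using assms(3) unfolding U(3) V(3) conj spec_mat_mult[OF U(1)] spec_mat_mult[OF V(1)] by (simp only:)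
  have eq: "real_diag n s * M = M * real_diag n t"
  proof (rule eq_matI)
    fix i j assume "i < dim_row (M * real_diag n t)" "j < dim_col (M * real_diag n t)"
    hence ij: "i < n" "j < n" using M by auto
    have "of_real (s i * s i) * M $$ (i,j) = M $$ (i,j) * of_real (t j * t j)"
      using arg_cong[OF sq, of "\<lambda>A. A $$ (i,j)"] 
      unfolding real_diag_mult_entry[OF M ij] mult_real_diag_entry[OF M ij] .
    hence "M $$ (i,j) = 0 \<or> (of_real (s i * s i) :: complex) = of_real (t j * t j)"
      unfolding mult.commute[of "M $$ (i,j)"] mult_cancel_right by blast
    hence "M $$ (i,j) = 0 \<or> (s i)\<^sup>2 = (t j)\<^sup>2" by (simp only: of_real_eq_iff power2_eq_square)
    hence "M $$ (i,j) = 0 \<or> s i = t j" using U(2)[OF ij(1)] V(2)[OF ij(2)] by (auto simp: power2_eq_iff_nonneg)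
    thus "(real_diag n s * M) $$ (i,j) = (M * real_diag n t) $$ (i,j)"
      unfolding real_diag_mult_entry[OF M ij] mult_real_diag_entry[OF M ij] by auto
  qed (use M in auto)
  hence "adj U * S * V = adj U * T * V" unfolding conj U(3) V(3) .
  hence e: "U * (adj U * S * V) * adj V = U * (adj U * T * V) * adj V" by (simp only:)
  have inv: "U * (adj U * Y * V) * adj V = Y" if Y: "Y \<in> carrier_mat n n" for Y
  proof -
    have "U * (adj U * Y * V) = U * (adj U * (Y * V))"
      by (rule arg_cong[of _ _ "(*) U"], rule assoc_mult_mat[of _ n n _ n _ n]) (use Uc Vc Y in auto)
    also have "\<dots> = U * adj U * (Y * V)"
      by (rule assoc_mult_mat[of _ n n _ n _ n, symmetric]) (use Uc Vc Y in auto)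
    also have "\<dots> = Y * V" using unitary_right[OF U(1)] Y Vc by simp
    finally have 1: "U * (adj U * Y * V) = Y * V" .
    have "Y * V * adj V = Y * (V * adj V)"
      by (rule assoc_mult_mat[of _ n n _ n _ n]) (use Uc Vc Y in auto)
    also have "\<dots> = Y" using unitary_right[OF V(1)] Y by simp
    finally show ?thesis unfolding 1 .
  qed
  have c: "S \<in> carrier_mat n n" "T \<in> carrier_mat n n" using assms(1,2) by (simp_all only: psd_def)
  have "S = U * (adj U * S * V) * adj V" using inv[OF c(1)] by (rule sym)
  also have "\<dots> = U * (adj U * T * V) * adj V" by (rule e)
  also have "\<dots> = T" by (rule inv[OF c(2)])
  finally show ?thesis .
qed

text \<open>\<open>mat_sqrt\<close> is a definite description, so it means something only through
  \<open>psd_sqrt_unique\<close>; from here on it can be computed on eigenvalues.\<close>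

lemma mat_sqrt_spec_mat:
  assumes "unitary_mat n U" "\<And>i. i < n \<Longrightarrow> p i \<ge> 0"
  shows "mat_sqrt n (spec_mat n U p) = spec_mat n U (\<lambda>i. sqrt (p i))"
  unfolding mat_sqrt_def
proof (rule the_equality)
  have "psd n (spec_mat n U (\<lambda>i. sqrt (p i)))"
    by (rule psd_spec_mat) (use assms unitary_carrier in auto)
  moreover have "spec_mat n U (\<lambda>i. sqrt (p i)) * spec_mat n U (\<lambda>i. sqrt (p i)) = spec_mat n U p"
    unfolding spec_mat_mult[OF assms(1)] by (rule spec_mat_cong) (use assms(2) in auto)
  ultimately show 1: "psd n (spec_mat n U (\<lambda>i. sqrt (p i))) \<and>
    spec_mat n U (\<lambda>i. sqrt (p i)) * spec_mat n U (\<lambda>i. sqrt (p i)) = spec_mat n U p" by simp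
  fix S assume "psd n S \<and> S * S = spec_mat n U p"
  thus "S = spec_mat n U (\<lambda>i. sqrt (p i))" using 1 psd_sqrt_unique by metis
qed

section \<open>Traces, overlaps of eigenbases and the Hilbert-Schmidt distance\<close>

lemma tr_mult:
  assumes "A \<in> carrier_mat m n" "B \<in> carrier_mat n m"
  shows "tr (A * B) = (\<Sum>i<m. \<Sum>j<n. A $$ (i,j) * B $$ (j,i))"
  unfolding tr_def using assms mat_mult_entry[OF assms] by (auto intro!: sum.cong)

lemma tr_comm:
  assumes "A \<in> carrier_mat m n" "B \<in> carrier_mat n m"
  shows "tr (A * B) = tr (B * A)"
  unfolding tr_mult[OF assms] tr_mult[OF assms(2,1)] by (subst sum.swap) (simp add: mult.commute)

text \<open>The transition probability between eigenvector \<open>y\<close> of one basis and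
  eigenvector \<open>z\<close> of the other. It is the only trace of noncommutativity that remains
  in the later estimates.\<close>

definition overlap :: "complex mat \<Rightarrow> complex mat \<Rightarrow> nat \<Rightarrow> nat \<Rightarrow> real" where
  "overlap U V y z = (cmod ((adj U * V) $$ (y,z)))\<^sup>2"

lemma overlap_nonneg [simp]: "overlap U V y z \<ge> 0"
  by (simp add: overlap_def)

lemma unitary_row_sum:
  assumes "unitary_mat n U" "i < n"
  shows "(\<Sum>j<n. (cmod (U $$ (i,j)))\<^sup>2) = 1"
proof -
  note U = unitary_carrier[OF assms(1)]
  have "complex_of_real (\<Sum>j<n. (cmod (U $$ (i,j)))\<^sup>2) = (\<Sum>j<n. U $$ (i,j) * adj U $$ (j,i))"
    unfolding of_real_sum using U assms(2) by (intro sum.cong) (auto simp: complex_norm_square simp del: of_real_power)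
  also have "\<dots> = (U * adj U) $$ (i,i)"
    using mat_mult_entry[OF U adj_carrier[OF U] assms(2,2)] by simp
  also have "\<dots> = 1" using unitary_right[OF assms(1)] assms(2) by simp
  finally show ?thesis by (simp only: of_real_eq_1_iff)
qed

lemma overlap_sum:
  assumes "unitary_mat n U" "unitary_mat n V" "y < n"
  shows "(\<Sum>z<n. overlap U V y z) = 1"
  unfolding overlap_def
  by (rule unitary_row_sum) (use assms unitary_adj unitary_mult in auto)

lemma sum_swap_pairs:
  "(\<Sum>i\<in>A. \<Sum>j\<in>B. \<Sum>y\<in>C. \<Sum>z\<in>D. f i j y z) = (\<Sum>y\<in>C. \<Sum>z\<in>D. \<Sum>i\<in>A. \<Sum>j\<in>B. f i j y z)"
proof -
  have "(\<Sum>i\<in>A. \<Sum>j\<in>B. \<Sum>y\<in>C. \<Sum>z\<in>D. f i j y z) = (\<Sum>i\<in>A. \<Sum>y\<in>C. \<Sum>j\<in>B. \<Sum>z\<in>D. f i j y z)"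
    by (rule sum.cong[OF refl], rule sum.swap)
  also have "\<dots> = (\<Sum>y\<in>C. \<Sum>i\<in>A. \<Sum>j\<in>B. \<Sum>z\<in>D. f i j y z)" by (rule sum.swap)
  also have "\<dots> = (\<Sum>y\<in>C. \<Sum>i\<in>A. \<Sum>z\<in>D. \<Sum>j\<in>B. f i j y z)"
    by (rule sum.cong[OF refl], rule sum.cong[OF refl], rule sum.swap)
  also have "\<dots> = (\<Sum>y\<in>C. \<Sum>z\<in>D. \<Sum>i\<in>A. \<Sum>j\<in>B. f i j y z)"
    by (rule sum.cong[OF refl], rule sum.swap)
  finally show ?thesis .
qed

text \<open>Both factors are expanded in rank-one eigenprojections; the trace of a product of two
  such projections is the squared modulus of an inner product.\<close>

lemma tr_spec_mat_mult:
  assumes U: "U \<in> carrier_mat n n" and V: "V \<in> carrier_mat n n"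
  shows "tr (spec_mat n U p * spec_mat n V q) = of_real (\<Sum>y<n. \<Sum>z<n. p y * q z * overlap U V y z)"
proof -
  have "tr (spec_mat n U p * spec_mat n V q) = 
    (\<Sum>i<n. \<Sum>j<n. (\<Sum>y<n. of_real (p y) * (U $$ (i,y) * cnj (U $$ (j,y)))) * 
       (\<Sum>z<n. of_real (q z) * (V $$ (j,z) * cnj (V $$ (i,z)))))"
    using tr_mult[OF spec_mat_carrier[OF U] spec_mat_carrier[OF V]] spec_mat_entry[OF U] spec_mat_entry[OF V]
    by (auto intro!: sum.cong)
  also have "\<dots> = (\<Sum>i<n. \<Sum>j<n. \<Sum>y<n. \<Sum>z<n. of_real (p y * q z) * 
      ((cnj (U $$ (j,y)) * V $$ (j,z)) * (cnj (cnj (U $$ (i,y)) * V $$ (i,z)))))"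
    by (intro sum.cong refl) (simp add: sum_product mult_ac)
  also have "\<dots> = (\<Sum>y<n. \<Sum>z<n. \<Sum>i<n. \<Sum>j<n. of_real (p y * q z) * 
      ((cnj (U $$ (j,y)) * V $$ (j,z)) * (cnj (cnj (U $$ (i,y)) * V $$ (i,z)))))"
    by (rule sum_swap_pairs)
  also have "\<dots> = (\<Sum>y<n. \<Sum>z<n. of_real (p y * q z) * 
     ((\<Sum>j<n. cnj (U $$ (j,y)) * V $$ (j,z)) * cnj (\<Sum>j<n. cnj (U $$ (j,y)) * V $$ (j,z))))"
    unfolding cnj_sum sum_product
    by (rule sum.cong[OF refl], rule sum.cong[OF refl], subst sum.swap) (simp only: sum_distrib_left)
  also have "\<dots> = (\<Sum>y<n. \<Sum>z<n. of_real (p y * q z) * 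
     ((adj U * V) $$ (y,z) * cnj ((adj U * V) $$ (y,z))))"
  proof (intro sum.cong refl)
    fix y z assume "y \<in> {..<n}" "z \<in> {..<n}"
    hence "(adj U * V) $$ (y,z) = (\<Sum>j<n. cnj (U $$ (j,y)) * V $$ (j,z))"
      using mat_mult_entry[OF adj_carrier[OF U] V, of y z] U by auto
    thus "of_real (p y * q z) * ((\<Sum>j<n. cnj (U $$ (j,y)) * V $$ (j,z)) * cnj (\<Sum>j<n. cnj (U $$ (j,y)) * V $$ (j,z)))
      = of_real (p y * q z) * ((adj U * V) $$ (y,z) * cnj ((adj U * V) $$ (y,z)))" by simp
  qed
  finally show ?thesis by (simp only: overlap_def of_real_sum of_real_mult complex_norm_square)
qed

lemma tr_spec_mat:
  assumes "unitary_mat n U"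
  shows "tr (spec_mat n U p) = of_real (\<Sum>i<n. p i)"
proof -
  note U = unitary_carrier[OF assms]
  have "tr (spec_mat n U p) = tr (spec_mat n U p * spec_mat n U (\<lambda>_. 1))"
    using spec_mat_one[OF assms] spec_mat_carrier[OF U, of p] by simp
  also have "\<dots> = of_real (\<Sum>y<n. p y * (\<Sum>z<n. overlap U U y z))"
    unfolding tr_spec_mat_mult[OF U U] by (simp add: sum_distrib_left)
  finally show ?thesis using overlap_sum[OF assms assms] by simp
qed

text \<open>Polarization for Hermitian matrices. When \<open>A\<close> and \<open>B\<close> are
  roots of states the first two traces are 1, so the distance and the affinity determine each
  other.\<close>

lemma hs_dist_sq:
  assumes A: "A \<in> carrier_mat n n" "adj A = A" and B: "B \<in> carrier_mat n n" "adj B = B"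
  shows "(hs_dist A B)\<^sup>2 = Re (tr (A * A)) + Re (tr (B * B)) - 2 * Re (tr (A * B))"
proof -
  have "(hs_dist A B)\<^sup>2 = (\<Sum>i<n. \<Sum>j<n. (cmod (A $$ (i,j) - B $$ (i,j)))\<^sup>2)"
    unfolding hs_dist_def using A by (simp add: sum_nonneg)
  also have "\<dots> = (\<Sum>i<n. \<Sum>j<n. Re (A $$ (i,j) * A $$ (j,i)) + Re (B $$ (i,j) * B $$ (j,i)) 
      - 2 * Re (A $$ (i,j) * B $$ (j,i)))"
  proof (intro sum.cong refl)
    fix i j assume ij: "i \<in> {..<n}" "j \<in> {..<n}"
    have "A $$ (j,i) = cnj (A $$ (i,j))" "B $$ (j,i) = cnj (B $$ (i,j))"
      using adj_entry[of j A i] adj_entry[of j B i] A B ij by auto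
    thus "(cmod (A $$ (i,j) - B $$ (i,j)))\<^sup>2 = Re (A $$ (i,j) * A $$ (j,i)) + Re (B $$ (i,j) * B $$ (j,i)) 
      - 2 * Re (A $$ (i,j) * B $$ (j,i))"
      unfolding cmod_power2 by (simp add: power2_eq_square algebra_simps)
  qed
  also have "\<dots> = Re (tr (A * A)) + Re (tr (B * B)) - 2 * Re (tr (A * B))"
    unfolding tr_mult[OF A(1) A(1)] tr_mult[OF A(1) B(1)] tr_mult[OF B(1) B(1)]
    by (simp add: sum.distrib sum_subtractf sum_distrib_left)
  finally show ?thesis .
qed

section \<open>Kronecker products\<close>

text \<open>The index of a Kronecker product is a quotient and a remainder; this is the change of
  variables behind every sum over such indices.\<close>

lemma sum_div_mod:
  fixes f :: "nat \<Rightarrow> nat \<Rightarrow> 'a::comm_monoid_add"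
  shows "(\<Sum>l<a * b. f (l div b) (l mod b)) = (\<Sum>i<a. \<Sum>j<b. f i j)"
proof -
  have "(\<Sum>l<a * b. f (l div b) (l mod b)) = (\<Sum>i<a. \<Sum>l\<in>{i * b..<i * b + b}. f (l div b) (l mod b))"
    by (rule sum.nat_group[symmetric])
  also have "\<dots> = (\<Sum>i<a. \<Sum>j<b. f i j)"
  proof (rule sum.cong[OF refl])
    fix i
    have "(\<Sum>l\<in>{i * b..<i * b + b}. f (l div b) (l mod b)) = (\<Sum>j\<in>{0..<b}. f ((j + i * b) div b) ((j + i * b) mod b))"
      using sum.shift_bounds_nat_ivl[of "\<lambda>l. f (l div b) (l mod b)" 0 "i * b" b] by (simp add: add.commute)
    thus "(\<Sum>l\<in>{i * b..<i * b + b}. f (l div b) (l mod b)) = (\<Sum>j<b. f i j)"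
      by (simp add: lessThan_atLeast0)
  qed
  finally show ?thesis .
qed

lemma div_mod_less:
  fixes i a b :: nat
  assumes "i < a * b"
  shows "i div b < a" "i mod b < b"
proof -
  have "b > 0" using assms by (cases b) auto
  thus "i mod b < b" by simp
  show "i div b < a" using assms by (rule less_mult_imp_div_less)
qed

lemma kron_carrier [simp]:
  "A \<in> carrier_mat m n \<Longrightarrow> B \<in> carrier_mat m' n' \<Longrightarrow> kron A B \<in> carrier_mat (m * m') (n * n')"
  by (auto simp: kron_def)

lemma kron_entry:
  assumes "A \<in> carrier_mat m n" "B \<in> carrier_mat m' n'" "i < m * m'" "j < n * n'"
  shows "kron A B $$ (i,j) = A $$ (i div m', j div n') * B $$ (i mod m', j mod n')"
  using assms by (auto simp: kron_def)

text \<open>The mixed-product property: the inner sum factors once its index is split into quotient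
  and remainder.\<close>

lemma kron_mult:
  assumes A: "A \<in> carrier_mat m n" and B: "B \<in> carrier_mat m' n'"
    and C: "C \<in> carrier_mat n k" and D: "D \<in> carrier_mat n' k'"
  shows "kron A B * kron C D = kron (A * C) (B * D)"
proof (rule eq_matI)
  note AB = kron_carrier[OF A B] and CD = kron_carrier[OF C D]
  have AC: "A * C \<in> carrier_mat m k" and BD: "B * D \<in> carrier_mat m' k'" using assms by auto
  fix i j assume "i < dim_row (kron (A * C) (B * D))" "j < dim_col (kron (A * C) (B * D))"
  hence ij: "i < m * m'" "j < k * k'" using kron_carrier[OF AC BD] by auto
  note dm = div_mod_less[OF ij(1)] div_mod_less[OF ij(2)]
  have "(kron A B * kron C D) $$ (i,j) = (\<Sum>l<n*n'. kron A B $$ (i,l) * kron C D $$ (l,j))"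
    by (rule mat_mult_entry[OF AB CD ij])
  also have "\<dots> = (\<Sum>l<n*n'. (A $$ (i div m', l div n') * B $$ (i mod m', l mod n')) *
       (C $$ (l div n', j div k') * D $$ (l mod n', j mod k')))"
    using kron_entry[OF A B ij(1)] kron_entry[OF C D _ ij(2)] by (intro sum.cong) auto
  also have "\<dots> = (\<Sum>l<n. \<Sum>l'<n'. (A $$ (i div m', l) * B $$ (i mod m', l')) *
       (C $$ (l, j div k') * D $$ (l', j mod k')))"
    by (rule sum_div_mod)
  also have "\<dots> = (\<Sum>l<n. A $$ (i div m', l) * C $$ (l, j div k')) * (\<Sum>l'<n'. B $$ (i mod m', l') * D $$ (l', j mod k'))"
    unfolding sum_product by (intro sum.cong refl) (simp add: mult_ac)
  also have "\<dots> = kron (A * C) (B * D) $$ (i,j)"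
    unfolding kron_entry[OF AC BD ij] mat_mult_entry[OF A C dm(1,3)] mat_mult_entry[OF B D dm(2,4)] ..
  finally show "(kron A B * kron C D) $$ (i,j) = kron (A * C) (B * D) $$ (i,j)" .
qed (use assms in \<open>auto simp: kron_def\<close>)

lemma adj_kron: "adj (kron A B) = kron (adj A) (adj B)"
proof (rule eq_matI)
  fix i j assume "i < dim_row (kron (adj A) (adj B))" "j < dim_col (kron (adj A) (adj B))"
  hence ij: "i < dim_col A * dim_col B" "j < dim_row A * dim_row B" by (auto simp: kron_def)
  show "adj (kron A B) $$ (i,j) = kron (adj A) (adj B) $$ (i,j)"
    using ij div_mod_less[OF ij(1)] div_mod_less[OF ij(2)] by (simp add: adj_def kron_def)
qed (auto simp: kron_def)

lemma tr_kron:
  assumes A: "A \<in> carrier_mat m m" and B: "B \<in> carrier_mat n n"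
  shows "tr (kron A B) = tr A * tr B"
proof -
  have "tr (kron A B) = (\<Sum>i<m * n. A $$ (i div n, i div n) * B $$ (i mod n, i mod n))"
    unfolding tr_def using kron_carrier[OF A B] kron_entry[OF A B] by (auto intro!: sum.cong)
  also have "\<dots> = tr A * tr B"
    using A B sum_div_mod[of "\<lambda>i j. A $$ (i,i) * B $$ (j,j)" n m] by (simp add: tr_def sum_product)
  finally show ?thesis .
qed

lemma kron_real_diag:
  "kron (real_diag m p) (real_diag n q) = real_diag (m * n) (\<lambda>i. p (i div n) * q (i mod n))"
proof (rule eq_matI)
  let ?R = "real_diag (m * n) (\<lambda>i. p (i div n) * q (i mod n))"
  fix i j assume "i < dim_row ?R" "j < dim_col ?R"
  hence ij: "i < m * n" "j < m * n" by auto
  note dm = div_mod_less[OF ij(1)] div_mod_less[OF ij(2)]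
  have "i = j \<longleftrightarrow> i div n = j div n \<and> i mod n = j mod n" by (metis div_mult_mod_eq)
  thus "kron (real_diag m p) (real_diag n q) $$ (i,j) = ?R $$ (i,j)"
    using ij dm kron_entry[OF real_diag_carrier real_diag_carrier ij] by (auto simp: real_diag_def)
qed (auto simp: kron_def)

lemma kron_one: "kron (1\<^sub>m m) (1\<^sub>m n) = 1\<^sub>m (m * n)"
proof -
  have "real_diag k (\<lambda>_. 1) = 1\<^sub>m k" for k by (rule eq_matI) (auto simp: real_diag_def)
  thus ?thesis using kron_real_diag[of m "\<lambda>_. 1" n "\<lambda>_. 1"] by simp
qed

lemma unitary_kron:
  assumes "unitary_mat m U" "unitary_mat n V"
  shows "unitary_mat (m * n) (kron U V)"
  using assms kron_mult[of "adj U" m m "adj V" n n U m V n]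
  by (auto simp: unitary_mat_def adj_kron kron_one)

text \<open>Gives product states an explicit eigenbasis and explicit eigenvalues, so the typical
  projections can be written down instead of being obtained from an abstract diagonalization in
  dimension \<open>d ^ n\<close>.\<close>

lemma kron_spec_mat:
  assumes U: "U \<in> carrier_mat m m" and V: "V \<in> carrier_mat n n"
  shows "kron (spec_mat m U p) (spec_mat n V q) = spec_mat (m * n) (kron U V) (\<lambda>i. p (i div n) * q (i mod n))"
proof -
  have "spec_mat (m * n) (kron U V) (\<lambda>i. p (i div n) * q (i mod n))
     = kron U V * kron (real_diag m p) (real_diag n q) * kron (adj U) (adj V)"
    by (simp add: spec_mat_def kron_real_diag adj_kron)
  also have "kron U V * kron (real_diag m p) (real_diag n q) = kron (U * real_diag m p) (V * real_diag n q)"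
    by (rule kron_mult[OF U V]) auto
  also have "kron (U * real_diag m p) (V * real_diag n q) * kron (adj U) (adj V) = 
     kron (U * real_diag m p * adj U) (V * real_diag n q * adj V)"
    by (rule kron_mult[of _ m m _ n n]) (use U V in auto)
  finally show ?thesis by (simp add: spec_mat_def)
qed

lemma kron_list_Nil [simp]: "kron_list [] = 1\<^sub>m 1"
  by (simp add: kron_list_def)

lemma kron_list_Cons [simp]: "kron_list (A # As) = kron A (kron_list As)"
  by (simp add: kron_list_def)

lemma kron_list_carrier:
  assumes "\<And>A. A \<in> set As \<Longrightarrow> A \<in> carrier_mat d d"
  shows "kron_list As \<in> carrier_mat (d ^ length As) (d ^ length As)"
  using assms by (induction As) auto

lemma kron_list_map_carrier:
  assumes "\<And>x. x \<in> set xs \<Longrightarrow> f x \<in> carrier_mat d d"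
  shows "kron_list (map f xs) \<in> carrier_mat (d ^ length xs) (d ^ length xs)"
  using kron_list_carrier[of "map f xs" d] assms by auto

lemma kron_list_mult:
  assumes "\<And>x. x \<in> set xs \<Longrightarrow> f x \<in> carrier_mat d d" "\<And>x. x \<in> set xs \<Longrightarrow> g x \<in> carrier_mat d d"
  shows "kron_list (map f xs) * kron_list (map g xs) = kron_list (map (\<lambda>x. f x * g x) xs)"
  using assms
proof (induction xs)
  case (Cons x xs)
  have "kron (f x) (kron_list (map f xs)) * kron (g x) (kron_list (map g xs))
      = kron (f x * g x) (kron_list (map f xs) * kron_list (map g xs))"
    by (rule kron_mult[of _ d d _ "d ^ length xs" "d ^ length xs" _ d _ "d ^ length xs"])
      (use Cons.prems in \<open>auto intro!: kron_list_map_carrier\<close>)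
  thus ?case using Cons by simp
qed simp

lemma adj_kron_list: "adj (kron_list As) = kron_list (map adj As)"
  by (induction As) (auto simp: adj_kron)

lemma tr_one: "tr (1\<^sub>m n) = of_nat n"
  by (simp add: tr_def)

lemma tr_kron_list:
  assumes "\<And>x. x \<in> set xs \<Longrightarrow> f x \<in> carrier_mat d d"
  shows "tr (kron_list (map f xs)) = (\<Prod>x\<leftarrow>xs. tr (f x))"
  using assms
proof (induction xs)
  case (Cons x xs)
  have "tr (kron (f x) (kron_list (map f xs))) = tr (f x) * tr (kron_list (map f xs))"
    by (rule tr_kron[of _ d _ "d ^ length xs"]) (use Cons.prems in \<open>auto intro!: kron_list_map_carrier\<close>)
  thus ?case using Cons by simp
qed (simp add: tr_one)

text \<open>Indices below \<open>d ^ n\<close> are read as words of \<open>n\<close> base-\<open>d\<close> digits, most significant digit first,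
  matching the index convention of \<^const>\<open>kron\<close>.\<close>

fun prod_weight :: "nat \<Rightarrow> (nat \<Rightarrow> real) list \<Rightarrow> nat \<Rightarrow> real" where
  "prod_weight d [] i = 1"
| "prod_weight d (p # ps) i = p (i div d ^ length ps) * prod_weight d ps (i mod d ^ length ps)"

lemma unitary_kron_list:
  assumes "\<And>x. x \<in> set xs \<Longrightarrow> unitary_mat d (U x)"
  shows "unitary_mat (d ^ length xs) (kron_list (map U xs))"
  using assms
proof (induction xs)
  case (Cons x xs)
  thus ?case using unitary_kron[of d "U x" "d ^ length xs" "kron_list (map U xs)"] by simp
qed (simp add: unitary_one)

lemma kron_list_spec_mat:
  assumes "\<And>x. x \<in> set xs \<Longrightarrow> U x \<in> carrier_mat d d"
  shows "kron_list (map (\<lambda>x. spec_mat d (U x) (p x)) xs)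
       = spec_mat (d ^ length xs) (kron_list (map U xs)) (prod_weight d (map p xs))"
  using assms
proof (induction xs)
  case Nil
  show ?case using spec_mat_one[OF unitary_one, of 1] by (simp add: fun_eq_iff[symmetric] prod_weight.simps(1)[abs_def])
next
  case (Cons x xs)
  thus ?case
    using kron_spec_mat[of "U x" d "kron_list (map U xs)" "d ^ length xs" "p x" "prod_weight d (map p xs)"]
      kron_list_map_carrier[of xs U d] by (simp add: prod_weight.simps(2)[abs_def])
qed

section \<open>Acceptance probabilities of effects\<close>

lemma tr_square_spec_mat:
  assumes A: "A \<in> carrier_mat n n" "adj A = A" and U: "U \<in> carrier_mat n n"
  shows "tr (A * A * spec_mat n U e) = of_real (\<Sum>i<n. \<Sum>l<n. e l * (cmod ((A * U) $$ (i,l)))\<^sup>2)"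
proof -
  let ?D = "real_diag n e"
  have AU: "A * U \<in> carrier_mat n n" using A U by auto
  have S: "spec_mat n U e \<in> carrier_mat n n" using U by simp
  have "tr (A * A * spec_mat n U e) = tr (A * (A * spec_mat n U e))"
    by (rule arg_cong[of _ _ tr], rule assoc_mult_mat[of _ n n _ n _ n]) (use A S in auto)
  \<comment> \<open>Cyclicity puts one copy of \<open>A\<close> on each side of the effect. With
    \<open>A\<close> a root of a state, the acceptance probability becomes a weighted sum of squared
    moduli of entries.\<close>
  also have "\<dots> = tr (A * spec_mat n U e * A)"
    by (rule tr_comm[of _ n n]) (use A S in auto)
  also have "A * spec_mat n U e = A * (U * ?D) * adj U"
    unfolding spec_mat_def by (rule assoc_mult_mat[of _ n n _ n _ n, symmetric]) (use A U in auto)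
  also have "A * (U * ?D) = A * U * ?D"
    by (rule assoc_mult_mat[of _ n n _ n _ n, symmetric]) (use A U in auto)
  also have "A * U * ?D * adj U * A = A * U * ?D * (adj U * A)"
    by (rule assoc_mult_mat[of _ n n _ n _ n]) (use A U in auto)
  also have "adj U * A = adj (A * U)" using adj_mult[OF A(1) U] A(2) by simp
  \<comment> \<open>Here \<open>spec_mat\<close> is applied to \<open>A * U\<close>, which is
    generally not unitary; the entry formula asks only for the dimensions.\<close>
  also have "A * U * ?D * adj (A * U) = spec_mat n (A * U) e" by (simp add: spec_mat_def)
  also have "tr (spec_mat n (A * U) e) = (\<Sum>i<n. spec_mat n (A * U) e $$ (i,i))"
    using spec_mat_carrier[OF AU, of e] by (simp only: tr_def carrier_matD)
  also have "\<dots> = of_real (\<Sum>i<n. \<Sum>l<n. e l * (cmod ((A * U) $$ (i,l)))\<^sup>2)"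
    unfolding of_real_sum of_real_mult complex_norm_square
    by (rule sum.cong[OF refl], rule spec_mat_entry[OF AU]) auto
  finally show ?thesis .
qed

lemma one_minus_spec_mat:
  assumes "unitary_mat n U"
  shows "1\<^sub>m n - spec_mat n U e = spec_mat n U (\<lambda>i. 1 - e i)"
proof (rule eq_matI)
  note Uc = unitary_carrier[OF assms]
  fix i j assume "i < dim_row (spec_mat n U (\<lambda>i. 1 - e i))" "j < dim_col (spec_mat n U (\<lambda>i. 1 - e i))"
  hence ij: "i < n" "j < n" using spec_mat_carrier[OF Uc, of "\<lambda>i. 1 - e i"] by auto
  have "(1\<^sub>m n - spec_mat n U e) $$ (i,j) = spec_mat n U (\<lambda>_. 1) $$ (i,j) - spec_mat n U e $$ (i,j)"
    using ij spec_mat_carrier[OF Uc, of e] spec_mat_one[OF assms] by simp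
  also have "\<dots> = spec_mat n U (\<lambda>i. 1 - e i) $$ (i,j)"
    unfolding spec_mat_entry[OF Uc ij] by (simp add: sum_subtractf[symmetric] algebra_simps)
  finally show "(1\<^sub>m n - spec_mat n U e) $$ (i,j) = spec_mat n U (\<lambda>i. 1 - e i) $$ (i,j)" .
qed (simp_all add: carrier_matD[OF spec_mat_carrier[OF unitary_carrier[OF assms]]])

lemma effect_spec_mat:
  assumes "unitary_mat n U" "\<And>i. i < n \<Longrightarrow> 0 \<le> e i" "\<And>i. i < n \<Longrightarrow> e i \<le> 1"
  shows "effect n (spec_mat n U e)"
  unfolding effect_def one_minus_spec_mat[OF assms(1)]
  using assms psd_spec_mat[OF unitary_carrier[OF assms(1)]] by auto

text \<open>A Cauchy-Schwarz bound with a free parameter: entrywise, the difference of squares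
  factors into a difference, controlled by the Hilbert-Schmidt distance, and a sum, controlled by
  the traces. The parameter \<open>t\<close> balances the two without square roots.\<close>

lemma tr_effect_diff_le:
  assumes A: "A \<in> carrier_mat n n" "adj A = A" and B: "B \<in> carrier_mat n n" "adj B = B"
    and E: "effect n E" and t: "t > 0"
  shows "Re (tr (A * A * E)) - Re (tr (B * B * E))
     \<le> t / 2 * (hs_dist A B)\<^sup>2 + (Re (tr (A * A)) + Re (tr (B * B))) / t"
proof -
  have psdE: "psd n E" "psd n (1\<^sub>m n - E)" using E by (auto simp: effect_def)
  obtain U e where U: "unitary_mat n U" "\<And>i. i < n \<Longrightarrow> e i \<ge> 0" "E = spec_mat n U e"
    using psd_spectral[OF psdE(1)] by blast
  note Uc = unitary_carrier[OF U(1)]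
  have "1\<^sub>m n - E = spec_mat n U (\<lambda>i. 1 - e i)" unfolding U(3) by (rule one_minus_spec_mat[OF U(1)])
  hence e1: "e i \<le> 1" if "i < n" for i
    using psd_spec_mat_nonneg[OF U(1) _ that, of "\<lambda>i. 1 - e i"] psdE(2) by auto
  define a where "a i l = (A * U) $$ (i,l)" for i l
  define b where "b i l = (B * U) $$ (i,l)" for i l
  \<comment> \<open>Right multiplication by the unitary \<open>U\<close> preserves the
    Hilbert-Schmidt norm: this is the trace formula with all weights equal to 1.\<close>
  have f: "(\<Sum>i<n. \<Sum>l<n. (cmod ((C * U) $$ (i,l)))\<^sup>2) = Re (tr (C * C))" if "C \<in> carrier_mat n n" "adj C = C" for C
    using tr_square_spec_mat[OF that Uc, of "\<lambda>_. 1"] spec_mat_one[OF U(1)] that by simp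
  have fd: "(\<Sum>i<n. \<Sum>l<n. (cmod (a i l - b i l))\<^sup>2) = (hs_dist A B)\<^sup>2"
  proof -
    have C: "A - B \<in> carrier_mat n n" "adj (A - B) = A - B"
    proof -
      show "adj (A - B) = A - B"
      proof (rule eq_matI)
        fix i j assume "i < dim_row (A - B)" "j < dim_col (A - B)"
        thus "adj (A - B) $$ (i,j) = (A - B) $$ (i,j)"
          using A B adj_entry[of i A j] adj_entry[of i B j] by auto
      qed (use A B in auto)
    qed (use A B in auto)
    have "a i l - b i l = ((A - B) * U) $$ (i,l)" if "i < n" "l < n" for i l
      unfolding a_def b_def
      using minus_mult_distrib_mat[OF A(1) B(1) Uc] that A B Uc by simp
    hence "(\<Sum>i<n. \<Sum>l<n. (cmod (a i l - b i l))\<^sup>2) = Re (tr ((A - B) * (A - B)))"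
      using f[OF C] by simp
    also have "\<dots> = Re (\<Sum>i<n. \<Sum>j<n. (A - B) $$ (i,j) * cnj ((A - B) $$ (i,j)))"
    proof -
      have h: "(A - B) $$ (i,j) * (A - B) $$ (j,i) = (A - B) $$ (i,j) * cnj ((A - B) $$ (i,j))" if "i < n" "j < n" for i j
      proof -
        have "adj (A - B) $$ (j,i) = cnj ((A - B) $$ (i,j))"
          by (rule adj_entry) (use A B that in auto)
        thus ?thesis unfolding C(2) by (rule arg_cong)
      qed
      show ?thesis unfolding tr_mult[OF C(1) C(1)]
        by (rule arg_cong[of _ _ Re], rule sum.cong[OF refl], rule sum.cong[OF refl], rule h) auto
    qed
    also have "\<dots> = (\<Sum>i<n. \<Sum>j<n. (cmod (A $$ (i,j) - B $$ (i,j)))\<^sup>2)"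
      unfolding complex_norm_square[symmetric] using A B by simp
    also have "\<dots> = (hs_dist A B)\<^sup>2" using A by (simp add: hs_dist_def sum_nonneg)
    finally show ?thesis .
  qed
  have "Re (tr (A * A * E)) - Re (tr (B * B * E)) = (\<Sum>i<n. \<Sum>l<n. e l * ((cmod (a i l))\<^sup>2 - (cmod (b i l))\<^sup>2))"
    unfolding U(3) tr_square_spec_mat[OF A Uc] tr_square_spec_mat[OF B Uc] a_def b_def
    by (simp add: sum_subtractf right_diff_distrib)
  also have "\<dots> \<le> (\<Sum>i<n. \<Sum>l<n. t / 2 * (cmod (a i l - b i l))\<^sup>2 + ((cmod (a i l))\<^sup>2 + (cmod (b i l))\<^sup>2) / t)"
  proof (intro sum_mono)
    fix i l assume "i \<in> {..<n}" "l \<in> {..<n}"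
    hence el: "0 \<le> e l" "e l \<le> 1" using U(2) e1 by auto
    define x y z where "x = cmod (a i l)" and "y = cmod (b i l)" and "z = cmod (a i l - b i l)"
    have xyz: "x \<ge> 0" "y \<ge> 0" "z \<ge> 0" "\<bar>x - y\<bar> \<le> z"
      unfolding x_def y_def z_def by (simp_all add: norm_triangle_ineq3)
    have "e l * (x\<^sup>2 - y\<^sup>2) \<le> \<bar>x\<^sup>2 - y\<^sup>2\<bar>"
    proof -
      have "e l * (x\<^sup>2 - y\<^sup>2) \<le> e l * \<bar>x\<^sup>2 - y\<^sup>2\<bar>" using el by (intro mult_left_mono) auto
      also have "\<dots> \<le> 1 * \<bar>x\<^sup>2 - y\<^sup>2\<bar>" using el by (intro mult_right_mono) auto
      finally show ?thesis by simp
    qed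
    also have "\<bar>x\<^sup>2 - y\<^sup>2\<bar> = \<bar>x - y\<bar> * (x + y)"
      using xyz by (simp add: power2_eq_square square_diff_square_factored abs_mult mult.commute)
    also have "\<dots> \<le> z * (x + y)" using xyz by (intro mult_right_mono) auto
    also have "\<dots> \<le> t / 2 * z\<^sup>2 + (x\<^sup>2 + y\<^sup>2) / t"
    proof -
      \<comment> \<open>The extra square (x - y)^2 turns (x + y)^2 into 2 (x^2 + y^2), which sums to
        the traces.\<close>
      have "0 \<le> (t * z - (x + y))\<^sup>2 + (x - y)\<^sup>2" by simp
      hence "2 * t * (z * (x + y)) \<le> t\<^sup>2 * z\<^sup>2 + 2 * (x\<^sup>2 + y\<^sup>2)"
        by (simp add: power2_eq_square algebra_simps)
      thus ?thesis using t by (simp add: field_simps power2_eq_square)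
    qed
    finally show "e l * ((cmod (a i l))\<^sup>2 - (cmod (b i l))\<^sup>2)
      \<le> t / 2 * (cmod (a i l - b i l))\<^sup>2 + ((cmod (a i l))\<^sup>2 + (cmod (b i l))\<^sup>2) / t"
      by (simp add: x_def y_def z_def)
  qed
  also have "\<dots> = t / 2 * (\<Sum>i<n. \<Sum>l<n. (cmod (a i l - b i l))\<^sup>2)
     + ((\<Sum>i<n. \<Sum>l<n. (cmod (a i l))\<^sup>2) + (\<Sum>i<n. \<Sum>l<n. (cmod (b i l))\<^sup>2)) / t"
    by (simp add: sum.distrib sum_distrib_left sum_divide_distrib add_divide_distrib)
  also have "\<dots> = t / 2 * (hs_dist A B)\<^sup>2 + (Re (tr (A * A)) + Re (tr (B * B))) / t"
    unfolding fd unfolding a_def b_def f[OF A] f[OF B] ..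
  finally show ?thesis .
qed

section \<open>Square roots of product states\<close>

lemma density_spectral:
  assumes "density d \<sigma>"
  obtains U p where "unitary_mat d U" "\<And>i. i < d \<Longrightarrow> p i \<ge> 0" "(\<Sum>i<d. p i) = 1" "\<sigma> = spec_mat d U p"
proof -
  obtain U p where U: "unitary_mat d U" "\<And>i. i < d \<Longrightarrow> p i \<ge> 0" "\<sigma> = spec_mat d U p"
    using psd_spectral[of d \<sigma>] assms by (auto simp: density_def)
  moreover have "(\<Sum>i<d. p i) = 1"
    using assms tr_spec_mat[OF U(1), of p] U(3) by (simp only: density_def of_real_eq_1_iff)
  ultimately show thesis using that by blast
qed

lemma mat_sqrt_density:
  assumes "density d \<sigma>"
  shows "mat_sqrt d \<sigma> \<in> carrier_mat d d" "adj (mat_sqrt d \<sigma>) = mat_sqrt d \<sigma>"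
    "mat_sqrt d \<sigma> * mat_sqrt d \<sigma> = \<sigma>" "tr \<sigma> = 1"
proof -
  obtain U p where U: "unitary_mat d U" "\<And>i. i < d \<Longrightarrow> p i \<ge> 0" "\<sigma> = spec_mat d U p"
    using density_spectral[OF assms] by metis
  note s = mat_sqrt_spec_mat[of d U p, OF U(1,2)]
  show "mat_sqrt d \<sigma> \<in> carrier_mat d d" "adj (mat_sqrt d \<sigma>) = mat_sqrt d \<sigma>"
    using unitary_carrier[OF U(1)] by (auto simp: U(3) s adj_spec_mat)
  have "spec_mat d U (\<lambda>i. sqrt (p i) * sqrt (p i)) = spec_mat d U p"
    by (rule spec_mat_cong) (use U(2) in auto)
  thus "mat_sqrt d \<sigma> * mat_sqrt d \<sigma> = \<sigma>"
    by (simp add: U(3) s spec_mat_mult[OF U(1)])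
  show "tr \<sigma> = 1" using assms by (simp add: density_def)
qed

text \<open>In the two eigenbases the affinity is a sum of nonnegative terms, hence real and
  nonnegative. The resulting bound 2 on the squared distance keeps the factors
  \<open>1 - h^2 / 2\<close> of a product state in [0,1].\<close>

lemma tr_mat_sqrt_mult:
  assumes "density d \<sigma>" "density d \<tau>"
  shows "tr (mat_sqrt d \<sigma> * mat_sqrt d \<tau>) = of_real (1 - (hs_dist (mat_sqrt d \<sigma>) (mat_sqrt d \<tau>))\<^sup>2 / 2)"
    and "(hs_dist (mat_sqrt d \<sigma>) (mat_sqrt d \<tau>))\<^sup>2 \<le> 2"
proof -
  obtain U p where U: "unitary_mat d U" "\<And>i. i < d \<Longrightarrow> p i \<ge> 0" "\<sigma> = spec_mat d U p"
    using density_spectral[OF assms(1)] by metis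
  obtain V q where V: "unitary_mat d V" "\<And>i. i < d \<Longrightarrow> q i \<ge> 0" "\<tau> = spec_mat d V q"
    using density_spectral[OF assms(2)] by metis
  define x where "x = (\<Sum>y<d. \<Sum>z<d. sqrt (p y) * sqrt (q z) * overlap U V y z)"
  have "mat_sqrt d \<sigma> = spec_mat d U (\<lambda>i. sqrt (p i))" "mat_sqrt d \<tau> = spec_mat d V (\<lambda>i. sqrt (q i))"
    unfolding U(3) V(3) by (rule mat_sqrt_spec_mat; use U(1,2) V(1,2) in simp)+
  hence t: "tr (mat_sqrt d \<sigma> * mat_sqrt d \<tau>) = of_real x"
    using tr_spec_mat_mult[OF unitary_carrier[OF U(1)] unitary_carrier[OF V(1)]] by (simp only: x_def)
  have "x \<ge> 0" unfolding x_def by (intro sum_nonneg mult_nonneg_nonneg) (use U V in auto)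
  moreover have "(hs_dist (mat_sqrt d \<sigma>) (mat_sqrt d \<tau>))\<^sup>2 = 2 - 2 * x"
    using hs_dist_sq[OF mat_sqrt_density(1,2)[OF assms(1)] mat_sqrt_density(1,2)[OF assms(2)]]
    by (simp add: t mat_sqrt_density(3,4)[OF assms(1)] mat_sqrt_density(3,4)[OF assms(2)])
  ultimately have "x = 1 - (hs_dist (mat_sqrt d \<sigma>) (mat_sqrt d \<tau>))\<^sup>2 / 2"
    and 2: "(hs_dist (mat_sqrt d \<sigma>) (mat_sqrt d \<tau>))\<^sup>2 \<le> 2" by linarith+
  thus "tr (mat_sqrt d \<sigma> * mat_sqrt d \<tau>) = of_real (1 - (hs_dist (mat_sqrt d \<sigma>) (mat_sqrt d \<tau>))\<^sup>2 / 2)"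
    using t by (simp only:)
  show "(hs_dist (mat_sqrt d \<sigma>) (mat_sqrt d \<tau>))\<^sup>2 \<le> 2" by (rule 2)
qed

text \<open>Built from the letter roots rather than as \<open>mat_sqrt\<close> of the tensor
  product: being Hermitian with the right square is all that the distance estimates need, and
  multiplicativity of traces is then immediate.\<close>

definition word_sqrt :: "('x \<Rightarrow> complex mat) \<Rightarrow> nat \<Rightarrow> nat \<Rightarrow> (nat \<Rightarrow> 'x) \<Rightarrow> complex mat" where
  "word_sqrt W d n u = kron_list (map (\<lambda>i. mat_sqrt d (W (u i))) [0..<n])"

text \<open>The additive substitute for the squared distance of word roots. It bounds that distance
  from above, and half of it is the exponent by which the affinity of two words decays.\<close>

definition word_dist2 :: "('x \<Rightarrow> complex mat) \<Rightarrow> nat \<Rightarrow> nat \<Rightarrow> (nat \<Rightarrow> 'x) \<Rightarrow> (nat \<Rightarrow> 'x) \<Rightarrow> real" where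
  "word_dist2 W d n u v = (\<Sum>i<n. (hs_dist (mat_sqrt d (W (u i))) (mat_sqrt d (W (v i))))\<^sup>2)"

lemma word_sqrt:
  assumes "\<forall>i<n. density d (W (u i))"
  shows "word_sqrt W d n u \<in> carrier_mat (d ^ n) (d ^ n)" "adj (word_sqrt W d n u) = word_sqrt W d n u"
    "word_sqrt W d n u * word_sqrt W d n u = tensor_word W n u" "tr (tensor_word W n u) = 1"
proof -
  have c: "mat_sqrt d (W (u i)) \<in> carrier_mat d d" if "i \<in> set [0..<n]" for i
    using mat_sqrt_density(1) assms that by simp
  show "word_sqrt W d n u \<in> carrier_mat (d ^ n) (d ^ n)"
    unfolding word_sqrt_def using kron_list_map_carrier[of "[0..<n]", OF c] by simp
  have "map adj (map (\<lambda>i. mat_sqrt d (W (u i))) [0..<n]) = map (\<lambda>i. mat_sqrt d (W (u i))) [0..<n]"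
    using mat_sqrt_density(2) assms by simp
  thus "adj (word_sqrt W d n u) = word_sqrt W d n u"
    unfolding word_sqrt_def adj_kron_list by (simp only:)
  have "map (\<lambda>i. mat_sqrt d (W (u i)) * mat_sqrt d (W (u i))) [0..<n] = map (\<lambda>i. W (u i)) [0..<n]"
    using mat_sqrt_density(3) assms by simp
  thus "word_sqrt W d n u * word_sqrt W d n u = tensor_word W n u"
    unfolding word_sqrt_def tensor_word_def using kron_list_mult[of "[0..<n]", OF c c] by (simp only:)
  have "tr (tensor_word W n u) = (\<Prod>i\<leftarrow>[0..<n]. tr (W (u i)))"
    unfolding tensor_word_def by (rule tr_kron_list[of _ _ d]) (use assms in \<open>auto simp: density_def psd_def\<close>)
  also have "map (\<lambda>i. tr (W (u i))) [0..<n] = map (\<lambda>i. 1) [0..<n]"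
    using assms by (simp add: density_def)
  also have "(\<Prod>i\<leftarrow>[0..<n]. 1) = (1 :: complex)" by (induction n) auto
  finally show "tr (tensor_word W n u) = 1" .
qed

lemma tr_word_sqrt_mult:
  assumes "\<forall>i<n. density d (W (u i))" "\<forall>i<n. density d (W (v i))"
  shows "tr (word_sqrt W d n u * word_sqrt W d n v)
     = of_real (\<Prod>i<n. 1 - (hs_dist (mat_sqrt d (W (u i))) (mat_sqrt d (W (v i))))\<^sup>2 / 2)"
proof -
  have cu: "mat_sqrt d (W (u i)) \<in> carrier_mat d d" if "i \<in> set [0..<n]" for i
    using mat_sqrt_density(1) assms(1) that by simp
  have cv: "mat_sqrt d (W (v i)) \<in> carrier_mat d d" if "i \<in> set [0..<n]" for i
    using mat_sqrt_density(1) assms(2) that by simp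
  have "word_sqrt W d n u * word_sqrt W d n v = kron_list (map (\<lambda>i. mat_sqrt d (W (u i)) * mat_sqrt d (W (v i))) [0..<n])"
    unfolding word_sqrt_def by (rule kron_list_mult) (erule cu, erule cv)
  also have "tr \<dots> = (\<Prod>i\<leftarrow>[0..<n]. tr (mat_sqrt d (W (u i)) * mat_sqrt d (W (v i))))"
    by (rule tr_kron_list[of _ _ d], rule mult_carrier_mat[of _ d d], erule cu, erule cv)
  also have "\<dots> = (\<Prod>i\<in>set [0..<n]. tr (mat_sqrt d (W (u i)) * mat_sqrt d (W (v i))))"
    by (rule prod.distinct_set_conv_list[symmetric]) simp
  also have "\<dots> = (\<Prod>i\<in>{..<n}. of_real (1 - (hs_dist (mat_sqrt d (W (u i))) (mat_sqrt d (W (v i))))\<^sup>2 / 2))"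
    by (rule prod.cong) (use tr_mat_sqrt_mult(1) assms in \<open>auto simp del: of_real_diff\<close>)
  finally show ?thesis by (simp only: of_real_prod)
qed

text \<open>The Weierstrass product inequality; the step uses that the partial product is at most
  1.\<close>

lemma prod_one_minus_ge:
  fixes x :: "nat \<Rightarrow> real"
  assumes "\<And>i. i < n \<Longrightarrow> 0 \<le> x i" "\<And>i. i < n \<Longrightarrow> x i \<le> 1"
  shows "1 - (\<Sum>i<n. x i) \<le> (\<Prod>i<n. 1 - x i)"
  using assms
proof (induction n)
  case (Suc n)
  have p: "(\<Prod>i<n. 1 - x i) \<le> 1" by (rule prod_le_1) (use Suc.prems less_SucI in auto)
  have "x n * (\<Prod>i<n. 1 - x i) \<le> x n * 1" by (rule mult_left_mono[OF p]) (use Suc.prems in auto)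
  moreover have "1 - (\<Sum>i<n. x i) \<le> (\<Prod>i<n. 1 - x i)" using Suc by auto
  ultimately show ?case by (simp add: algebra_simps)
qed simp

lemma prod_one_minus_le_exp:
  fixes x :: "nat \<Rightarrow> real"
  assumes "\<And>i. i < n \<Longrightarrow> x i \<le> 1"
  shows "(\<Prod>i<n. 1 - x i) \<le> exp (- (\<Sum>i<n. x i))"
proof -
  have "(\<Prod>i<n. 1 - x i) \<le> (\<Prod>i<n. exp (- x i))"
    by (rule prod_mono) (use assms exp_ge_add_one_self[of "- x _"] in auto)
  thus ?thesis by (simp add: exp_sum sum_negf[symmetric])
qed

text \<open>The squared distance of the word roots is twice one minus the product of the letter
  affinities, and the Weierstrass inequality makes this subadditive over the letters.\<close>

lemma hs_dist_word_sqrt_le: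
  assumes "\<forall>i<n. density d (W (u i))" "\<forall>i<n. density d (W (v i))"
  shows "(hs_dist (word_sqrt W d n u) (word_sqrt W d n v))\<^sup>2 \<le> word_dist2 W d n u v"
proof -
  let ?x = "\<lambda>i. (hs_dist (mat_sqrt d (W (u i))) (mat_sqrt d (W (v i))))\<^sup>2 / 2"
  note wu = word_sqrt[of n d W u, OF assms(1)] and wv = word_sqrt[of n d W v, OF assms(2)]
  have "(hs_dist (word_sqrt W d n u) (word_sqrt W d n v))\<^sup>2 = 2 - 2 * (\<Prod>i<n. 1 - ?x i)"
    unfolding hs_dist_sq[OF wu(1,2) wv(1,2)] wu(3,4) wv(3,4) tr_word_sqrt_mult[of n d W u v, OF assms]
    unfolding Re_complex_of_real one_complex.sel by simp
  also have "\<dots> \<le> 2 * (\<Sum>i<n. ?x i)"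
    using prod_one_minus_ge[of n ?x] tr_mat_sqrt_mult(2) assms by auto
  finally show ?thesis by (simp add: word_dist2_def sum_distrib_left)
qed

text \<open>The test of word \<open>j\<close> accepts its own state and rejects that of word
  \<open>k\<close> with a gap of at least e = \<open>1 - l1 - l2\<close>. Close roots would make
  such a gap impossible.\<close>

lemma di_code_word_dist:
  assumes "di_code W X d n N l1 l2 u E" "\<And>x. x \<in> X \<Longrightarrow> density d (W x)" "l1 + l2 < 1"
    and jk: "j < N" "k < N" "j \<noteq> k"
  shows "(1 - l1 - l2)\<^sup>2 / 4 \<le> word_dist2 W d n (u j) (u k)"
proof -
  define e where "e = 1 - l1 - l2"
  have e: "e > 0" using assms(3) by (simp add: e_def)
  have dj: "\<forall>i<n. density d (W (u j i))" and dk: "\<forall>i<n. density d (W (u k i))"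
    using assms(1,2) jk by (auto simp: di_code_def)
  note wj = word_sqrt[of n d W "u j", OF dj] and wk = word_sqrt[of n d W "u k", OF dk]
  have E: "effect (d ^ n) (E j)" "Re (tr (tensor_word W n (u j) * E j)) \<ge> 1 - l1"
    "Re (tr (tensor_word W n (u k) * E j)) \<le> l2"
    using assms(1) jk by (auto simp: di_code_def)
  let ?D = "(hs_dist (word_sqrt W d n (u j)) (word_sqrt W d n (u k)))\<^sup>2"
  \<comment> \<open>With \<open>t = 4 / e\<close> the trace term, where both traces are 1, equals e
    / 2 and uses half of the gap; the other half gives the bound e^2 / 4.\<close>
  have "e \<le> (4 / e) / 2 * ?D + 2 / (4 / e)"
    using tr_effect_diff_le[OF wj(1,2) wk(1,2) E(1), of "4 / e"] E(2,3) e
    unfolding wj(3,4) wk(3,4) by (simp add: e_def)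
  hence "e\<^sup>2 / 4 \<le> ?D" using e by (simp add: field_simps power2_eq_square)
  also have "\<dots> \<le> word_dist2 W d n (u j) (u k)" by (rule hs_dist_word_sqrt_le) (fact dj, fact dk)
  finally show ?thesis by (simp add: e_def)
qed

text \<open>The trace is a sum of \<open>P y\<close> over \<open>z \<in> H\<close> weighted by the doubly stochastic matrix of overlaps of
  the two eigenbases, so noncommuting states are handled like classical distributions. On \<open>G\<close> and \<open>H\<close>
  the weight \<open>P y\<close> is at most \<open>a b sqrt (P y) sqrt (Q z)\<close>.\<close>

lemma tr_test_le:
  assumes U: "unitary_mat m U" and V: "unitary_mat m V"
    and P: "\<And>y. y < m \<Longrightarrow> P y \<ge> 0"
    and a: "\<And>y. y < m \<Longrightarrow> y \<in> G \<Longrightarrow> sqrt (P y) \<le> a"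
    and b: "\<And>z. z < m \<Longrightarrow> z \<in> H \<Longrightarrow> 1 \<le> b * sqrt (Q z)"
    and Q: "\<And>z. z < m \<Longrightarrow> Q z \<ge> 0"
    and tail: "(\<Sum>y\<in>{..<m} - G. P y) \<le> r" and ab: "a \<ge> 0" "b \<ge> 0"
  shows "Re (tr (spec_mat m U P * spec_mat m V (indicator H)))
     \<le> r + a * b * Re (tr (spec_mat m U (\<lambda>y. sqrt (P y)) * spec_mat m V (\<lambda>z. sqrt (Q z))))"
proof -
  let ?O = "overlap U V"
  have "Re (tr (spec_mat m U P * spec_mat m V (indicator H))) = (\<Sum>y<m. \<Sum>z<m. P y * indicator H z * ?O y z)"
    unfolding tr_spec_mat_mult[OF unitary_carrier[OF U] unitary_carrier[OF V]] by simp
  also have "\<dots> \<le> (\<Sum>y<m. \<Sum>z<m. (if y \<in> G then 0 else P y * ?O y z) + a * b * (sqrt (P y) * sqrt (Q z) * ?O y z))"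
  proof (intro sum_mono)
    fix y z assume "y \<in> {..<m}" "z \<in> {..<m}"
    hence yz: "y < m" "z < m" by auto
    have nn: "0 \<le> a * b * (sqrt (P y) * sqrt (Q z) * ?O y z)" using ab P yz Q by simp
    show "P y * indicator H z * ?O y z \<le> (if y \<in> G then 0 else P y * ?O y z) + a * b * (sqrt (P y) * sqrt (Q z) * ?O y z)"
    proof (cases "y \<in> G \<and> z \<in> H")
      case True
      have "sqrt (P y) * sqrt (P y) \<le> a * sqrt (P y)"
        by (rule mult_right_mono) (use True a P yz in auto)
      hence "(sqrt (P y) * sqrt (P y)) * 1 \<le> (a * sqrt (P y)) * (b * sqrt (Q z))"
        by (rule mult_mono) (use True b ab P yz in auto)
      hence "P y \<le> (a * sqrt (P y)) * (b * sqrt (Q z))" using P yz by simp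
      hence "P y * ?O y z \<le> (a * sqrt (P y)) * (b * sqrt (Q z)) * ?O y z"
        by (rule mult_right_mono) simp
      thus ?thesis using True by (simp add: mult_ac)
    next
      case False
      thus ?thesis using nn P yz by (auto simp: indicator_def add_increasing2)
    qed
  qed
  also have "\<dots> = (\<Sum>y<m. (if y \<in> G then 0 else P y) + a * b * (\<Sum>z<m. sqrt (P y) * sqrt (Q z) * ?O y z))"
  proof (rule sum.cong[OF refl])
    fix y assume "y \<in> {..<m}"
    hence "(\<Sum>z<m. P y * ?O y z) = P y" using overlap_sum[OF U V] by (simp add: sum_distrib_left[symmetric])
    thus "(\<Sum>z<m. (if y \<in> G then 0 else P y * ?O y z) + a * b * (sqrt (P y) * sqrt (Q z) * ?O y z))
       = (if y \<in> G then 0 else P y) + a * b * (\<Sum>z<m. sqrt (P y) * sqrt (Q z) * ?O y z)"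
      by (simp add: sum.distrib sum_distrib_left)
  qed
  also have "\<dots> = (\<Sum>y\<in>{..<m} - G. P y) + a * b * (\<Sum>y<m. \<Sum>z<m. sqrt (P y) * sqrt (Q z) * ?O y z)"
    by (simp add: sum.distrib sum_distrib_left sum.If_cases Diff_eq Collect_mem_eq Collect_neg_eq)
  also have "(\<Sum>y<m. \<Sum>z<m. sqrt (P y) * sqrt (Q z) * ?O y z) = Re (tr (spec_mat m U (\<lambda>y. sqrt (P y)) * spec_mat m V (\<lambda>z. sqrt (Q z))))"
    unfolding tr_spec_mat_mult[OF unitary_carrier[OF U] unitary_carrier[OF V]] by simp
  finally show ?thesis using tail by simp
qed

section \<open>Entropy concentration for product weights\<close>

text \<open>These bounds are independent of the distribution, so concentration needs no lower bound
  on eigenvalues. The third reduces to the second by x = s^2, since x (ln x)^2 = 4 (s ln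
  s)^2.\<close>

lemma mult_ln_bounds:
  fixes x :: real
  assumes "0 \<le> x" "x \<le> 1"
  shows "0 \<le> - (x * ln x)" "- (x * ln x) \<le> 1" "x * (ln x)\<^sup>2 \<le> 4"
proof -
  have *: "0 \<le> - (s * ln s) \<and> - (s * ln s) \<le> 1" if "0 \<le> s" "s \<le> 1" for s :: real
  proof (cases "s = 0")
    case False
    hence s: "s > 0" using that by simp
    have "ln s \<le> 0" using s that by simp
    moreover have "- ln s \<le> 1 / s" using ln_le_minus_one[of "1 / s"] s by (simp add: ln_div)
    hence "s * (- ln s) \<le> s * (1 / s)" using s by (intro mult_left_mono) auto
    ultimately show ?thesis using s by (auto simp: mult_nonneg_nonpos)
  qed simp
  show "0 \<le> - (x * ln x)" "- (x * ln x) \<le> 1" using *[OF assms] by auto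
  define s where "s = sqrt x"
  have s: "0 \<le> s" "s \<le> 1" "x = s\<^sup>2" using assms by (auto simp: s_def)
  have "ln x = 2 * ln s \<or> x = 0" using s(1) by (cases "s = 0") (auto simp: s(3) ln_realpow)
  hence "x * (ln x)\<^sup>2 = 4 * (- (s * ln s))\<^sup>2" by (auto simp: s(3) power_mult_distrib)
  also have "\<dots> \<le> 4 * 1\<^sup>2" using *[OF s(1,2)] by (intro mult_left_mono power_mono) auto
  finally show "x * (ln x)\<^sup>2 \<le> 4" by simp
qed

definition prob_weight :: "nat \<Rightarrow> (nat \<Rightarrow> real) \<Rightarrow> bool" where
  "prob_weight d p \<longleftrightarrow> (\<forall>a<d. p a \<ge> 0) \<and> (\<Sum>a<d. p a) = 1"

text \<open>Zero weights contribute nothing, since \<open>ln 0 = 0\<close>.\<close>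

definition entropy_ln :: "nat \<Rightarrow> (nat \<Rightarrow> real) \<Rightarrow> real" where
  "entropy_ln d p = (\<Sum>a<d. - (p a * ln (p a)))"

lemma prob_weight_le_1:
  assumes "prob_weight d p" "a < d"
  shows "p a \<le> 1"
proof -
  have "p a \<le> (\<Sum>a<d. p a)" by (rule member_le_sum) (use assms in \<open>auto simp: prob_weight_def\<close>)
  thus ?thesis using assms by (simp add: prob_weight_def)
qed

lemma entropy_ln_bounds:
  assumes "prob_weight d p"
  shows "0 \<le> entropy_ln d p" "entropy_ln d p \<le> d"
proof -
  have b: "0 \<le> - (p a * ln (p a))" "- (p a * ln (p a)) \<le> 1" if "a < d" for a
    using mult_ln_bounds[of "p a"] prob_weight_le_1[OF assms that] assms that by (auto simp: prob_weight_def)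
  show "0 \<le> entropy_ln d p" unfolding entropy_ln_def by (rule sum_nonneg) (use b in auto)
  have "entropy_ln d p \<le> (\<Sum>a<d. 1)" unfolding entropy_ln_def by (rule sum_mono) (use b in auto)
  thus "entropy_ln d p \<le> d" by simp
qed

text \<open>The information content \<open>- ln p\<close> has mean \<open>entropy_ln d p\<close>.
  Its variance is at most its second moment, and each of the \<open>d\<close> outcomes adds at most
  4 to that.\<close>

lemma information_moments:
  assumes "prob_weight d p"
  shows "(\<Sum>a<d. p a * (- ln (p a) - entropy_ln d p)) = 0"
    "(\<Sum>a<d. p a * (- ln (p a) - entropy_ln d p)\<^sup>2) \<le> 4 * d"
proof -
  let ?h = "entropy_ln d p"
  have "(\<Sum>a<d. p a * (- ln (p a) - ?h)) = (\<Sum>a<d. - (p a * ln (p a))) - ?h * (\<Sum>a<d. p a)"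
    by (simp add: sum_subtractf sum_distrib_left algebra_simps flip: sum_negf)
  thus "(\<Sum>a<d. p a * (- ln (p a) - ?h)) = 0"
    using assms by (simp add: prob_weight_def entropy_ln_def)
  have "(\<Sum>a<d. p a * (- ln (p a) - ?h)\<^sup>2)
     = (\<Sum>a<d. p a * (ln (p a))\<^sup>2 - 2 * ?h * (- (p a * ln (p a))) + ?h\<^sup>2 * p a)"
    by (rule sum.cong[OF refl]) (simp add: power2_eq_square algebra_simps)
  also have "\<dots> = (\<Sum>a<d. p a * (ln (p a))\<^sup>2) - 2 * ?h * (\<Sum>a<d. - (p a * ln (p a))) + ?h\<^sup>2 * (\<Sum>a<d. p a)"
    by (simp only: sum.distrib sum_subtractf sum_distrib_left)
  also have "\<dots> = (\<Sum>a<d. p a * (ln (p a))\<^sup>2) - ?h\<^sup>2"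
    using assms by (simp add: prob_weight_def entropy_ln_def[symmetric] power2_eq_square)
  also have "\<dots> \<le> (\<Sum>a<d. p a * (ln (p a))\<^sup>2)" by simp
  also have "\<dots> \<le> (\<Sum>a<d. 4)"
    by (rule sum_mono) (use mult_ln_bounds(3) prob_weight_le_1[OF assms] assms in \<open>auto simp: prob_weight_def\<close>)
  finally show "(\<Sum>a<d. p a * (- ln (p a) - ?h)\<^sup>2) \<le> 4 * d" by simp
qed

lemma prod_weight_sqrt: "prod_weight d (map (\<lambda>p a. sqrt (p a)) ps) i = sqrt (prod_weight d ps i)"
  by (induction ps arbitrary: i) (auto simp: real_sqrt_mult)

lemma prod_weight_nonneg:
  assumes "\<And>p. p \<in> set ps \<Longrightarrow> prob_weight d p" "i < d ^ length ps"
  shows "prod_weight d ps i \<ge> 0"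
  using assms
proof (induction ps arbitrary: i)
  case (Cons p ps)
  note dm = div_mod_less[of i d "d ^ length ps"]
  show ?case using Cons dm by (auto simp: prob_weight_def intro!: mult_nonneg_nonneg)
qed simp

lemma sum_prod_weight_Cons:
  "(\<Sum>i<d ^ length (p # ps). F (prod_weight d (p # ps) i))
     = (\<Sum>a<d. \<Sum>b<d ^ length ps. F (p a * prod_weight d ps b))"
  using sum_div_mod[of "\<lambda>a b. F (p a * prod_weight d ps b)" "d ^ length ps" d] by simp

text \<open>Information contents of independent letters add up: means add, the cross term vanishes
  because deviations are centered, and variances add. The three claims share one induction since the
  variance step uses the other two.\<close>

lemma prod_weight_moments:
  assumes "\<And>p. p \<in> set ps \<Longrightarrow> prob_weight d p"
  defines "H \<equiv> (\<Sum>p\<leftarrow>ps. entropy_ln d p)" and "P \<equiv> prod_weight d ps"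
  shows "(\<Sum>i<d ^ length ps. P i) = 1 \<and> (\<Sum>i<d ^ length ps. P i * (- ln (P i) - H)) = 0
     \<and> (\<Sum>i<d ^ length ps. P i * (- ln (P i) - H)\<^sup>2) \<le> length ps * (4 * d)"
  using assms(1) unfolding H_def P_def
proof (induction ps)
  case (Cons p ps)
  define m where "m = d ^ length ps"
  define Q where "Q = prod_weight d ps"
  define H where "H = (\<Sum>p\<leftarrow>ps. entropy_ln d p)"
  define h where "h = entropy_ln d p"
  define X where "X a = - ln (p a) - h" for a
  define Y where "Y b = - ln (Q b) - H" for b
  have IH: "(\<Sum>b<m. Q b) = 1" "(\<Sum>b<m. Q b * Y b) = 0" "(\<Sum>b<m. Q b * (Y b)\<^sup>2) \<le> length ps * (4 * d)"
    using Cons by (auto simp: m_def Q_def H_def Y_def)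
  have p: "prob_weight d p" using Cons.prems by simp
  have pX: "(\<Sum>a<d. p a) = 1" "(\<Sum>a<d. p a * X a) = 0" "(\<Sum>a<d. p a * (X a)\<^sup>2) \<le> 4 * d"
    using p information_moments[OF p] by (auto simp: prob_weight_def X_def h_def)
  have Qn: "Q b \<ge> 0" if "b < m" for b 
    using prod_weight_nonneg[of ps d b] Cons.prems that by (auto simp: Q_def m_def)
  have pn: "p a \<ge> 0" if "a < d" for a using p that by (simp add: prob_weight_def)
  \<comment> \<open>Multiplying by the weight covers indices of weight zero, where the logarithm of
    the product does not split.\<close>
  have ln: "p a * Q b * f (- ln (p a * Q b) - (h + H)) = p a * Q b * f (X a + Y b)" if "a < d" "b < m" for a b and f :: "real \<Rightarrow> real"
  proof (cases "p a * Q b = 0")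
    case False
    hence "p a > 0" "Q b > 0" using pn Qn that by (auto simp: less_le)
    hence "- ln (p a * Q b) - (h + H) = X a + Y b" by (simp add: ln_mult X_def Y_def)
    thus ?thesis by simp
  qed auto
  \<comment> \<open>One reindexing for arbitrary \<open>f\<close>; the constant 1, the identity and
    the square yield the three moments.\<close>
  have S: "(\<Sum>i<d ^ length (p # ps). prod_weight d (p # ps) i * f (- ln (prod_weight d (p # ps) i) - (\<Sum>p\<leftarrow>p # ps. entropy_ln d p)))
      = (\<Sum>a<d. \<Sum>b<m. p a * Q b * f (X a + Y b))" for f :: "real \<Rightarrow> real"
  proof -
    have "(\<Sum>i<d ^ length (p # ps). prod_weight d (p # ps) i * f (- ln (prod_weight d (p # ps) i) - (\<Sum>p\<leftarrow>p # ps. entropy_ln d p)))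
      = (\<Sum>a<d. \<Sum>b<m. p a * Q b * f (- ln (p a * Q b) - (h + H)))"
      using sum_prod_weight_Cons[of "\<lambda>x. x * f (- ln x - (h + H))" d p ps]
      by (simp add: m_def Q_def H_def h_def)
    also have "\<dots> = (\<Sum>a<d. \<Sum>b<m. p a * Q b * f (X a + Y b))"
      by (intro sum.cong refl ln) auto
    finally show ?thesis .
  qed
  have "(\<Sum>a<d. \<Sum>b<m. p a * Q b * 1) = (\<Sum>a<d. p a) * (\<Sum>b<m. Q b)"
    by (simp only: sum_product mult_1_right)
  hence 1: "(\<Sum>a<d. \<Sum>b<m. p a * Q b * 1) = 1" using IH(1) pX(1) by simp
  have "(\<Sum>a<d. \<Sum>b<m. p a * Q b * (X a + Y b)) = (\<Sum>a<d. \<Sum>b<m. (p a * X a) * Q b + p a * (Q b * Y b))"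
    by (intro sum.cong refl) (simp add: algebra_simps)
  also have "\<dots> = (\<Sum>a<d. p a * X a) * (\<Sum>b<m. Q b) + (\<Sum>a<d. p a) * (\<Sum>b<m. Q b * Y b)"
    by (simp only: sum_product sum.distrib)
  finally have 2: "(\<Sum>a<d. \<Sum>b<m. p a * Q b * (X a + Y b)) = 0" using IH pX by simp
  have "(\<Sum>a<d. \<Sum>b<m. p a * Q b * (X a + Y b)\<^sup>2)
      = (\<Sum>a<d. \<Sum>b<m. (p a * (X a)\<^sup>2) * Q b + 2 * ((p a * X a) * (Q b * Y b)) + p a * (Q b * (Y b)\<^sup>2))"
    by (intro sum.cong refl) (simp add: algebra_simps power2_eq_square)
  also have "\<dots> = (\<Sum>a<d. p a * (X a)\<^sup>2) * (\<Sum>b<m. Q b) + 2 * ((\<Sum>a<d. p a * X a) * (\<Sum>b<m. Q b * Y b)) + (\<Sum>a<d. p a) * (\<Sum>b<m. Q b * (Y b)\<^sup>2)"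
    unfolding sum_product sum.distrib by (simp only: sum_distrib_left)
  finally have 3: "(\<Sum>a<d. \<Sum>b<m. p a * Q b * (X a + Y b)\<^sup>2) \<le> length (p # ps) * (4 * d)"
    using IH pX by (simp add: algebra_simps)
  have "(\<Sum>i<d ^ length (p # ps). prod_weight d (p # ps) i) = 1"
    using trans[OF S[of "\<lambda>_. 1"] 1] by (simp only: mult_1_right)
  moreover have "(\<Sum>i<d ^ length (p # ps). prod_weight d (p # ps) i * (- ln (prod_weight d (p # ps) i) - (\<Sum>p\<leftarrow>p # ps. entropy_ln d p))) = 0"
    using trans[OF S[of "\<lambda>x. x"] 2] .
  moreover have "(\<Sum>i<d ^ length (p # ps). prod_weight d (p # ps) i * (- ln (prod_weight d (p # ps) i) - (\<Sum>p\<leftarrow>p # ps. entropy_ln d p))\<^sup>2) \<le> length (p # ps) * (4 * d)"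
    unfolding S[of "\<lambda>x. x\<^sup>2"] by (rule 3)
  ultimately show ?case by blast
qed simp

text \<open>Chebyshev's inequality. Positivity is demanded explicitly because
  \<open>ln 0 = 0\<close> could let an index of weight zero pass the entropy condition, while
  typical weights must later be bounded below.\<close>

lemma prod_weight_tail:
  assumes ps: "\<And>p. p \<in> set ps \<Longrightarrow> prob_weight d p" and w: "w > 0"
  defines "H \<equiv> (\<Sum>p\<leftarrow>ps. entropy_ln d p)" and "P \<equiv> prod_weight d ps"
  shows "(\<Sum>i\<in>{..<d ^ length ps} - {i. P i > 0 \<and> \<bar>- ln (P i) - H\<bar> \<le> w}. P i) \<le> length ps * (4 * d) / w\<^sup>2"
proof -
  let ?m = "d ^ length ps" and ?D = "\<lambda>i. (- ln (P i) - H)\<^sup>2"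
  have Pn: "P i \<ge> 0" if "i < ?m" for i using prod_weight_nonneg[OF ps that] by (simp add: P_def)
  have "(\<Sum>i\<in>{..<?m} - {i. P i > 0 \<and> \<bar>- ln (P i) - H\<bar> \<le> w}. P i)
     \<le> (\<Sum>i\<in>{..<?m} - {i. P i > 0 \<and> \<bar>- ln (P i) - H\<bar> \<le> w}. P i * ?D i / w\<^sup>2)"
  proof (rule sum_mono)
    fix i assume i: "i \<in> {..<?m} - {i. P i > 0 \<and> \<bar>- ln (P i) - H\<bar> \<le> w}"
    show "P i \<le> P i * ?D i / w\<^sup>2"
    proof (cases "P i > 0")
      case True
      hence "w \<le> \<bar>- ln (P i) - H\<bar>" using i by auto
      hence "w\<^sup>2 \<le> ?D i" using w by (metis abs_le_square_iff abs_of_pos)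
      hence "P i * w\<^sup>2 \<le> P i * ?D i" using True by simp
      thus ?thesis using w by (simp add: pos_le_divide_eq)
    next
      case False
      hence "P i = 0" using Pn[of i] i by auto
      thus ?thesis by simp
    qed
  qed
  also have "\<dots> \<le> (\<Sum>i<?m. P i * ?D i / w\<^sup>2)"
    by (rule sum_mono2) (use Pn in auto)
  also have "\<dots> = (\<Sum>i<?m. P i * ?D i) / w\<^sup>2" by (simp add: sum_divide_distrib)
  also have "\<dots> \<le> length ps * (4 * d) / w\<^sup>2"
    using prod_weight_moments[of ps d] ps by (intro divide_right_mono) (auto simp: P_def H_def)
  finally show ?thesis .
qed

section \<open>Codes from separated words\<close>

lemma density_spec_mat:
  assumes "unitary_mat d U" "prob_weight d p"
  shows "density d (spec_mat d U p)"
  using assms psd_spec_mat[OF unitary_carrier[OF assms(1)], of p] tr_spec_mat[OF assms(1), of p]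
  by (simp add: density_def prob_weight_def del: of_real_sum)

text \<open>The Chebyshev tail \<open>4 * real d / c\<^sup>2\<close> is the whole first error and
  one part of the second. In the exponent of the other part, \<open>c * sqrt n\<close> is the width
  of the two typical sets, \<open>sqrt n / 2\<close> the residual entropy mismatch, and
  \<open>D / 2\<close> the decay of the affinity.\<close>

lemma di_code_from_words:
  fixes W :: "'x \<Rightarrow> complex mat" and p :: "'x \<Rightarrow> nat \<Rightarrow> real"
  assumes spec: "\<And>x. x \<in> X \<Longrightarrow> unitary_mat d (U x) \<and> prob_weight d (p x) \<and> W x = spec_mat d (U x) (p x)"
    and C: "finite C" "\<And>w i. w \<in> C \<Longrightarrow> i < n \<Longrightarrow> w i \<in> X"
    and c: "n > 0" "c > 0"
  defines "H \<equiv> \<lambda>w. \<Sum>i<n. entropy_ln d (p (w i))"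
  assumes close: "\<And>w w'. w \<in> C \<Longrightarrow> w' \<in> C \<Longrightarrow> H w - H w' \<le> sqrt n"
    and dist: "\<And>w w'. w \<in> C \<Longrightarrow> w' \<in> C \<Longrightarrow> w \<noteq> w' \<Longrightarrow> D \<le> word_dist2 W d n w w'"
    and l1: "4 * real d / c\<^sup>2 \<le> l1" and l2: "4 * real d / c\<^sup>2 + exp (sqrt n / 2 + c * sqrt n - D / 2) \<le> l2"
  shows "\<exists>u E. di_code W X d n (card C) l1 l2 u E"
proof -
  define m where "m = d ^ n"
  define ps where "ps w = map (\<lambda>i. p (w i)) [0..<n]" for w
  define P where "P w = prod_weight d (ps w)" for w
  define V where "V w = kron_list (map (\<lambda>i. U (w i)) [0..<n])" for w
  define G where "G w = {i. P w i > 0 \<and> \<bar>- ln (P w i) - H w\<bar> \<le> c * sqrt n}" for w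
  have dens: "\<forall>i<n. density d (W (w i))" if "w \<in> C" for w
    using spec C(2)[OF that] density_spec_mat by auto
  have V: "unitary_mat m (V w)" if "w \<in> C" for w
    using unitary_kron_list[of "[0..<n]" d "\<lambda>i. U (w i)"] spec C(2)[OF that] by (simp add: V_def m_def)
  have Uc: "U (w i) \<in> carrier_mat d d" if "w \<in> C" "i \<in> set [0..<n]" for w i
    using spec C(2)[OF that(1), of i] that(2) unitary_carrier by auto
  have ps: "prob_weight d q" if "w \<in> C" "q \<in> set (ps w)" for w q
    using that spec C(2) by (auto simp: ps_def)
  have len: "length (ps w) = n" for w by (simp add: ps_def)
  have Pn: "P w i \<ge> 0" if "w \<in> C" "i < m" for w i
    unfolding P_def by (rule prod_weight_nonneg) (use that ps len in \<open>auto simp: m_def\<close>)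
  have Hs: "(\<Sum>q\<leftarrow>ps w. entropy_ln d q) = H w" for w
    by (simp add: ps_def H_def o_def interv_sum_list_conv_sum_set_nat lessThan_atLeast0)
  have tw: "tensor_word W n w = spec_mat m (V w) (P w)" if "w \<in> C" for w
  proof -
    have e: "map (\<lambda>i. W (w i)) [0..<n] = map (\<lambda>i. spec_mat d (U (w i)) (p (w i))) [0..<n]"
      using spec C(2)[OF that] by simp
    show ?thesis unfolding tensor_word_def e
      using kron_list_spec_mat[where xs = "[0..<n]" and d = d and U = "\<lambda>i. U (w i)" and p = "\<lambda>i. p (w i)"] Uc[OF that]
      by (simp add: V_def P_def ps_def m_def)
  qed
  have ws: "word_sqrt W d n w = spec_mat m (V w) (\<lambda>i. sqrt (P w i))" if "w \<in> C" for w
  proof -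
    have s: "mat_sqrt d (W (w i)) = spec_mat d (U (w i)) (\<lambda>a. sqrt (p (w i) a))" if "i < n" for i
      using spec[OF C(2)[OF \<open>w \<in> C\<close> that]] mat_sqrt_spec_mat[of d "U (w i)" "p (w i)"] by (auto simp: prob_weight_def)
    hence e: "map (\<lambda>i. mat_sqrt d (W (w i))) [0..<n] = map (\<lambda>i. spec_mat d (U (w i)) (\<lambda>a. sqrt (p (w i) a))) [0..<n]"
      by simp
    have "prod_weight d (map (\<lambda>i a. sqrt (p (w i) a)) [0..<n]) = (\<lambda>i. sqrt (P w i))"
      using prod_weight_sqrt[of d "ps w"] by (simp add: P_def ps_def o_def fun_eq_iff)
    thus ?thesis unfolding word_sqrt_def e using kron_list_spec_mat[where xs = "[0..<n]" and d = d and U = "\<lambda>i. U (w i)" and p = "\<lambda>i a. sqrt (p (w i) a)"] Uc[OF that]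
      by (simp add: V_def m_def)
  qed
  have w0: "c * sqrt n > 0" using c by simp
  have tail: "(\<Sum>i\<in>{..<m} - G w. P w i) \<le> 4 * real d / c\<^sup>2" if "w \<in> C" for w
    using prod_weight_tail[of "ps w" d "c * sqrt n", OF ps[OF that] w0] c
    by (simp add: len Hs m_def G_def P_def power_mult_distrib)
  have sumP: "(\<Sum>i<m. P w i) = 1" if "w \<in> C" for w
    using prod_weight_moments[of "ps w" d] ps[OF that] by (simp add: len m_def P_def)
  define T where "T w = spec_mat m (V w) (indicator (G w))" for w
  have eff: "effect m (T w)" if "w \<in> C" for w
    unfolding T_def by (rule effect_spec_mat[OF V[OF that]]) (auto simp: indicator_def)
  have acc: "Re (tr (tensor_word W n w * T w)) \<ge> 1 - l1" if "w \<in> C" for w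
  proof -
    have "Re (tr (tensor_word W n w * T w)) = (\<Sum>i<m. P w i * indicator (G w) i)"
      unfolding tw[OF that] T_def spec_mat_mult[OF V[OF that]] tr_spec_mat[OF V[OF that]] by simp
    also have "\<dots> = (\<Sum>i\<in>{..<m} \<inter> G w. P w i)"
      by (simp add: sum.inter_restrict indicator_def if_distrib cong: if_cong)
    also have "\<dots> = (\<Sum>i<m. P w i) - (\<Sum>i\<in>{..<m} - G w. P w i)"
      using sum.Int_Diff[of "{..<m}" "P w" "G w"] by simp
    finally show ?thesis using sumP[OF that] tail[OF that] l1 by simp
  qed
  have rej: "Re (tr (tensor_word W n w * T w')) \<le> l2" if w: "w \<in> C" "w' \<in> C" "w \<noteq> w'" for w w'
  proof -
    \<comment> \<open>\<open>?a\<close> bounds typical root eigenvalues of \<open>w\<close> from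
      above, \<open>1 / ?b\<close> those of \<open>w'\<close> from below. In the product the
      entropies enter only through their difference.\<close>
    let ?a = "exp ((c * sqrt n - H w) / 2)" and ?b = "exp ((c * sqrt n + H w') / 2)"
    let ?t = "Re (tr (spec_mat m (V w) (\<lambda>i. sqrt (P w i)) * spec_mat m (V w') (\<lambda>i. sqrt (P w' i))))"
    have test: "Re (tr (spec_mat m (V w) (P w) * spec_mat m (V w') (indicator (G w')))) \<le> 4 * real d / c\<^sup>2 + ?a * ?b * ?t"
    proof (rule tr_test_le[OF V[OF w(1)] V[OF w(2)], where G = "G w"])
      fix y assume y: "y < m" "y \<in> G w"
      hence "ln (P w y) \<le> c * sqrt n - H w" "P w y > 0" by (auto simp: G_def)
      hence "ln (sqrt (P w y)) \<le> (c * sqrt n - H w) / 2" by (simp add: ln_sqrt)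
      hence "exp (ln (sqrt (P w y))) \<le> ?a" by (simp only: exp_le_cancel_iff)
      thus "sqrt (P w y) \<le> ?a" using \<open>P w y > 0\<close> by simp
    next
      fix z assume z: "z < m" "z \<in> G w'"
      hence "- ln (P w' z) \<le> c * sqrt n + H w'" "P w' z > 0" by (auto simp: G_def)
      moreover have "0 \<le> k / 2 + l / 2" if "- l \<le> k" for k l :: real using that by simp
      ultimately have "0 \<le> (c * sqrt n + H w') / 2 + ln (sqrt (P w' z))" unfolding ln_sqrt[OF less_imp_le[OF \<open>P w' z > 0\<close>]] by blast
      hence "1 \<le> exp ((c * sqrt n + H w') / 2 + ln (sqrt (P w' z)))" by simp
      thus "1 \<le> ?b * sqrt (P w' z)" using \<open>P w' z > 0\<close> by (simp add: exp_add)
    qed (use tail Pn w in auto)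
    have "?t \<le> exp (- (D / 2))"
    proof -
      let ?x = "\<lambda>i. (hs_dist (mat_sqrt d (W (w i))) (mat_sqrt d (W (w' i))))\<^sup>2 / 2"
      have "?t = (\<Prod>i<n. 1 - ?x i)"
        unfolding ws[OF w(1), symmetric] ws[OF w(2), symmetric] tr_word_sqrt_mult[of n d W w w', OF dens[OF w(1)] dens[OF w(2)]]
        by (rule Re_complex_of_real)
      also have "\<dots> \<le> exp (- (\<Sum>i<n. ?x i))"
        by (rule prod_one_minus_le_exp) (use tr_mat_sqrt_mult(2) dens[OF w(1)] dens[OF w(2)] in auto)
      also have "(\<Sum>i<n. ?x i) = word_dist2 W d n w w' / 2"
        by (simp add: word_dist2_def sum_divide_distrib)
      also have "exp (- (word_dist2 W d n w w' / 2)) \<le> exp (- (D / 2))" using dist[OF w] by simp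
      finally show ?thesis .
    qed
    hence "?a * ?b * ?t \<le> ?a * ?b * exp (- (D / 2))" by (intro mult_left_mono) auto
    also have "\<dots> = exp ((H w' - H w) / 2 + c * sqrt n - D / 2)"
      by (simp add: exp_add[symmetric] field_simps)
    \<comment> \<open>The words enter \<open>close\<close> in reversed order, because the test
      belongs to \<open>w'\<close> and the state to \<open>w\<close>.\<close>
    also have "\<dots> \<le> exp (sqrt n / 2 + c * sqrt n - D / 2)" using close[OF w(2,1)] by simp
    finally show ?thesis using l2 test unfolding tw[OF w(1)] T_def by linarith
  qed
  obtain f where f: "bij_betw f {0..<card C} C" using ex_bij_betw_nat_finite[OF C(1)] by blast
  have fC: "f j \<in> C" if "j < card C" for j using bij_betwE[OF f] that by auto
  have fi: "f j \<noteq> f k" if "j < card C" "k < card C" "j \<noteq> k" for j k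
    using bij_betw_imp_inj_on[OF f] that by (auto simp: inj_on_def)
  have "di_code W X d n (card C) l1 l2 f (\<lambda>j. T (f j))"
    unfolding di_code_def using C(2) fC fi eff acc rej by (auto simp: m_def)
  thus ?thesis by blast
qed

section \<open>Words, Hamming distance and Gilbert-Varshamov counting\<close>

abbreviation words :: "nat \<Rightarrow> 'x set \<Rightarrow> (nat \<Rightarrow> 'x) set" where
  "words n A \<equiv> {..<n} \<rightarrow>\<^sub>E A"

definition hamming :: "nat \<Rightarrow> (nat \<Rightarrow> 'x) \<Rightarrow> (nat \<Rightarrow> 'x) \<Rightarrow> nat" where
  "hamming n v w = card {i. i < n \<and> v i \<noteq> w i}"

lemma hamming_commute: "hamming n v w = hamming n w v"
  unfolding hamming_def by (rule arg_cong[of _ _ card]) auto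

lemma card_words: "finite A \<Longrightarrow> card (words n A) = card A ^ n"
  by (simp add: card_PiE)

text \<open>The ball is covered by choosing the set of positions that differ from \<open>v\<close>,
  at most 2^n choices, and then fewer than \<open>t\<close> free letters. The crude 2^n costs only n
  bits.\<close>

lemma card_hamming_ball:
  assumes A: "finite A" "A \<noteq> {}" and v: "v \<in> words n A"
  shows "card {w \<in> words n A. hamming n w v < t} \<le> 2 ^ n * card A ^ t"
proof -
  define I where "I = {T. T \<subseteq> {..<n} \<and> card T < t}"
  define R where "R T = (\<Pi>\<^sub>E i\<in>{..<n}. if i \<in> T then A else {v i})" for T
  have fI: "finite I" unfolding I_def by (rule finite_subset[of _ "Pow {..<n}"]) auto
  have fR: "finite (R T)" for T unfolding R_def using A by (intro finite_PiE) auto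
  have A1: "card A \<ge> 1" using A by (simp add: Suc_leI card_gt_0_iff)
  have "{w \<in> words n A. hamming n w v < t} \<subseteq> (\<Union>T\<in>I. R T)"
  proof
    fix w assume w: "w \<in> {w \<in> words n A. hamming n w v < t}"
    let ?T = "{i. i < n \<and> w i \<noteq> v i}"
    have "?T \<in> I" using w by (auto simp: I_def hamming_def)
    moreover have "w \<in> R ?T" using w by (auto simp: R_def PiE_iff)
    ultimately show "w \<in> (\<Union>T\<in>I. R T)" by blast
  qed
  hence "card {w \<in> words n A. hamming n w v < t} \<le> card (\<Union>T\<in>I. R T)"
    by (rule card_mono[rotated]) (use fI fR in auto)
  also have "\<dots> \<le> (\<Sum>T\<in>I. card (R T))" by (rule card_UN_le[OF fI])
  also have "\<dots> \<le> (\<Sum>T\<in>I. card A ^ t)"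
  proof (rule sum_mono)
    fix T assume T: "T \<in> I"
    have "card (R T) = (\<Prod>i<n. if i \<in> T then card A else 1)"
      unfolding R_def by (subst card_PiE) (auto intro!: prod.cong)
    also have "\<dots> = card A ^ card T"
      using T by (simp add: prod.If_cases I_def Int_absorb1)
    also have "\<dots> \<le> card A ^ t" using T A1 by (intro power_increasing) (auto simp: I_def)
    finally show "card (R T) \<le> card A ^ t" .
  qed
  also have "\<dots> = card I * card A ^ t" by simp
  also have "card I \<le> card (Pow {..<n})" unfolding I_def by (rule card_mono) auto
  hence "card I * card A ^ t \<le> 2 ^ n * card A ^ t" by (simp add: card_Pow)
  finally show ?thesis .
qed

text \<open>The Gilbert-Varshamov argument for an abstract relation "too close": choose a point,
  delete its at most \<open>v\<close> neighbours, recurse. Every chosen point pays for at most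
  \<open>v\<close> deletions.\<close>

lemma greedy_packing:
  assumes "finite B" and sym: "\<And>x y. r x y \<Longrightarrow> r y x"
    and ball: "\<And>c. c \<in> B \<Longrightarrow> r c c \<and> card {x \<in> B. r x c} \<le> v"
  shows "\<exists>C\<subseteq>B. (\<forall>x\<in>C. \<forall>y\<in>C. x \<noteq> y \<longrightarrow> \<not> r x y) \<and> card B \<le> card C * v"
  using assms(1,3)
proof (induction B rule: finite_psubset_induct)
  case (psubset B)
  show ?case
  proof (cases "B = {}")
    case False
    then obtain c where c: "c \<in> B" by blast
    define B' where "B' = B - {x \<in> B. r x c}"
    have B': "B' \<subset> B" using c psubset.prems[OF c] by (auto simp: B'_def)
    have "card {x \<in> B'. r x a} \<le> v" if "a \<in> B'" for a
    proof -
      have "card {x \<in> B'. r x a} \<le> card {x \<in> B. r x a}"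
        by (rule card_mono) (use psubset.hyps B' in auto)
      also have "\<dots> \<le> v" using psubset.prems[of a] that B' by auto
      finally show ?thesis .
    qed
    hence "\<exists>C\<subseteq>B'. (\<forall>x\<in>C. \<forall>y\<in>C. x \<noteq> y \<longrightarrow> \<not> r x y) \<and> card B' \<le> card C * v"
      using psubset.prems B' by (intro psubset.IH[OF B']) blast
    then obtain C where C: "C \<subseteq> B'" "\<forall>x\<in>C. \<forall>y\<in>C. x \<noteq> y \<longrightarrow> \<not> r x y" "card B' \<le> card C * v" by blast
    have fin: "finite C" "c \<notin> C" using C(1) B' psubset.hyps psubset.prems[OF c] 
      by (auto simp: B'_def intro: finite_subset)
    have "card {x \<in> B. r x c} \<le> card B" by (rule card_mono) (use psubset.hyps in auto)
    hence "card B = card B' + card {x \<in> B. r x c}"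
      unfolding B'_def using psubset.hyps by (subst card_Diff_subset) auto
    also have "\<dots> \<le> card (insert c C) * v" using C(3) psubset.prems[OF c] fin by simp
    finally have "card B \<le> card (insert c C) * v" .
    moreover have "\<forall>x\<in>insert c C. \<forall>y\<in>insert c C. x \<noteq> y \<longrightarrow> \<not> r x y"
      using C(1,2) sym by (auto simp: B'_def)
    moreover have "insert c C \<subseteq> B" using C(1) c by (auto simp: B'_def)
    ultimately show ?thesis by blast
  qed auto
qed

lemma large_fiber:
  assumes "finite B" "\<And>x. x \<in> B \<Longrightarrow> g x < k" "B \<noteq> {}"
  shows "\<exists>j<k. card B \<le> k * card {x \<in> B. g x = j}"
proof (rule ccontr)
  assume "\<not> ?thesis"
  hence less: "k * card {x \<in> B. g x = j} < card B" if "j < k" for j using that by auto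
  have k: "k > 0" using assms(2,3) by fastforce
  have "B = (\<Union>j\<in>{..<k}. {x \<in> B. g x = j})" using assms(2) by auto
  hence "card B \<le> (\<Sum>j<k. card {x \<in> B. g x = j})" using card_UN_le[of "{..<k}" "\<lambda>j. {x \<in> B. g x = j}"] by simp
  hence "k * card B \<le> (\<Sum>j<k. k * card {x \<in> B. g x = j})" by (simp add: sum_distrib_left[symmetric])
  also have "\<dots> < (\<Sum>j<k. card B)" by (rule sum_strict_mono) (use less k in auto)
  finally show False by simp
qed

text \<open>Values of \<open>H\<close> are sorted into bins of width \<open>s\<close> and a largest
  bin is kept, after which the greedy choice runs inside it. Balls within the bin are bounded by
  balls among all words.\<close>

lemma gilbert_varshamov_fiber:
  fixes H :: "(nat \<Rightarrow> 'x) \<Rightarrow> real"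
  assumes A: "finite A" "A \<noteq> {}" and s: "s > 0" and t: "t > 0"
    and H: "\<And>w. w \<in> words n A \<Longrightarrow> 0 \<le> H w \<and> H w \<le> K"
  shows "\<exists>C\<subseteq>words n A. (\<forall>v\<in>C. \<forall>w\<in>C. H v - H w \<le> s) \<and> (\<forall>v\<in>C. \<forall>w\<in>C. v \<noteq> w \<longrightarrow> t \<le> hamming n v w)
    \<and> real (card A ^ n) \<le> (K / s + 1) * (real (card C) * real (2 ^ n * card A ^ t))"
proof -
  let ?B = "words n A"
  define g where "g w = nat \<lfloor>H w / s\<rfloor>" for w
  \<comment> \<open>Floors run from 0 to the floor of K / s inclusive, hence the successor.\<close>
  define k where "k = Suc (nat \<lfloor>K / s\<rfloor>)"
  have fB: "finite ?B" using A by (intro finite_PiE) auto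
  have neB: "?B \<noteq> {}" using A by (simp add: PiE_eq_empty_iff)
  have "K \<ge> 0" using H neB by (meson ex_in_conv order_trans)
  have gk: "g w < k" if "w \<in> ?B" for w
    unfolding g_def k_def using H[OF that] s
    by (intro le_imp_less_Suc nat_mono floor_mono divide_right_mono) auto
  have "\<exists>j<k. card ?B \<le> k * card {w \<in> ?B. g w = j}"
    by (rule large_fiber[OF fB _ neB]) (rule gk)
  then obtain j where j: "card ?B \<le> k * card {w \<in> ?B. g w = j}" by (elim exE conjE)
  let ?F = "{w \<in> ?B. g w = j}"
  have "\<exists>C\<subseteq>?F. (\<forall>x\<in>C. \<forall>y\<in>C. x \<noteq> y \<longrightarrow> \<not> hamming n x y < t) \<and> card ?F \<le> card C * (2 ^ n * card A ^ t)"
  proof (rule greedy_packing[where r = "\<lambda>x y. hamming n x y < t"])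
    fix c assume c: "c \<in> ?F"
    have "card {x \<in> ?F. hamming n x c < t} \<le> card {w \<in> ?B. hamming n w c < t}"
      by (rule card_mono) (use fB in auto)
    also have "\<dots> \<le> 2 ^ n * card A ^ t" using A c by (intro card_hamming_ball) simp_all
    finally have 1: "card {x \<in> ?F. hamming n x c < t} \<le> 2 ^ n * card A ^ t" .
    have "hamming n c c < t" using t by (simp add: hamming_def)
    with 1 show "hamming n c c < t \<and> card {x \<in> ?F. hamming n x c < t} \<le> 2 ^ n * card A ^ t" by (rule conjI[rotated])
  next
    show "finite ?F" using fB by simp
    show "hamming n y x < t" if "hamming n x y < t" for x y :: "nat \<Rightarrow> 'x"
      unfolding hamming_commute[of n y x] by (rule that)
  qed
  then obtain C where C: "C \<subseteq> ?F" "\<forall>x\<in>C. \<forall>y\<in>C. x \<noteq> y \<longrightarrow> \<not> hamming n x y < t"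
    "card ?F \<le> card C * (2 ^ n * card A ^ t)" by (elim exE conjE)
  have "H v - H w \<le> s" if "v \<in> C" "w \<in> C" for v w
  proof -
    have vw: "v \<in> ?B" "w \<in> ?B" "g v = g w" using that C(1) by auto
    have "0 \<le> \<lfloor>H v / s\<rfloor>" "0 \<le> \<lfloor>H w / s\<rfloor>" using H[OF vw(1)] H[OF vw(2)] s by simp_all
    hence "\<lfloor>H v / s\<rfloor> = \<lfloor>H w / s\<rfloor>" using vw(3) by (simp only: g_def eq_nat_nat_iff)
    hence "H v / s - H w / s \<le> 1" by linarith
    thus ?thesis using s by (simp add: field_simps)
  qed
  moreover have "real (card A ^ n) \<le> (K / s + 1) * (real (card C) * real (2 ^ n * card A ^ t))"
  proof -
    have "card A ^ n \<le> k * (card C * (2 ^ n * card A ^ t))"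
      unfolding card_words[OF A(1), of n, symmetric] by (rule order_trans[OF j mult_le_mono2[OF C(3)]])
    hence "real (card A ^ n) \<le> real (k * (card C * (2 ^ n * card A ^ t)))" by (simp only: of_nat_le_iff)
    also have "\<dots> = real k * (real (card C) * real (2 ^ n * card A ^ t))" by simp
    also have "\<dots> \<le> (K / s + 1) * (real (card C) * real (2 ^ n * card A ^ t))"
      by (rule mult_right_mono) (use \<open>K \<ge> 0\<close> s in \<open>auto simp: k_def\<close>)
    finally show ?thesis .
  qed
  moreover have "\<forall>v\<in>C. \<forall>w\<in>C. v \<noteq> w \<longrightarrow> t \<le> hamming n v w" using C(2) by (simp only: not_less)
  moreover have "C \<subseteq> ?B" using C(1) by auto
  ultimately show ?thesis by blast
qed

lemma word_dist2_ge_hamming: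
  fixes \<delta> :: real
  assumes "\<And>i. i < n \<Longrightarrow> v i \<in> A" "\<And>i. i < n \<Longrightarrow> w i \<in> A" "\<delta> \<ge> 0"
    and "\<And>x y. x \<in> A \<Longrightarrow> y \<in> A \<Longrightarrow> x \<noteq> y \<Longrightarrow> \<delta> \<le> hs_dist (mat_sqrt d (W x)) (mat_sqrt d (W y))"
  shows "hamming n v w * \<delta>\<^sup>2 \<le> word_dist2 W d n v w"
proof -
  have "hamming n v w * \<delta>\<^sup>2 = (\<Sum>i\<in>{i. i < n \<and> v i \<noteq> w i}. \<delta>\<^sup>2)" by (simp add: hamming_def)
  also have "\<dots> \<le> (\<Sum>i\<in>{i. i < n \<and> v i \<noteq> w i}. (hs_dist (mat_sqrt d (W (v i))) (mat_sqrt d (W (w i))))\<^sup>2)"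
    by (rule sum_mono) (use assms in \<open>auto intro!: power_mono\<close>)
  also have "\<dots> \<le> word_dist2 W d n v w" unfolding word_dist2_def by (rule sum_mono2) auto
  finally show ?thesis .
qed

text \<open>The packing lives on root matrices and the code on letters, so one preimage letter is
  fixed for each packing point. The factor \<open>d * sqrt n + 1\<close> counts entropy bins and
  \<open>2 ^ n * real (card S) ^ t\<close> bounds a Hamming ball.\<close>

lemma di_code_exists:
  fixes W :: "'x \<Rightarrow> complex mat" and \<delta> :: real
  assumes dens: "\<And>x. x \<in> X \<Longrightarrow> density d (W x)"
    and S: "S \<subseteq> mat_sqrt d ` W ` X" "finite S" "S \<noteq> {}"
      "\<And>x y. x \<in> S \<Longrightarrow> y \<in> S \<Longrightarrow> x \<noteq> y \<Longrightarrow> \<delta> \<le> hs_dist x y" "\<delta> \<ge> 0"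
    and c: "n > 0" "c > 0" and t: "t > 0"
    and l1: "4 * real d / c\<^sup>2 \<le> l1" and l2: "4 * real d / c\<^sup>2 + exp (sqrt n / 2 + c * sqrt n - real t * \<delta>\<^sup>2 / 2) \<le> l2"
  shows "\<exists>N u E. di_code W X d n N l1 l2 u E \<and>
     real (card S) ^ n \<le> (d * sqrt n + 1) * (real N * (2 ^ n * real (card S) ^ t))"
proof -
  have "\<forall>x\<in>X. \<exists>U p. unitary_mat d U \<and> prob_weight d p \<and> W x = spec_mat d U p"
    using density_spectral[OF dens] unfolding prob_weight_def by metis
  then obtain U p where spec: "\<And>x. x \<in> X \<Longrightarrow> unitary_mat d (U x) \<and> prob_weight d (p x) \<and> W x = spec_mat d (U x) (p x)"
    by metis
  obtain A where A: "A \<subseteq> X" "inj_on (\<lambda>x. mat_sqrt d (W x)) A" "S = (\<lambda>x. mat_sqrt d (W x)) ` A"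
    using S(1) unfolding image_image subset_image_inj by blast
  have cA: "card A = card S" "finite A" "A \<noteq> {}"
    using A S(2,3) card_image[OF A(2)] finite_image_iff[OF A(2)] by auto
  define H where "H w = (\<Sum>i<n. entropy_ln d (p (w i)))" for w
  have H: "0 \<le> H w \<and> H w \<le> n * d" if "w \<in> words n A" for w
  proof -
    have "prob_weight d (p (w i))" if "i < n" for i using spec A(1) \<open>w \<in> words n A\<close> that by auto
    hence b: "0 \<le> entropy_ln d (p (w i))" "entropy_ln d (p (w i)) \<le> d" if "i < n" for i
      using entropy_ln_bounds that by auto
    have "H w \<le> (\<Sum>i<n. real d)" unfolding H_def by (rule sum_mono) (use b in auto)
    moreover have "0 \<le> H w" unfolding H_def by (rule sum_nonneg) (use b in auto)
    ultimately show ?thesis by simp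
  qed
  \<comment> \<open>Bin width \<open>sqrt n\<close> matches the typical fluctuations: a finer one
    gains nothing, and the range \<open>n * d\<close> gives only order \<open>sqrt n\<close>
    bins.\<close>
  obtain C where C: "C \<subseteq> words n A" "\<forall>v\<in>C. \<forall>w\<in>C. H v - H w \<le> sqrt n"
    "\<forall>v\<in>C. \<forall>w\<in>C. v \<noteq> w \<longrightarrow> t \<le> hamming n v w"
    "real (card A ^ n) \<le> (n * d / sqrt n + 1) * (real (card C) * real (2 ^ n * card A ^ t))"
    using gilbert_varshamov_fiber[OF cA(2,3), of "sqrt n" t n H "n * d"] H c t by auto
  have CA: "w i \<in> A" if "w \<in> C" "i < n" for w i using C(1) that by auto
  have sep: "\<delta> \<le> hs_dist (mat_sqrt d (W x)) (mat_sqrt d (W y))" if "x \<in> A" "y \<in> A" "x \<noteq> y" for x y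
    using S(4) A(2,3) that by (auto simp: inj_on_def)
  have "\<exists>u E. di_code W X d n (card C) l1 l2 u E"
  proof (rule di_code_from_words[where U = U and p = p and c = c and D = "t * \<delta>\<^sup>2"])
    show "finite C" using C(1) by (rule finite_subset) (use cA in \<open>auto intro!: finite_PiE\<close>)
    fix w w' assume w: "w \<in> C" "w' \<in> C"
    show "(\<Sum>i<n. entropy_ln d (p (w i))) - (\<Sum>i<n. entropy_ln d (p (w' i))) \<le> sqrt n"
      using C(2) w by (simp add: H_def)
    assume "w \<noteq> w'"
    hence "t * \<delta>\<^sup>2 \<le> hamming n w w' * \<delta>\<^sup>2" using C(3) w by (intro mult_right_mono) auto
    also have "\<dots> \<le> word_dist2 W d n w w'"
      by (rule word_dist2_ge_hamming[of _ _ A]) (use CA w sep S(5) in auto)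
    finally show "t * \<delta>\<^sup>2 \<le> word_dist2 W d n w w'" .
  qed (use spec A(1) CA c l1 l2 in auto)
  moreover have "n * d / sqrt n = d * sqrt n" using c by (simp add: field_simps)
  ultimately show ?thesis using C(4) cA(1) by auto
qed

section \<open>Packing numbers and code sizes\<close>

definition separated :: "real \<Rightarrow> complex mat set \<Rightarrow> bool" where
  "separated \<delta> S \<longleftrightarrow> (\<forall>x\<in>S. \<forall>y\<in>S. x \<noteq> y \<longrightarrow> hs_dist x y \<ge> \<delta>)"

lemma hs_dist_nonneg: "hs_dist A B \<ge> 0"
  by (simp add: hs_dist_def sum_nonneg)

lemma hs_dist_commute:
  assumes "A \<in> carrier_mat m n" "B \<in> carrier_mat m n"
  shows "hs_dist A B = hs_dist B A"
  using assms by (simp add: hs_dist_def norm_minus_commute)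

text \<open>Entrywise (p + q)^2 \<le> 2 p^2 + 2 q^2. Where it is applied both legs are bounded by
  the same \<delta>, and the resulting bound 4 \<delta>^2 is the one the ordinary triangle
  inequality would give.\<close>

lemma hs_dist_sq_triangle:
  assumes "A \<in> carrier_mat m n" "B \<in> carrier_mat m n" "C \<in> carrier_mat m n"
  shows "(hs_dist A C)\<^sup>2 \<le> 2 * (hs_dist A B)\<^sup>2 + 2 * (hs_dist B C)\<^sup>2"
proof -
  have "(cmod (a - c))\<^sup>2 \<le> 2 * (cmod (a - b))\<^sup>2 + 2 * (cmod (b - c))\<^sup>2" for a b c
  proof -
    have "(cmod (a - c))\<^sup>2 \<le> (cmod (a - b) + cmod (b - c))\<^sup>2"
      using norm_triangle_ineq[of "a - b" "b - c"] by (intro power_mono) auto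
    also have "\<dots> \<le> 2 * (cmod (a - b))\<^sup>2 + 2 * (cmod (b - c))\<^sup>2"
      using zero_le_power2[of "cmod (a - b) - cmod (b - c)"] by (simp add: power2_eq_square algebra_simps)
    finally show ?thesis .
  qed
  hence "(\<Sum>i<m. \<Sum>j<n. (cmod (A $$ (i,j) - C $$ (i,j)))\<^sup>2)
    \<le> (\<Sum>i<m. \<Sum>j<n. 2 * (cmod (A $$ (i,j) - B $$ (i,j)))\<^sup>2 + 2 * (cmod (B $$ (i,j) - C $$ (i,j)))\<^sup>2)"
    by (intro sum_mono)
  thus ?thesis using assms by (simp add: hs_dist_def sum_nonneg sum.distrib sum_distrib_left)
qed

text \<open>The squared moduli of all entries of a root add up to the trace of the state, which is
  1. This boundedness makes packing numbers finite.\<close>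

lemma mat_sqrt_entry_le_1:
  assumes "density d \<sigma>" "i < d" "j < d"
  shows "cmod (mat_sqrt d \<sigma> $$ (i,j)) \<le> 1"
proof -
  let ?r = "mat_sqrt d \<sigma>"
  note r = mat_sqrt_density[OF assms(1)]
  have h: "?r $$ (k,l) * ?r $$ (l,k) = of_real ((cmod (?r $$ (k,l)))\<^sup>2)" if "k < d" "l < d" for k l
  proof -
    have "adj ?r $$ (l,k) = cnj (?r $$ (k,l))" by (rule adj_entry) (use r that in auto)
    thus ?thesis unfolding r(2) complex_norm_square by (rule arg_cong)
  qed
  have "of_real (\<Sum>k<d. \<Sum>l<d. (cmod (?r $$ (k,l)))\<^sup>2) = tr (?r * ?r)"
    unfolding tr_mult[OF r(1) r(1)] of_real_sum by (intro sum.cong refl h[symmetric]) auto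
  also have "\<dots> = 1" unfolding r(3) by (rule r(4))
  finally have s: "(\<Sum>k<d. \<Sum>l<d. (cmod (?r $$ (k,l)))\<^sup>2) = 1" by (simp only: of_real_eq_1_iff)
  have "(cmod (?r $$ (i,j)))\<^sup>2 \<le> (\<Sum>l<d. (cmod (?r $$ (i,l)))\<^sup>2)"
    by (rule member_le_sum) (use assms in auto)
  also have "\<dots> \<le> (\<Sum>k<d. \<Sum>l<d. (cmod (?r $$ (k,l)))\<^sup>2)"
    by (rule member_le_sum[of i "{..<d}" "\<lambda>k. \<Sum>l<d. (cmod (?r $$ (k,l)))\<^sup>2"]) (use assms in \<open>auto intro: sum_nonneg\<close>)
  finally have "(cmod (?r $$ (i,j)))\<^sup>2 \<le> 1\<^sup>2" using s by simp
  thus ?thesis by (rule power2_le_imp_le) simp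
qed

text \<open>Finiteness by rounding all entries to a grid: a cell contains at most one point of \<open>S\<close>.\<close>

lemma separated_card_bounded:
  assumes F: "\<And>A. A \<in> F \<Longrightarrow> A \<in> carrier_mat d d"
    and b: "\<And>A i j. A \<in> F \<Longrightarrow> i < d \<Longrightarrow> j < d \<Longrightarrow> cmod (A $$ (i,j)) \<le> 1"
    and \<delta>: "\<delta> > 0"
  shows "\<exists>B. \<forall>S. S \<subseteq> F \<and> finite S \<and> separated \<delta> S \<longrightarrow> card S \<le> B"
proof -
  \<comment> \<open>Two points in one cell differ by at most 2 / K in each entry, so their distance
    is at most 2 d / K; \<open>K\<close> makes this smaller than \<delta>.\<close>
  obtain K :: nat where K: "K > (2 * d + 1) / \<delta>" using reals_Archimedean2 by blast
  have K0: "K > 0" using K \<delta> by (cases K) (auto simp: field_simps)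
  define cell where "cell x = (\<lfloor>real K * Re x\<rfloor>, \<lfloor>real K * Im x\<rfloor>)" for x
  define T where "T = ({..<d} \<times> {..<d}) \<rightarrow>\<^sub>E ({- int K..int K} \<times> {- int K..int K})"
  define g where "g A = restrict (\<lambda>ij. cell (A $$ ij)) ({..<d} \<times> {..<d})" for A
  have fT: "finite T" unfolding T_def by (intro finite_PiE) auto
  have cell_in: "cell x \<in> {- int K..int K} \<times> {- int K..int K}" if "cmod x \<le> 1" for x
  proof -
    have "- int K \<le> \<lfloor>real K * y\<rfloor> \<and> \<lfloor>real K * y\<rfloor> \<le> int K" if "\<bar>y\<bar> \<le> 1" for y :: real
    proof -
      have "real K * \<bar>y\<bar> \<le> real K * 1" using that by (intro mult_left_mono) auto
      hence "\<bar>real K * y\<bar> \<le> real K" by (simp add: abs_mult)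
      thus ?thesis by linarith
    qed
    thus ?thesis using abs_Re_le_cmod[of x] abs_Im_le_cmod[of x] that by (auto simp: cell_def)
  qed
  have gT: "g A \<in> T" if "A \<in> F" for A
    using cell_in b[OF that] by (auto simp: g_def T_def)
  have close: "cmod (x - y) \<le> 2 / K" if "cell x = cell y" for x y
  proof -
    have "\<bar>a - c\<bar> \<le> 1 / K" if "\<lfloor>real K * a\<rfloor> = \<lfloor>real K * c\<rfloor>" for a c
    proof -
      have "\<bar>real K * a - real K * c\<bar> \<le> 1" using that by linarith
      hence "real K * \<bar>a - c\<bar> \<le> 1" using K0 by (simp add: abs_mult flip: right_diff_distrib)
      thus ?thesis using K0 by (simp add: field_simps)
    qed
    hence "\<bar>Re (x - y)\<bar> \<le> 1 / K" "\<bar>Im (x - y)\<bar> \<le> 1 / K" using that by (auto simp: cell_def)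
    thus ?thesis using cmod_le[of "x - y"] by simp
  qed
  have "card S \<le> card T" if S: "S \<subseteq> F" "finite S" "separated \<delta> S" for S
  proof (rule card_inj_on_le[OF _ _ fT])
    show "g ` S \<subseteq> T" using gT S by auto
    show "inj_on g S"
    proof (rule inj_onI, rule ccontr)
      fix A B assume AB: "A \<in> S" "B \<in> S" "g A = g B" "A \<noteq> B"
      have c: "A \<in> carrier_mat d d" "B \<in> carrier_mat d d" using AB S F by auto
      have "cmod (A $$ (i,j) - B $$ (i,j)) \<le> 2 / K" if "i < d" "j < d" for i j
        using fun_cong[OF AB(3), of "(i,j)"] that by (intro close) (simp add: g_def)
      hence "(\<Sum>i<d. \<Sum>j<d. (cmod (A $$ (i,j) - B $$ (i,j)))\<^sup>2) \<le> (\<Sum>i<d. \<Sum>j<d. (2 / K)\<^sup>2)"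
        by (intro sum_mono power_mono) auto
      also have "\<dots> = (2 * d / K)\<^sup>2" by (simp add: power2_eq_square)
      finally have "hs_dist A B \<le> 2 * d / K" unfolding hs_dist_def using c by (simp add: real_le_lsqrt)
      also have "\<dots> < \<delta>" using K K0 \<delta> by (simp add: field_simps)
      finally have "hs_dist A B < \<delta>" .
      moreover have "\<delta> \<le> hs_dist A B" using S(3) AB(1,2,4) unfolding separated_def by blast
      ultimately show False by simp
    qed
  qed
  thus ?thesis by blast
qed

text \<open>A bounded supremum of naturals in \<open>enat\<close> is a maximum; this turns the value
  of \<open>packing_num\<close> into an actual packing.\<close>

lemma Sup_enat_attained:
  assumes "P k" "\<And>n. P n \<Longrightarrow> n \<le> B"
  shows "\<exists>n. P n \<and> Sup {enat m |m. P m} = enat n"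
proof -
  have fin: "finite {n. P n}" by (rule finite_subset[of _ "{..B}"]) (use assms in auto)
  have "P (Max {n. P n})" using Max_in[OF fin] assms(1) by auto
  moreover have "Sup {enat m |m. P m} = enat (Max {n. P n})"
    using calculation fin by (intro antisym Sup_least Sup_upper) auto
  ultimately show ?thesis by blast
qed

lemma packing_num_attained:
  assumes F: "\<And>A. A \<in> F \<Longrightarrow> A \<in> carrier_mat d d" "F \<noteq> {}"
    and b: "\<And>A i j. A \<in> F \<Longrightarrow> i < d \<Longrightarrow> j < d \<Longrightarrow> cmod (A $$ (i,j)) \<le> 1"
    and \<delta>: "\<delta> > 0"
  obtains S where "S \<subseteq> F" "finite S" "S \<noteq> {}" "separated \<delta> S" "packing_num \<delta> F = enat (card S)"
    "\<And>S'. S' \<subseteq> F \<Longrightarrow> finite S' \<Longrightarrow> separated \<delta> S' \<Longrightarrow> card S' \<le> card S"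
proof -
  have "\<exists>B. \<forall>S. S \<subseteq> F \<and> finite S \<and> separated \<delta> S \<longrightarrow> card S \<le> B"
    by (rule separated_card_bounded[OF _ _ \<delta>]) (fact F(1), fact b)
  then obtain B where B: "\<forall>S. S \<subseteq> F \<and> finite S \<and> separated \<delta> S \<longrightarrow> card S \<le> B" by (elim exE)
  let ?P = "\<lambda>m. \<exists>S. S \<subseteq> F \<and> finite S \<and> separated \<delta> S \<and> m = card S"
  have p: "packing_num \<delta> F = Sup {enat m |m. ?P m}"
    unfolding packing_num_def separated_def by (rule arg_cong[of _ _ Sup]) auto
  have "?P 0" by (rule exI[of _ "{}"]) (auto simp: separated_def)
  moreover have "k \<le> B" if "?P k" for k using that B by (elim exE conjE) simp
  ultimately have "\<exists>m. ?P m \<and> packing_num \<delta> F = enat m"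
    unfolding p by (rule Sup_enat_attained)
  then obtain m S where S: "S \<subseteq> F" "finite S" "separated \<delta> S" "m = card S" and m: "packing_num \<delta> F = enat m"
    by (elim exE conjE)
  have max: "card S' \<le> card S" if "S' \<subseteq> F" "finite S'" "separated \<delta> S'" for S'
  proof -
    have "enat (card S') \<in> {enat m |m. ?P m}" using that by auto
    hence "enat (card S') \<le> packing_num \<delta> F" unfolding p by (rule Sup_upper)
    thus ?thesis using m S(4) by simp
  qed
  obtain x where "x \<in> F" using F(2) by blast
  hence "card {x} \<le> card S" by (intro max) (auto simp: separated_def)
  hence "S \<noteq> {}" by auto
  thus thesis using S m max by (intro that) simp_all
qed

text \<open>The constant in \<delta> is chosen so that two codewords with the same rounding have
  squared letter distances below 4 \<delta>^2, hence total below 4 n \<delta>^2 =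
  \<open>(1 - l1 - l2)\<^sup>2 / 4\<close>, the minimum that the code forces.\<close>

lemma di_code_card_le:
  assumes dens: "\<And>x. x \<in> X \<Longrightarrow> density d (W x)" and l: "l1 + l2 < 1"
    and n: "n > 0" and \<delta>: "\<delta> = (1 - l1 - l2) / (4 * sqrt n)"
    and S: "S \<subseteq> mat_sqrt d ` W ` X" "finite S" "separated \<delta> S"
    and max: "\<And>S'. S' \<subseteq> mat_sqrt d ` W ` X \<Longrightarrow> finite S' \<Longrightarrow> separated \<delta> S' \<Longrightarrow> card S' \<le> card S"
    and code: "di_code W X d n N l1 l2 u E"
  shows "N \<le> card S ^ n"
proof -
  let ?F = "mat_sqrt d ` W ` X" and ?r = "\<lambda>x. mat_sqrt d (W x)"
  have FC: "A \<in> carrier_mat d d" if "A \<in> ?F" for A using that mat_sqrt_density(1)[OF dens] by auto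
  have \<delta>0: "\<delta> > 0" using l n by (simp add: \<delta>)
  \<comment> \<open>A packing of maximal size is also a covering: a point far from all of
    \<open>S\<close> could be added to it.\<close>
  have near: "\<exists>s\<in>S. hs_dist A s < \<delta>" if A: "A \<in> ?F" for A
  proof (rule ccontr)
    assume far: "\<not> ?thesis"
    hence "A \<notin> S" using \<delta>0 by (auto simp: hs_dist_def)
    moreover have "separated \<delta> (insert A S)"
      unfolding separated_def
    proof (intro ballI impI)
      fix x y assume xy: "x \<in> insert A S" "y \<in> insert A S" "x \<noteq> y"
      have "\<delta> \<le> hs_dist A s \<and> \<delta> \<le> hs_dist s A" if "s \<in> S" for s
      proof -
        have "\<delta> \<le> hs_dist A s" using far that by (auto simp: not_less)
        moreover have "hs_dist A s = hs_dist s A"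
          by (rule hs_dist_commute[OF FC[OF A] FC]) (use S(1) that in blast)
        ultimately show ?thesis by simp
      qed
      thus "\<delta> \<le> hs_dist x y" using xy S(3) unfolding separated_def by blast
    qed
    hence "card (insert A S) \<le> card S" using max[of "insert A S"] A S by simp
    ultimately show False using S(2) by simp
  qed
  define f where "f A = (SOME s. s \<in> S \<and> hs_dist A s < \<delta>)" for A
  have f: "f A \<in> S \<and> hs_dist A (f A) < \<delta>" if "A \<in> ?F" for A
    unfolding f_def by (rule someI_ex) (use near[OF that] in blast)
  \<comment> \<open>Restriction makes the rounded codeword extensional, hence an element of the
    finite set \<open>words n S\<close>.\<close>
  define g where "g j = restrict (\<lambda>i. f (?r (u j i))) {..<n}" for j
  have uX: "u j i \<in> X" if "j < N" "i < n" for j i using code that by (auto simp: di_code_def)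
  have "inj_on g {..<N}"
  proof (rule inj_onI, rule ccontr)
    fix j k assume jk: "j \<in> {..<N}" "k \<in> {..<N}" "g j = g k" "j \<noteq> k"
    have "(hs_dist (?r (u j i)) (?r (u k i)))\<^sup>2 < 4 * \<delta>\<^sup>2" if i: "i < n" for i
    proof -
      let ?a = "?r (u j i)" and ?b = "?r (u k i)"
      have F: "?a \<in> ?F" "?b \<in> ?F" using uX i jk by auto
      have fe: "f ?a = f ?b" using fun_cong[OF jk(3), of i] i by (simp add: g_def)
      have fF: "f ?a \<in> ?F" using f[OF F(1)] S(1) by auto
      have "(hs_dist ?a (f ?a))\<^sup>2 < \<delta>\<^sup>2" "(hs_dist (f ?a) ?b)\<^sup>2 < \<delta>\<^sup>2"
        using f[OF F(1)] f[OF F(2)] hs_dist_commute[OF FC[OF F(2)] FC[OF fF]] fe hs_dist_nonneg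
        by (auto intro!: power_strict_mono)
      thus ?thesis using hs_dist_sq_triangle[OF FC[OF F(1)] FC[OF fF] FC[OF F(2)]] by linarith
    qed
    hence "word_dist2 W d n (u j) (u k) < (\<Sum>i<n. 4 * \<delta>\<^sup>2)"
      unfolding word_dist2_def using n by (intro sum_strict_mono) auto
    also have "\<dots> = (1 - l1 - l2)\<^sup>2 / 4" using n by (simp add: \<delta> power_divide power_mult_distrib)
    finally show False using di_code_word_dist[OF code dens l, of j k] jk by simp
  qed
  moreover have "g ` {..<N} \<subseteq> words n S" using f uX by (auto simp: g_def)
  moreover have "finite (words n S)" using S(2) by (intro finite_PiE) auto
  ultimately have "card {..<N} \<le> card (words n S)" by (rule card_inj_on_le)
  thus ?thesis using card_words[OF S(2), of n] by simp
qed

lemma di_rate_ge: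
  assumes "di_code W X d n N l1 l2 u E" "N \<ge> 1" "n \<ge> 2"
  shows "ereal (log 2 N / (n * log 2 n)) \<le> di_rate W X d l1 l2 n"
proof (cases "N_DI W X d n l1 l2")
  case (enat N')
  have "enat N \<le> N_DI W X d n l1 l2" unfolding N_DI_def by (rule Sup_upper) (use assms in blast)
  hence "log 2 N \<le> log 2 N'" using assms(2) enat by simp
  thus ?thesis using enat assms(3) by (simp add: di_rate_def divide_right_mono)
qed (simp add: di_rate_def)

lemma di_rate_le:
  fixes B :: nat
  assumes "\<And>N u E. di_code W X d n N l1 l2 u E \<Longrightarrow> N \<le> B" "B \<ge> 1" "n \<ge> 2"
  shows "di_rate W X d l1 l2 n \<le> ereal (log 2 B / (n * log 2 n))"
proof -
  have "N_DI W X d n l1 l2 \<le> enat B" unfolding N_DI_def by (rule Sup_least) (use assms(1) in auto)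
  then obtain N where N: "N_DI W X d n l1 l2 = enat N" "N \<le> B" by (cases "N_DI W X d n l1 l2") auto
  \<comment> \<open>The value \<open>N = 0\<close> has logarithm 0 by convention and is covered by
    \<open>B \<ge> 1\<close>.\<close>
  have "log 2 N \<le> log 2 B" using N(2) assms(2) by (cases "N = 0") (auto simp: log_def divide_right_mono)
  thus ?thesis using N assms(3) by (simp add: di_rate_def divide_right_mono)
qed

text \<open>Degenerate cases are harmless: the logarithm of 0 and quotients with denominator 0 take
  the value 0.\<close>

lemma di_rate_nonneg: "0 \<le> di_rate W X d l1 l2 n"
proof (cases "N_DI W X d n l1 l2")
  case (enat N)
  have "0 \<le> log 2 (real N)" by (cases "N = 0") (auto simp: log_def)
  moreover have "0 \<le> real n * log 2 (real n)" by (cases "n = 0") auto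
  ultimately show ?thesis using enat by (simp add: di_rate_def)
qed (simp add: di_rate_def)

section \<open>Asymptotic rates\<close>

lemma mat_sqrt_image:
  assumes "\<And>x. x \<in> X \<Longrightarrow> density d (W x)" "A \<in> mat_sqrt d ` W ` X"
  shows "A \<in> carrier_mat d d" "i < d \<Longrightarrow> j < d \<Longrightarrow> cmod (A $$ (i,j)) \<le> 1"
  using assms mat_sqrt_density(1) mat_sqrt_entry_le_1 by auto

lemma packing_mat_sqrt:
  assumes dens: "\<And>x. x \<in> X \<Longrightarrow> density d (W x)" and "X \<noteq> {}" "\<delta> > 0"
  obtains S where "S \<subseteq> mat_sqrt d ` W ` X" "finite S" "S \<noteq> {}" "separated \<delta> S"
    "packing_num \<delta> (mat_sqrt d ` W ` X) = enat (card S)"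
    "\<And>S'. S' \<subseteq> mat_sqrt d ` W ` X \<Longrightarrow> finite S' \<Longrightarrow> separated \<delta> S' \<Longrightarrow> card S' \<le> card S"
proof (rule packing_num_attained[of "mat_sqrt d ` W ` X" d \<delta>])
  show "mat_sqrt d ` W ` X \<noteq> {}" using assms by auto
  show "A \<in> carrier_mat d d" if "A \<in> mat_sqrt d ` W ` X" for A
    by (rule mat_sqrt_image(1)[OF dens that])
  show "cmod (A $$ (i,j)) \<le> 1" if "A \<in> mat_sqrt d ` W ` X" "i < d" "j < d" for A i j
    by (rule mat_sqrt_image(2)[OF dens that])
qed (use assms that in auto)

text \<open>An upper limit bounds the quotient for all small \<delta>, in particular along \<eta> /
  \<open>sqrt n\<close>. There - log \<delta> is log n / 2 up to a constant, and the exponent n in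
  \<open>card S ^ n\<close> cancels the n in the rate.\<close>

theorem di_limsup_le:
  assumes dens: "\<And>x. x \<in> X \<Longrightarrow> density d (W x)" and X: "X \<noteq> {}" and l: "l1 + l2 < 1"
  shows "di_limsup W X d l1 l2 \<le> ereal (1/2) * upper_mink_dim (mat_sqrt d ` W ` X)"
proof (rule dense_ge)
  let ?F = "mat_sqrt d ` W ` X"
  define \<eta> where "\<eta> = (1 - l1 - l2) / 4"
  have \<eta>: "\<eta> > 0" using l by (simp add: \<eta>_def)
  fix z assume z: "ereal (1/2) * upper_mink_dim ?F < z"
  show "di_limsup W X d l1 l2 \<le> z"
  proof (cases z)
    case (real y)
    define b where "b = 2 * y"
    have "upper_mink_dim ?F < ereal b"
      using z unfolding real b_def by (cases "upper_mink_dim ?F") auto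
    hence "\<forall>\<^sub>F \<delta> in at_right 0. (case packing_num \<delta> ?F of
       enat N \<Rightarrow> ereal (log 2 (real N) / (- log 2 \<delta>)) | \<infinity> \<Rightarrow> \<infinity>) < ereal b"
      unfolding upper_mink_dim_def by (rule Limsup_lessD)
    \<comment> \<open>The bound for small \<delta> is pulled back along this sequence and so holds
      for all large n.\<close>
    moreover have "filterlim (\<lambda>n::nat. \<eta> / sqrt (real n)) (at_right 0) sequentially"
      using \<eta> by real_asymp
    ultimately have "\<forall>\<^sub>F n in sequentially. (case packing_num (\<eta> / sqrt (real n)) ?F of
       enat N \<Rightarrow> ereal (log 2 (real N) / (- log 2 (\<eta> / sqrt (real n)))) | \<infinity> \<Rightarrow> \<infinity>) < ereal b"
      by (rule eventually_compose_filterlim)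
    moreover have "\<forall>\<^sub>F n :: nat in sequentially. \<eta> / sqrt (real n) < 1" using \<eta> by real_asymp
    moreover have "\<forall>\<^sub>F n :: nat in sequentially. n \<ge> 2" by (rule eventually_ge_at_top)
    ultimately have "\<forall>\<^sub>F n in sequentially. di_rate W X d l1 l2 n
       \<le> ereal (b * (log 2 n / 2 - log 2 \<eta>) / log 2 n)"
    proof eventually_elim
      case (elim n)
      define \<delta> where "\<delta> = \<eta> / sqrt n"
      have \<delta>: "0 < \<delta>" "\<delta> < 1" using \<eta> elim by (auto simp: \<delta>_def)
      obtain S where S: "S \<subseteq> ?F" "finite S" "S \<noteq> {}" "separated \<delta> S" "packing_num \<delta> ?F = enat (card S)"
        "\<And>S'. S' \<subseteq> ?F \<Longrightarrow> finite S' \<Longrightarrow> separated \<delta> S' \<Longrightarrow> card S' \<le> card S"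
        using packing_mat_sqrt[of X d W \<delta>] dens X \<delta>(1) by blast
      have M: "card S \<ge> 1" using S(2,3) by (simp add: Suc_leI card_gt_0_iff)
      have "log 2 (card S) / (- log 2 \<delta>) < b" using elim(1) S(5) by (simp add: \<delta>_def)
      moreover have "0 < - log 2 \<delta>" using \<delta> by simp
      ultimately have "log 2 (card S) \<le> b * (- log 2 \<delta>)" using pos_divide_less_eq less_imp_le by blast
      also have "- log 2 \<delta> = log 2 n / 2 - log 2 \<eta>"
        using \<eta> elim by (simp add: \<delta>_def log_def ln_div ln_sqrt diff_divide_distrib)
      finally have lM: "log 2 (card S) \<le> b * (log 2 n / 2 - log 2 \<eta>)" .
      have "di_rate W X d l1 l2 n \<le> ereal (log 2 (real (card S ^ n)) / (n * log 2 n))"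
      proof (rule di_rate_le)
        fix N u E assume code: "di_code W X d n N l1 l2 u E"
        show "N \<le> card S ^ n"
        proof (rule di_code_card_le[OF dens l _ _ S(1,2,4) S(6) code])
          show "\<delta> = (1 - l1 - l2) / (4 * sqrt n)" by (simp add: \<delta>_def \<eta>_def)
        qed (use elim in auto)
      qed (use M elim in auto)
      also have "log 2 (real (card S ^ n)) / (n * log 2 n) = log 2 (card S) / log 2 n"
        using M elim by (simp add: log_nat_power)
      also have "ereal \<dots> \<le> ereal (b * (log 2 n / 2 - log 2 \<eta>) / log 2 n)"
        using lM elim by (simp add: divide_right_mono)
      finally show ?case .
    qed
    hence "di_limsup W X d l1 l2 \<le> limsup (\<lambda>n. ereal (b * (log 2 n / 2 - log 2 \<eta>) / log 2 n))"
      unfolding di_limsup_def by (rule Limsup_mono)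
    also have "(\<lambda>n::nat. b * (log 2 n / 2 - log 2 \<eta>) / log 2 n) \<longlonglongrightarrow> y"
      unfolding b_def by real_asymp
    hence "limsup (\<lambda>n. ereal (b * (log 2 n / 2 - log 2 \<eta>) / log 2 n)) = ereal y"
      by (intro lim_imp_Limsup) auto
    finally show ?thesis by (simp add: real)
  qed (use z in auto)
qed

text \<open>Of the n letters at most \<alpha> n + 1 are spent on the distance requirement, so the
  remaining ones carry \<open>log 2 M\<close> bits each. The deductions n and \<open>log 2 K\<close>
  pay for the choice of positions and for the entropy bins.\<close>

lemma log_code_size_ge:
  fixes \<mu> \<alpha> :: real
  assumes ineq: "M ^ n \<le> K * (N * (2 ^ n * M ^ t))" and M: "M \<ge> 1" and K: "K > 0" and N: "N > 0"
    and t: "t \<le> \<alpha> * n + 1" and \<mu>: "\<mu> \<le> log 2 M" and \<alpha>: "n - \<alpha> * n - 1 \<ge> 0"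
  shows "(n - \<alpha> * n - 1) * \<mu> - n - log 2 K \<le> log 2 N"
proof -
  have "log 2 (M ^ n) \<le> log 2 (K * (N * (2 ^ n * M ^ t)))" using ineq M K N by simp
  hence "n * log 2 M \<le> log 2 K + log 2 N + n + t * log 2 M"
    using M K N by (simp add: log_mult log_nat_power)
  moreover have "t * log 2 M \<le> (\<alpha> * n + 1) * log 2 M" by (rule mult_right_mono) (use t M in auto)
  moreover have "(n - \<alpha> * n - 1) * \<mu> \<le> (n - \<alpha> * n - 1) * log 2 M" by (rule mult_left_mono) (use \<mu> \<alpha> in auto)
  ultimately show ?thesis by (simp add: algebra_simps)
qed

text \<open>The point is the order of quantifiers: \<kappa> depends on the errors, on
  \<open>d\<close> and on \<alpha>, but not on n, \<delta> or the packing, so \<delta> may later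
  shrink with \<kappa> fixed.\<close>

lemma di_code_rate_ge:
  assumes dens: "\<forall>x\<in>X. density d (W x)" and l: "l1 > 0" "l2 > 0" and \<alpha>: "0 < \<alpha>"
  shows "\<exists>\<kappa>>0. \<forall>n \<delta> S \<mu>. S \<subseteq> mat_sqrt d ` W ` X \<and> finite S \<and> S \<noteq> {} \<and> separated \<delta> S \<and> n \<ge> 2 \<and> \<delta> > 0 \<and>
     \<kappa> \<le> \<delta>\<^sup>2 * sqrt n \<and> \<mu> \<le> log 2 (card S) \<and> n - \<alpha> * n - 1 \<ge> 0 \<longrightarrow>
     ereal (((n - \<alpha> * n - 1) * \<mu> - n - log 2 (d * sqrt n + 1)) / (n * log 2 n)) \<le> di_rate W X d l1 l2 n"
proof -
  \<comment> \<open>The tail must fit into \<open>l1\<close> and into half of \<open>l2\<close>; the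
    other half of \<open>l2\<close> is reserved for the affinity term.\<close>
  define \<epsilon> where "\<epsilon> = min l1 (l2 / 2)"
  \<comment> \<open>Writing \<open>d + 1\<close> instead of \<open>d\<close> keeps \<open>c\<close>
    positive for every \<open>d\<close>.\<close>
  define c where "c = sqrt (4 * (d + 1) / \<epsilon>)"
  \<comment> \<open>Chosen so that \<alpha> n \<delta>^2 / 2 outweighs
    \<open>sqrt n / 2 + c * sqrt n\<close> and still pushes the exponential below
    \<open>l2 / 2\<close>.\<close>
  define \<kappa> where "\<kappa> = (1 + 2 * c + 2 * \<bar>ln (l2 / 2)\<bar>) / \<alpha>"
  have \<epsilon>: "\<epsilon> > 0" using l by (simp add: \<epsilon>_def)
  have c: "c > 0" using \<epsilon> by (simp add: c_def)
  have c2: "c\<^sup>2 = 4 * (d + 1) / \<epsilon>" using \<epsilon> by (simp add: c_def)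
  have cl: "4 * real d / c\<^sup>2 \<le> \<epsilon>"
  proof -
    have "4 * real d / c\<^sup>2 = \<epsilon> * (d / (d + 1))" unfolding c2 using \<epsilon> by (simp add: field_simps)
    also have "\<dots> \<le> \<epsilon> * 1" using \<epsilon> by (intro mult_left_mono) auto
    finally show ?thesis by simp
  qed
  have "\<kappa> > 0" using c \<alpha> by (simp add: \<kappa>_def)
  moreover have "ereal (((n - \<alpha> * n - 1) * \<mu> - n - log 2 (d * sqrt n + 1)) / (n * log 2 n)) \<le> di_rate W X d l1 l2 n"
    if h: "S \<subseteq> mat_sqrt d ` W ` X" "finite S" "S \<noteq> {}" "separated \<delta> S" "n \<ge> 2" "\<delta> > 0" "\<kappa> \<le> \<delta>\<^sup>2 * sqrt n"
       "\<mu> \<le> log 2 (card S)" "n - \<alpha> * n - 1 \<ge> 0" for n :: nat and \<delta> S \<mu>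
  proof -
    define t where "t = nat \<lceil>\<alpha> * n\<rceil>"
    have an: "\<alpha> * n > 0" using \<alpha> h(5) by simp
    have t: "\<alpha> * n \<le> t" "t \<le> \<alpha> * n + 1" using an by (auto simp: t_def)
    have t0: "t > 0" using t(1) an by (cases t) auto
    have "sqrt n / 2 + c * sqrt n - real t * \<delta>\<^sup>2 / 2 \<le> ln (l2 / 2)"
    proof -
      have s: "sqrt n \<ge> 1" using h(5) by simp
      have "sqrt n * (1 + 2 * c + 2 * \<bar>ln (l2 / 2)\<bar>) = \<alpha> * sqrt n * \<kappa>" using \<alpha> by (simp add: \<kappa>_def)
      also have "\<dots> \<le> \<alpha> * sqrt n * (\<delta>\<^sup>2 * sqrt n)" using h(7) \<alpha> by (intro mult_left_mono) auto
      also have "\<dots> = (\<alpha> * n) * \<delta>\<^sup>2" by (simp add: mult_ac)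
      also have "\<dots> \<le> t * \<delta>\<^sup>2" using t(1) by (intro mult_right_mono) auto
      finally have 1: "sqrt n * (1 + 2 * c + 2 * \<bar>ln (l2 / 2)\<bar>) \<le> t * \<delta>\<^sup>2" .
      have "sqrt n * \<bar>ln (l2 / 2)\<bar> \<ge> 1 * \<bar>ln (l2 / 2)\<bar>" using s by (intro mult_right_mono) auto
      thus ?thesis using 1 by (simp add: algebra_simps)
    qed
    hence "exp (sqrt n / 2 + c * sqrt n - real t * \<delta>\<^sup>2 / 2) \<le> exp (ln (l2 / 2))" by (simp only: exp_le_cancel_iff)
    hence e: "exp (sqrt n / 2 + c * sqrt n - real t * \<delta>\<^sup>2 / 2) \<le> l2 / 2" using l by simp
    have "\<exists>N u E. di_code W X d n N l1 l2 u E \<and>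
       real (card S) ^ n \<le> (d * sqrt n + 1) * (real N * (2 ^ n * real (card S) ^ t))"
    proof (rule di_code_exists[where c = c and t = t and \<delta> = \<delta>, OF _ h(1,2,3)])
      show "4 * real d / c\<^sup>2 \<le> l1" using cl by (simp add: \<epsilon>_def)
      show "4 * real d / c\<^sup>2 + exp (sqrt n / 2 + c * sqrt n - real t * \<delta>\<^sup>2 / 2) \<le> l2"
        using cl e by (simp add: \<epsilon>_def)
    qed (use h c t0 dens in \<open>auto simp: separated_def\<close>)
    then obtain N u E where N: "di_code W X d n N l1 l2 u E"
      "real (card S) ^ n \<le> (d * sqrt n + 1) * (real N * (2 ^ n * real (card S) ^ t))" by blast
    have M: "real (card S) \<ge> 1" using h(2,3) by (simp add: Suc_leI card_gt_0_iff)
    hence pos: "real (card S) ^ n > 0" by simp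
    have N1: "N \<ge> 1"
    proof (rule ccontr)
      assume "\<not> N \<ge> 1"
      hence "N = 0" by simp
      hence "real (card S) ^ n \<le> 0" using N(2) by simp
      with pos show False by linarith
    qed
    have K: "d * sqrt n + 1 > 0" by (intro add_nonneg_pos) auto
    have "(n - \<alpha> * n - 1) * \<mu> - n - log 2 (d * sqrt n + 1) \<le> log 2 N"
      by (rule log_code_size_ge[OF N(2) M K _ t(2) h(8,9)]) (use N1 in auto)
    hence "ereal (((n - \<alpha> * n - 1) * \<mu> - n - log 2 (d * sqrt n + 1)) / (n * log 2 n)) \<le> ereal (log 2 N / (n * log 2 n))"
      using h(5) by (simp add: divide_right_mono)
    also have "\<dots> \<le> di_rate W X d l1 l2 n" by (rule di_rate_ge[OF N(1) N1 h(5)])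
    finally show ?thesis .
  qed
  ultimately show ?thesis by blast
qed

text \<open>If the limit superior of the rates were below b, all late rates would be. The dimension
  supplies some \<delta> so small that a blocklength matched to it is already late, and the code
  built there has rate above b.\<close>

theorem di_limsup_ge:
  assumes dens: "\<And>x. x \<in> X \<Longrightarrow> density d (W x)" and X: "X \<noteq> {}" and l: "l1 > 0" "l2 > 0"
  shows "ereal (1/4) * upper_mink_dim (mat_sqrt d ` W ` X) \<le> di_limsup W X d l1 l2"
proof (rule dense_le)
  let ?F = "mat_sqrt d ` W ` X"
  fix z assume z: "z < ereal (1/4) * upper_mink_dim ?F"
  have nonneg: "0 \<le> di_limsup W X d l1 l2"
    unfolding di_limsup_def by (rule le_Limsup) (auto simp: di_rate_nonneg)
  show "z \<le> di_limsup W X d l1 l2"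
  proof (cases "z \<le> 0")
    case False
    then obtain b where b: "z = ereal b" "b > 0" using z by (cases z) auto
    have "ereal (4 * b) < upper_mink_dim ?F"
      using z b by (cases "upper_mink_dim ?F") auto
    then obtain a where a: "4 * b < a" "ereal a < upper_mink_dim ?F"
      using ereal_dense2[of "ereal (4 * b)" "upper_mink_dim ?F"] by auto
    \<comment> \<open>The relative Hamming distance. This value makes the limiting rate (1 -
      \<alpha>) a / 4 the midpoint of b and a / 4.\<close>
    define \<alpha> where "\<alpha> = (a - 4 * b) / (2 * a)"
    have \<alpha>: "0 < \<alpha>" "\<alpha> < 1" using a b by (auto simp: \<alpha>_def field_simps)
    have lim_b: "b < (1 - \<alpha>) * a / 4" using a b by (simp add: \<alpha>_def field_simps)
    have dens': "\<forall>x\<in>X. density d (W x)" using dens by blast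
    obtain \<kappa> where \<kappa>: "\<kappa> > 0" and rate: "\<forall>n \<delta> S \<mu>. S \<subseteq> ?F \<and> finite S \<and> S \<noteq> {} \<and> separated \<delta> S \<and> n \<ge> 2 \<and> \<delta> > 0 \<and>
       \<kappa> \<le> \<delta>\<^sup>2 * sqrt n \<and> \<mu> \<le> log 2 (card S) \<and> n - \<alpha> * n - 1 \<ge> 0 \<longrightarrow>
       ereal (((n - \<alpha> * n - 1) * \<mu> - n - log 2 (d * sqrt n + 1)) / (n * log 2 n)) \<le> di_rate W X d l1 l2 n"
      using di_code_rate_ge[OF dens' l \<alpha>(1)] by (elim exE conjE)
    \<comment> \<open>A lower bound on the logarithm of the packing size in terms of n alone: n - 1
      \<le> (\<kappa> / \<delta>^2)^2 gives - log \<delta> \<ge> log (n - 1) / 4 - log \<kappa> /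
      2.\<close>
    define \<mu> where "\<mu> n = a * (log 2 (real n - 1) / 4 - log 2 \<kappa> / 2)" for n :: nat
    define g where "g n = ((n - \<alpha> * n - 1) * \<mu> n - n - log 2 (d * sqrt n + 1)) / (n * log 2 n)" for n :: nat
    have "g \<longlonglongrightarrow> (1 - \<alpha>) * a / 4"
    proof (cases "d = 0")
      case True
      show ?thesis unfolding g_def \<mu>_def True using \<alpha> by simp real_asymp
    next
      case False
      hence "real d > 0" by simp
      thus ?thesis unfolding g_def \<mu>_def using \<alpha> by real_asymp
    qed
    hence "\<forall>\<^sub>F n in sequentially. b < g n" using lim_b by (rule order_tendstoD)
    moreover have "\<forall>\<^sub>F n :: nat in sequentially. n - \<alpha> * n - 1 \<ge> 0" using \<alpha> by real_asymp
    ultimately have "\<forall>\<^sub>F n in sequentially. b < g n \<and> n - \<alpha> * n - 1 \<ge> 0 \<and> n \<ge> 2"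
      using eventually_ge_at_top[of 2] by eventually_elim auto
    then obtain n0 where n0: "\<And>n. n \<ge> n0 \<Longrightarrow> b < g n \<and> n - \<alpha> * n - 1 \<ge> 0 \<and> n \<ge> 2"
      unfolding eventually_sequentially by blast
    show ?thesis
    proof (rule ccontr)
      assume "\<not> ?thesis"
      hence "di_limsup W X d l1 l2 < ereal b" using b by simp
      hence "\<forall>\<^sub>F n in sequentially. di_rate W X d l1 l2 n < ereal b"
        unfolding di_limsup_def by (rule Limsup_lessD)
      then obtain n1 where n1: "\<And>n. n \<ge> n1 \<Longrightarrow> di_rate W X d l1 l2 n < ereal b"
        unfolding eventually_sequentially by blast
      define m where "m = max n0 n1"
      have "\<forall>\<^sub>F \<delta>::real in at_right 0. real m \<le> (\<kappa> / \<delta>\<^sup>2)\<^sup>2"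
      proof -
        have "filterlim (\<lambda>\<delta>::real. (\<kappa> / \<delta>\<^sup>2)\<^sup>2) at_top (at_right 0)" using \<kappa> by real_asymp
        thus ?thesis by (simp add: filterlim_at_top)
      qed
      moreover have "\<forall>\<^sub>F \<delta>::real in at_right 0. 0 < \<delta> \<and> \<delta> < 1"
        by (auto simp: eventually_at_right_field intro!: exI[of _ 1])
      ultimately have ev: "\<forall>\<^sub>F \<delta>::real in at_right 0. real m \<le> (\<kappa> / \<delta>\<^sup>2)\<^sup>2 \<and> 0 < \<delta> \<and> \<delta> < 1"
        by eventually_elim auto
      let ?f = "\<lambda>\<delta>. case packing_num \<delta> ?F of enat N \<Rightarrow> ereal (log 2 (real N) / (- log 2 \<delta>)) | \<infinity> \<Rightarrow> \<infinity>"
      \<comment> \<open>Only existence is available: the quotient exceeds a for some arbitrarily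
        small \<delta>, not eventually.\<close>
      have "\<exists>\<delta>. real m \<le> (\<kappa> / \<delta>\<^sup>2)\<^sup>2 \<and> 0 < \<delta> \<and> \<delta> < 1 \<and> \<not> ?f \<delta> \<le> ereal a"
      proof (rule ccontr)
        assume "\<not> ?thesis"
        hence "\<forall>\<^sub>F \<delta> in at_right 0. ?f \<delta> \<le> ereal a" by (intro eventually_mono[OF ev]) blast
        hence "upper_mink_dim ?F \<le> ereal a" unfolding upper_mink_dim_def by (rule Limsup_bounded)
        thus False using a(2) by simp
      qed
      then obtain \<delta> where \<delta>: "real m \<le> (\<kappa> / \<delta>\<^sup>2)\<^sup>2" "0 < \<delta>" "\<delta> < 1" "\<not> ?f \<delta> \<le> ereal a"
        by (elim exE conjE)
      obtain S where S: "S \<subseteq> ?F" "finite S" "S \<noteq> {}" "separated \<delta> S" "packing_num \<delta> ?F = enat (card S)"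
          "\<And>S'. S' \<subseteq> ?F \<Longrightarrow> finite S' \<Longrightarrow> separated \<delta> S' \<Longrightarrow> card S' \<le> card S"
        using packing_mat_sqrt[of X d W \<delta>] dens X \<delta>(2) by blast
      have "a < log 2 (card S) / (- log 2 \<delta>)" using \<delta>(4) S(5) by simp
      moreover have "0 < - log 2 \<delta>" using \<delta>(2,3) by simp
      ultimately have lS: "a * (- log 2 \<delta>) \<le> log 2 (card S)" using pos_less_divide_eq less_imp_le by blast
      \<comment> \<open>The least n with \<kappa> \<le> \<delta>^2 \<open>sqrt n\<close>. Minimality
        keeps log n close to - 4 log \<delta>, the source of the factor 1/4; rounding up is why n -
        1 occurs in \<mu>.\<close>
      define n where "n = nat \<lceil>(\<kappa> / \<delta>\<^sup>2)\<^sup>2\<rceil>"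
      have n: "(\<kappa> / \<delta>\<^sup>2)\<^sup>2 \<le> real n" "real n - 1 \<le> (\<kappa> / \<delta>\<^sup>2)\<^sup>2"
      proof -
        have "real n = of_int \<lceil>(\<kappa> / \<delta>\<^sup>2)\<^sup>2\<rceil>" by (simp add: n_def)
        thus "(\<kappa> / \<delta>\<^sup>2)\<^sup>2 \<le> real n" "real n - 1 \<le> (\<kappa> / \<delta>\<^sup>2)\<^sup>2" by linarith+
      qed
      have "real m \<le> n" using \<delta>(1) n(1) by linarith
      hence nm: "n \<ge> n0" "n \<ge> n1" by (auto simp: m_def)
      note n0' = n0[OF nm(1)]
      have "\<kappa> / \<delta>\<^sup>2 \<le> sqrt n" using n(1) by (rule real_le_rsqrt)
      hence \<kappa>n: "\<kappa> \<le> \<delta>\<^sup>2 * sqrt n" using \<delta>(2) by (simp add: field_simps)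
      have "\<mu> n \<le> log 2 (card S)"
      proof -
        have "log 2 (real n - 1) \<le> log 2 ((\<kappa> / \<delta>\<^sup>2)\<^sup>2)" using n(2) n0' \<kappa> \<delta>(2) by (subst log_le_cancel_iff) auto
        also have "\<dots> = 2 * log 2 \<kappa> - 4 * log 2 \<delta>"
          using \<kappa> \<delta>(2) by (simp add: log_nat_power log_divide)
        finally have "log 2 (real n - 1) / 4 - log 2 \<kappa> / 2 \<le> - log 2 \<delta>" by simp
        hence "\<mu> n \<le> a * (- log 2 \<delta>)" unfolding \<mu>_def using a b by (intro mult_left_mono) auto
        thus ?thesis using lS by simp
      qed
      hence "ereal (g n) \<le> di_rate W X d l1 l2 n"
        unfolding g_def by (intro rate[rule_format] conjI) (use S(1-4) n0' \<delta>(2) \<kappa>n in auto)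
      also have "\<dots> < ereal b" by (rule n1[OF nm(2)])
      finally show False using n0' by simp
    qed
  qed (use nonneg in auto)
qed

section \<open>Quantum channels\<close>

text \<open>Positivity of the output is complete positivity with a trivial one-dimensional ancilla,
  where \<open>id_tensor\<close> reduces to the channel itself.\<close>

lemma density_channel:
  assumes ch: "quantum_channel dA dB \<N>" and \<rho>: "density dA \<rho>"
  shows "density dB (\<N> \<rho>)"
proof -
  have c: "\<rho> \<in> carrier_mat dA dA" and p: "psd dA \<rho>" and t: "tr \<rho> = 1"
    using \<rho> by (simp_all add: density_def psd_def)
  have Nc: "\<N> \<rho> \<in> carrier_mat dB dB" and "tr (\<N> \<rho>) = 1"
    using ch c t by (simp_all add: quantum_channel_def)
  have "block dA \<rho> 0 0 = \<rho>" using c by (intro eq_matI) (auto simp: block_def)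
  hence "id_tensor 1 dA dB \<N> \<rho> = \<N> \<rho>"
    using Nc by (intro eq_matI) (auto simp: id_tensor_def)
  moreover have "psd (1 * dA) \<rho> \<longrightarrow> psd (1 * dB) (id_tensor 1 dA dB \<N> \<rho>)"
    using ch unfolding quantum_channel_def by blast
  ultimately have "psd dB (\<N> \<rho>)" using p by simp
  thus ?thesis using \<open>tr (\<N> \<rho>) = 1\<close> by (simp add: density_def)
qed

text \<open>The two code conditions differ only in which of j and k names the state in the second
  error, and both range over all ordered pairs.\<close>

lemma C_DI_opt_q_eq: "C_DI_opt_q \<N> X d = C_DI_opt \<N> X d"
proof -
  have "{enat N | N. \<exists>\<rho> E.
          (\<forall>j<N. \<forall>i<n. \<rho> j i \<in> X) \<and>
          (\<forall>j<N. effect (d ^ n) (E j)) \<and>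
          (\<forall>j<N. Re (tr (kron_list (map (\<lambda>i. \<N> (\<rho> j i)) [0..<n]) * E j)) \<ge> 1 - l1) \<and>
          (\<forall>j<N. \<forall>k<N. j \<noteq> k \<longrightarrow> Re (tr (kron_list (map (\<lambda>i. \<N> (\<rho> k i)) [0..<n]) * E j)) \<le> l2)}
      = {enat N | N. \<exists>u E. di_code \<N> X d n N l1 l2 u E}" for n l1 l2
    unfolding di_code_def tensor_word_def by (intro Collect_cong ex_cong1 conj_cong refl) metis
  thus ?thesis
    unfolding C_DI_opt_q_def C_DI_opt_def di_limsup_def di_rate_def[abs_def] N_DI_def by simp
qed

text \<open>The lower bound holds with one value for every pair of positive errors, so it passes to
  the infimum.\<close>

lemma C_DI_opt_ge:
  assumes "\<forall>x\<in>X. density d (W x)" "X \<noteq> {}"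
  shows "ereal (1/4) * upper_mink_dim (mat_sqrt d ` W ` X) \<le> C_DI_opt W X d"
  unfolding C_DI_opt_def using assms by (intro INF_greatest di_limsup_ge) auto

lemma C_DI_opt_le:
  assumes "l1 > 0" "l2 > 0"
  shows "C_DI_opt W X d \<le> di_limsup W X d l1 l2"
  unfolding C_DI_opt_def using assms by (intro INF_lower2[of l1] INF_lower2[of l2]) auto

text \<open>The channel half is the cq half for the map \<open>\<N>\<close> on the letters
  \<open>Xq\<close>. Its upper bound passes through the given pair \<open>l1\<close>,
  \<open>l2\<close>, at which the infimum is evaluated.\<close>

theorem theorem4:
  fixes W :: "'x \<Rightarrow> complex mat" and X :: "'x set" and d :: nat
    and \<N> :: "complex mat \<Rightarrow> complex mat" and Xq :: "complex mat set" and dA dB :: nat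
    and l1 l2 :: real
  assumes W_cq: "\<forall>x\<in>X. density d (W x)" and X_ne: "X \<noteq> {}"
    and l_pos: "l1 > 0" "l2 > 0" and l_sum: "l1 + l2 < 1"
    and N_chan: "quantum_channel dA dB \<N>"
    and Xq_states: "\<forall>\<rho>\<in>Xq. density dA \<rho>" and Xq_ne: "Xq \<noteq> {}"
  shows "ereal (1/4) * upper_mink_dim (mat_sqrt d ` W ` X) \<le> C_DI_opt W X d
       \<and> C_DI_opt W X d \<le> di_limsup W X d l1 l2
       \<and> di_limsup W X d l1 l2 \<le> ereal (1/2) * upper_mink_dim (mat_sqrt d ` W ` X)
       \<and> ereal (1/4) * upper_mink_dim (mat_sqrt dB ` \<N> ` Xq) \<le> C_DI_opt_q \<N> Xq dB
       \<and> C_DI_opt_q \<N> Xq dB \<le> ereal (1/2) * upper_mink_dim (mat_sqrt dB ` \<N> ` Xq)"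
proof -
  have N_cq: "\<forall>\<rho>\<in>Xq. density dB (\<N> \<rho>)" using density_channel[OF N_chan] Xq_states by blast
  have "di_limsup W X d l1 l2 \<le> ereal (1/2) * upper_mink_dim (mat_sqrt d ` W ` X)"
    by (rule di_limsup_le) (use W_cq X_ne l_sum in auto)
  moreover have "di_limsup \<N> Xq dB l1 l2 \<le> ereal (1/2) * upper_mink_dim (mat_sqrt dB ` \<N> ` Xq)"
    by (rule di_limsup_le) (use N_cq Xq_ne l_sum in auto)
  with C_DI_opt_le[OF l_pos]
  have "C_DI_opt_q \<N> Xq dB \<le> ereal (1/2) * upper_mink_dim (mat_sqrt dB ` \<N> ` Xq)"
    unfolding C_DI_opt_q_eq by (rule order_trans)
  ultimately show ?thesis
    using C_DI_opt_ge[OF W_cq X_ne] C_DI_opt_le[OF l_pos, of W X d] C_DI_opt_ge[OF N_cq Xq_ne]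
    unfolding C_DI_opt_q_eq by blast
qed

end
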